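(* Consider the depth-$m$ AA-Picard iteration for the steady Navier–Stokes equations with the $L^2$ norm used for the AA optimization, as described in the context. Suppose there is $\sigma>0$ with $\sigma\|\nabla e_j\|\le\|\nabla(w_{j+1}-w_j)\|$ for all $j$, suppose $\tilde\sigma>0$, suppose $0<|\hat\alpha^k_j|<\bar{\hat\alpha}$ for all $k,j$ for some fixed $\bar{\hat\alpha}$, and suppose the residual differences $\{w_j-w_{j-1}\}_{j=1,\dots,k}$ are not linearly dependent in the $L^2$ inner product. Let $\tilde K$ be a constant with $\|\nabla e_j\|\le\tilde K\|\nabla w_j\|$ for all $j$. Then \[ \|\nabla w_{k+1}\|\le\kappa\,(\theta^{L^2}_{k,m})^{1/2}(\theta^{H^1_0}_{k,m})^{1/2}\left(\frac{\|\sum_{j=k-m}^k\hat\alpha^k_j\nabla w_j\|}{\|\sum_{j=k-m}^k\alpha^k_j\nabla w_j\|}\right)^{1/2}\left(\frac{\|w_k\|}{C_P\|\nabla w_k\|}\right)^{1/2}\|\nabla w_k\| + \tilde K^2M\nu^{-1}\kappa\,\frac{m(m+3)\bar{\hat\alpha}}{2}\sum_{j=k-m+1}^k\sum_{i=k-m}^{j-1}\|\nabla w_i\|\,\|\nabla w_j\|. \]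
   Context: Let $\Omega\subset\mathbb{R}^d$, $d\in\{2,3\}$, be a bounded open connected domain; $(\cdot,\cdot)$ and $\|\cdot\|$ denote the $L^2(\Omega)$ inner product and norm, $\|\cdot\|_{-1}$ the $H^{-1}(\Omega)$ norm and $\langle\cdot,\cdot\rangle$ the $H^{-1}$–$H^1_0$ duality pairing. $X=H^1_0(\Omega)^d$, $Q=\{q\in L^2(\Omega):\int_\Omega q=0\}$. $C_P$ is the Poincaré constant: $\|\phi\|\le C_P\|\nabla\phi\|$ for $\phi\in X$. $b^*(v,w,z)=(v\cdot\nabla w,z)+\tfrac12((\nabla\cdot v)w,z)$. $M:=C_P^{1/2}C_3C_6$, where $\|\phi\|_{L^6}\le C_6\|\nabla\phi\|$ and $\|\phi\|_{L^3}\le C_3\|\phi\|^{1/2}\|\nabla\phi\|^{1/2}$ for $\phi\in X$. Let $X_h\subset X$, $Q_h\subset Q$ be conforming finite element spaces satisfying the inf-sup condition $\sup_{0\ne v\in X_h}(\nabla\cdot v,q)/\|\nabla v\|\ge\beta\|q\|$ for all $q\in Q_h$ with $\beta>0$, and $V_h=\{v\in X_h:(\nabla\cdot v,q)=0\ \forall q\in Q_h\}$. Let $\nu>0$, $f\in H^{-1}(\Omega)$, and $\kappa:=M\nu^{-2}\|f\|_{-1}$ (no smallness assumed). The Picard operator $g:V_h\to V_h$ maps $u$ to the unique $g(u)\in V_h$ with $\nu(\nabla g(u),\nabla v)+b^*(u,g(u),v)=\langle f,v\rangle$ for all $v\in V_h$. AA-Picard of depth $m$ with $L^2$ optimization (no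 damping): set $\tilde u_j:=g(u_{j-1})$, $w_j:=\tilde u_j-u_{j-1}$, $e_j:=u_j-u_{j-1}$; at step $k$ the coefficients $(\hat\alpha^k_j)_{j=k-m}^k$ minimize $\|\sum_{j=k-m}^k\alpha_jw_j\|$ ($L^2$ norm) subject to $\sum_j\alpha_j=1$, and $u_k=\sum_{j=k-m}^k\hat\alpha^k_j\tilde u_j$. $(\alpha^k_j)_{j=k-m}^k$ denote the minimizers of $\|\nabla\sum_{j=k-m}^k\alpha_jw_j\|$ subject to $\sum_j\alpha_j=1$ for the same residuals. Gains: $\theta^{H^1_0}_{k,m}=\|\nabla\sum_{j=k-m}^k\alpha^k_jw_j\|/\|\nabla w_k\|$ and $\theta^{L^2}_{k,m}=\|\sum_{j=k-m}^k\hat\alpha^k_jw_j\|/\|w_k\|$. Further, $\tilde\sigma:=\sigma\min_j\Big\{\frac{\|\nabla e_j\|}{\|e_j\|}\,\frac{\|w_{j+1}-w_j\|}{\|\nabla(w_{j+1}-w_j)\|}\Big\}$. The paper notes that a constant $\tilde K$ as in the claim exists, depending on $\tilde\sigma$, $\theta^{L^2}$ and the degree of $L^2$-linear independence of the residual differences. *)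

theory Defs
  imports "HOL-Analysis.Analysis"
begin

text \<open>Concrete function-space setting on a domain Omega in real^'n.
  Velocity fields are functions real^'n => real^'n; a gradient is a matrix field
  G with G x $ i $ j = d_j u_i (x).  All integrals are Lebesgue integrals over Omega.\<close>

definition l2ip :: "(real^'n) set \<Rightarrow> (real^'n \<Rightarrow> 'a::real_inner) \<Rightarrow> (real^'n \<Rightarrow> 'a) \<Rightarrow> real" where
  "l2ip \<Omega> u v = (LINT x:\<Omega>|lborel. u x \<bullet> v x)"

definition l2norm :: "(real^'n) set \<Rightarrow> (real^'n \<Rightarrow> 'a::real_inner) \<Rightarrow> real" where
  "l2norm \<Omega> u = sqrt (l2ip \<Omega> u u)"

definition Lpnorm :: "(real^'n) set \<Rightarrow> real \<Rightarrow> (real^'n \<Rightarrow> 'a::real_normed_vector) \<Rightarrow> real" where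
  "Lpnorm \<Omega> p u = (LINT x:\<Omega>|lborel. norm (u x) powr p) powr (1 / p)"

definition L2 :: "(real^'n) set \<Rightarrow> (real^'n \<Rightarrow> 'a::{real_normed_vector, second_countable_topology}) \<Rightarrow> bool" where
  "L2 \<Omega> u \<longleftrightarrow> set_borel_measurable lborel \<Omega> u \<and> set_integrable lborel \<Omega> (\<lambda>x. (norm (u x))\<^sup>2)"

definition pderiv :: "(real^'n \<Rightarrow> real) \<Rightarrow> 'n \<Rightarrow> real^'n \<Rightarrow> real" where
  "pderiv \<phi> j x = frechet_derivative \<phi> (at x) (axis j 1)"

definition test_fun :: "(real^'n) set \<Rightarrow> (real^'n \<Rightarrow> real) \<Rightarrow> bool" where
  "test_fun \<Omega> \<phi> \<longleftrightarrow> (\<forall>x. \<phi> differentiable (at x))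
     \<and> (\<forall>j. continuous_on UNIV (pderiv \<phi> j))
     \<and> compact (closure {x. \<phi> x \<noteq> 0}) \<and> closure {x. \<phi> x \<noteq> 0} \<subseteq> \<Omega>"

definition weak_grad :: "(real^'n) set \<Rightarrow> (real^'n \<Rightarrow> real^'n) \<Rightarrow> (real^'n \<Rightarrow> real^'n^'n) \<Rightarrow> bool" where
  "weak_grad \<Omega> u G \<longleftrightarrow> (\<forall>\<phi>. test_fun \<Omega> \<phi> \<longrightarrow> (\<forall>i j.
      (LINT x:\<Omega>|lborel. u x $ i * pderiv \<phi> j x) = - (LINT x:\<Omega>|lborel. G x $ i $ j * \<phi> x)))"

definition H1 :: "(real^'n) set \<Rightarrow> (real^'n \<Rightarrow> real^'n) \<Rightarrow> bool" where
  "H1 \<Omega> u \<longleftrightarrow> L2 \<Omega> u \<and> (\<exists>G. L2 \<Omega> G \<and> weak_grad \<Omega> u G)"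

definition grad :: "(real^'n) set \<Rightarrow> (real^'n \<Rightarrow> real^'n) \<Rightarrow> (real^'n \<Rightarrow> real^'n^'n)" where
  "grad \<Omega> u = (SOME G. L2 \<Omega> G \<and> weak_grad \<Omega> u G)"

definition jac :: "(real^'n \<Rightarrow> real^'n) \<Rightarrow> (real^'n \<Rightarrow> real^'n^'n)" where
  "jac \<psi> x = (\<chi> i j. pderiv (\<lambda>y. \<psi> y $ i) j x)"

definition H10 :: "(real^'n) set \<Rightarrow> (real^'n \<Rightarrow> real^'n) \<Rightarrow> bool" where
  "H10 \<Omega> u \<longleftrightarrow> H1 \<Omega> u \<and> (\<exists>\<psi> :: nat \<Rightarrow> real^'n \<Rightarrow> real^'n.
      (\<forall>n i. test_fun \<Omega> (\<lambda>x. \<psi> n x $ i)) \<and>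
      (\<lambda>n. (l2norm \<Omega> (\<lambda>x. u x - \<psi> n x))\<^sup>2 + (l2norm \<Omega> (\<lambda>x. grad \<Omega> u x - jac (\<psi> n) x))\<^sup>2)
         \<longlonglongrightarrow> 0)"

definition Qsp :: "(real^'n) set \<Rightarrow> (real^'n \<Rightarrow> real) \<Rightarrow> bool" where
  "Qsp \<Omega> q \<longleftrightarrow> L2 \<Omega> q \<and> (LINT x:\<Omega>|lborel. q x) = 0"

definition h1ip :: "(real^'n) set \<Rightarrow> (real^'n \<Rightarrow> real^'n) \<Rightarrow> (real^'n \<Rightarrow> real^'n) \<Rightarrow> real" where
  "h1ip \<Omega> u v = l2ip \<Omega> (grad \<Omega> u) (grad \<Omega> v)"

definition h1snorm :: "(real^'n) set \<Rightarrow> (real^'n \<Rightarrow> real^'n) \<Rightarrow> real" where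
  "h1snorm \<Omega> u = l2norm \<Omega> (grad \<Omega> u)"

definition divg :: "(real^'n) set \<Rightarrow> (real^'n \<Rightarrow> real^'n) \<Rightarrow> real^'n \<Rightarrow> real" where
  "divg \<Omega> v x = (\<Sum>i\<in>UNIV. grad \<Omega> v x $ i $ i)"

definition bstar :: "(real^'n) set \<Rightarrow> (real^'n \<Rightarrow> real^'n) \<Rightarrow> (real^'n \<Rightarrow> real^'n) \<Rightarrow> (real^'n \<Rightarrow> real^'n) \<Rightarrow> real" where
  "bstar \<Omega> v w z = (LINT x:\<Omega>|lborel. (grad \<Omega> w x *v v x) \<bullet> z x)
                   + 1/2 * (LINT x:\<Omega>|lborel. divg \<Omega> v x * (w x \<bullet> z x))"

definition fin_subspace :: "('a \<Rightarrow> 'b::real_vector) set \<Rightarrow> (('a \<Rightarrow> 'b) \<Rightarrow> bool) \<Rightarrow> bool" where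
  "fin_subspace S P \<longleftrightarrow> (\<forall>v\<in>S. P v) \<and>
     (\<exists>B. finite B \<and> S = {(\<lambda>x. \<Sum>b\<in>B. c b *\<^sub>R b x) | c. True})"

text \<open>Discrete inf-sup condition: sup_{v in Xh, v<>0} (div v, q)/||grad v|| >= beta ||q||,
  expressed as: every upper bound of the quotients is at least beta ||q||.\<close>
definition inf_sup :: "(real^'n) set \<Rightarrow> (real^'n \<Rightarrow> real^'n) set \<Rightarrow> (real^'n \<Rightarrow> real) set \<Rightarrow> real \<Rightarrow> bool" where
  "inf_sup \<Omega> Xh Qh \<beta> \<longleftrightarrow> (\<forall>q\<in>Qh. \<forall>c.
     (\<forall>v\<in>Xh. h1snorm \<Omega> v \<noteq> 0 \<longrightarrow> l2ip \<Omega> (divg \<Omega> v) q / h1snorm \<Omega> v \<le> c) \<longrightarrow> \<beta> * l2norm \<Omega> q \<le> c)"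

definition Vh :: "(real^'n) set \<Rightarrow> (real^'n \<Rightarrow> real^'n) set \<Rightarrow> (real^'n \<Rightarrow> real) set \<Rightarrow> (real^'n \<Rightarrow> real^'n) set" where
  "Vh \<Omega> Xh Qh = {v\<in>Xh. \<forall>q\<in>Qh. l2ip \<Omega> (divg \<Omega> v) q = 0}"

definition Hminus1 :: "(real^'n) set \<Rightarrow> ((real^'n \<Rightarrow> real^'n) \<Rightarrow> real) \<Rightarrow> bool" where
  "Hminus1 \<Omega> f \<longleftrightarrow>
     (\<forall>u v. H10 \<Omega> u \<longrightarrow> H10 \<Omega> v \<longrightarrow> f (\<lambda>x. u x + v x) = f u + f v) \<and>
     (\<forall>c u. H10 \<Omega> u \<longrightarrow> f (\<lambda>x. c *\<^sub>R u x) = c * f u) \<and>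
     (\<exists>C. \<forall>v. H10 \<Omega> v \<longrightarrow> \<bar>f v\<bar> \<le> C * h1snorm \<Omega> v)"

definition dual_norm :: "(real^'n) set \<Rightarrow> ((real^'n \<Rightarrow> real^'n) \<Rightarrow> real) \<Rightarrow> real" where
  "dual_norm \<Omega> f = Sup {\<bar>f v\<bar> / h1snorm \<Omega> v | v. H10 \<Omega> v \<and> h1snorm \<Omega> v \<noteq> 0}"

definition picard_sol :: "(real^'n) set \<Rightarrow> real \<Rightarrow> ((real^'n \<Rightarrow> real^'n) \<Rightarrow> real) \<Rightarrow> (real^'n \<Rightarrow> real^'n) set
     \<Rightarrow> (real^'n \<Rightarrow> real^'n) \<Rightarrow> (real^'n \<Rightarrow> real^'n) \<Rightarrow> bool" where
  "picard_sol \<Omega> \<nu> f V u v \<longleftrightarrow> v \<in> V \<and> (\<forall>\<phi>\<in>V. \<nu> * h1ip \<Omega> v \<phi> + bstar \<Omega> u v \<phi> = f \<phi>)"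

definition lin_comb :: "(nat \<Rightarrow> real) \<Rightarrow> nat set \<Rightarrow> (nat \<Rightarrow> 'a \<Rightarrow> 'b::real_vector) \<Rightarrow> 'a \<Rightarrow> 'b" where
  "lin_comb c A w = (\<lambda>x. \<Sum>j\<in>A. c j *\<^sub>R w j x)"

definition AA_opt :: "((real^'n \<Rightarrow> real^'n) \<Rightarrow> real) \<Rightarrow> (nat \<Rightarrow> real^'n \<Rightarrow> real^'n) \<Rightarrow> nat \<Rightarrow> nat \<Rightarrow> (nat \<Rightarrow> real) \<Rightarrow> bool" where
  "AA_opt N w k mk c \<longleftrightarrow> (\<Sum>j\<in>{k-mk..k}. c j) = 1 \<and>
     (\<forall>b. (\<Sum>j\<in>{k-mk..k}. b j) = 1 \<longrightarrow> N (lin_comb c {k-mk..k} w) \<le> N (lin_comb b {k-mk..k} w))"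

text \<open>Residuals w_j = g(u_{j-1}) - u_{j-1} = ut_j - u_{j-1} and increments e_j = u_j - u_{j-1}.\<close>
definition resid :: "(nat \<Rightarrow> 'a \<Rightarrow> 'b::real_vector) \<Rightarrow> (nat \<Rightarrow> 'a \<Rightarrow> 'b) \<Rightarrow> nat \<Rightarrow> 'a \<Rightarrow> 'b" where
  "resid ut u j = (\<lambda>x. ut j x - u (j - 1) x)"

definition incr :: "(nat \<Rightarrow> 'a \<Rightarrow> 'b::real_vector) \<Rightarrow> nat \<Rightarrow> 'a \<Rightarrow> 'b" where
  "incr u j = (\<lambda>x. u j x - u (j - 1) x)"

definition sigma_tilde :: "(real^'n) set \<Rightarrow> real \<Rightarrow> (nat \<Rightarrow> real^'n \<Rightarrow> real^'n) \<Rightarrow> (nat \<Rightarrow> real^'n \<Rightarrow> real^'n) \<Rightarrow> nat \<Rightarrow> real" where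
  "sigma_tilde \<Omega> \<sigma> u ut k = \<sigma> * Min ((\<lambda>j. (h1snorm \<Omega> (incr u j) / l2norm \<Omega> (incr u j)) *
      (l2norm \<Omega> (\<lambda>x. resid ut u (j + 1) x - resid ut u j x) / h1snorm \<Omega> (\<lambda>x. resid ut u (j + 1) x - resid ut u j x))) ` {1..k})"

end

(*
  Subtracting the averaged Picard equations that define u_k from the Picard equation of g(u_k) and testing with
  z = w_{k+1} gives nu |grad z|^2 = sum_j ah_j b(u_{j-1} - u_k, ut_j, z). Writing
  ut_j = ut_{k-m} + (ut_j - ut_{k-m}), the first part collapses to -b(sum_j ah_j w_j, ut_{k-m}, z), because
  sum_j ah_j (u_{j-1} - u_k) = -sum_j ah_j w_j. By skew-symmetry and the interpolated L3 bound it contributes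
  kappa CP^(-1/2) (|W| |grad W|)^(1/2) for the averaged residual W, and this is the product of gain factors of
  the claim. In the second part both differences telescope into increments e_p, e_q with q < j <= p, where g is
  Lipschitz with constant kappa. This gives the quadratic term.

  The trilinear estimates need that H10 fields are in L6 (Fatou along test fields) and that weak gradients are
  unique almost everywhere (fundamental lemma of the calculus of variations). Skew-symmetry of b in its last two
  arguments is the definition of the weak gradient when these are test fields, and extends by density, one
  argument at a time.
*)
theory Submission
  imports Defs
begin


section \<open>Test functions\<close>

text \<open>The base iterate of the splitting is the oldest one of the window. Then
  \<open>u (j - 1) - u k\<close> telescopes into increments of index at least j and
  \<open>ut j - ut (k - m)\<close> into images of increments of index below j. No diagonal product
  occurs, and every pair belongs to the triangular sum of the claim. Each of the m indices j > k - m
  contributes at most that whole sum and j = k - m contributes nothing; this gives the factor m,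
  which is at most m (m + 3) / 2. Two conventions shape the analytic part. \<open>grad\<close> is a
  Hilbert choice among weak gradients, so its linearity holds almost everywhere and rests on
  uniqueness. The integral of a non-integrable function is 0, so integral estimates have to be
  preceded by integrability. The divergence term of \<open>bstar\<close> sees its first argument
  only through the divergence, which costs a full |grad W|. Only after skew-symmetry has cancelled
  it does the leading term carry the geometric mean of |W| and |grad W|.\<close>

lemma test_fun_differentiable: "test_fun A \<phi> \<Longrightarrow> \<phi> differentiable (at x)"
  by (auto simp: test_fun_def)

lemma test_fun_continuous: "test_fun A \<phi> \<Longrightarrow> continuous_on UNIV \<phi>"
  by (metis test_fun_differentiable continuous_at_imp_continuous_on differentiable_imp_continuous_within)

lemma test_fun_continuous_pderiv: "test_fun A \<phi> \<Longrightarrow> continuous_on UNIV (pderiv \<phi> j)"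
  by (auto simp: test_fun_def)

lemma pderiv_eqI:
  assumes "(\<phi> has_derivative D) (at x)"
  shows "pderiv \<phi> j x = D (axis j 1)"
  unfolding pderiv_def using frechet_derivative_at[OF assms] by simp

lemma pderiv_add:
  assumes "\<phi> differentiable (at x)" "\<psi> differentiable (at x)"
  shows "pderiv (\<lambda>x. \<phi> x + \<psi> x) j x = pderiv \<phi> j x + pderiv \<psi> j x"
  using assms unfolding frechet_derivative_works
  by (subst pderiv_eqI[OF has_derivative_add]) (auto simp: pderiv_def)

lemma pderiv_cmult:
  assumes "\<phi> differentiable (at x)"
  shows "pderiv (\<lambda>x. c * \<phi> x) j x = c * pderiv \<phi> j x"
  using assms unfolding frechet_derivative_works
  by (subst pderiv_eqI[OF has_derivative_mult_right]) (auto simp: pderiv_def)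

lemma pderiv_mult:
  assumes "\<phi> differentiable (at x)" "\<psi> differentiable (at x)"
  shows "pderiv (\<lambda>x. \<phi> x * \<psi> x) j x = pderiv \<phi> j x * \<psi> x + \<phi> x * pderiv \<psi> j x"
  using assms unfolding frechet_derivative_works
  by (subst pderiv_eqI[OF has_derivative_mult]) (auto simp: pderiv_def)

text \<open>The support condition of \<open>test_fun\<close> is monotone: a closed subset of a
  compact set is compact. It suffices to enclose the nonzero set of a sum, product or
  multiple.\<close>

lemma closure_support_subset:
  assumes "{x. f x \<noteq> 0} \<subseteq> S" "compact (closure S)" "closure S \<subseteq> \<Omega>"
  shows "compact (closure {x. f x \<noteq> 0}) \<and> closure {x. f x \<noteq> 0} \<subseteq> \<Omega>"
  using closure_mono[OF assms(1)] assms(2,3) compact_Int_closed[OF assms(2) closed_closure, of "{x. f x \<noteq> 0}"]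
  by (auto simp: Int_absorb1)

lemma test_fun_add:
  fixes \<phi> \<psi> :: "real^'n \<Rightarrow> real"
  assumes "test_fun \<Omega> \<phi>" "test_fun \<Omega> \<psi>"
  shows "test_fun \<Omega> (\<lambda>x. \<phi> x + \<psi> x)"
proof -
  have "compact (closure ({x. \<phi> x \<noteq> 0} \<union> {x. \<psi> x \<noteq> 0}))"
    using assms by (auto simp: test_fun_def closure_Un)
  moreover have "closure ({x. \<phi> x \<noteq> 0} \<union> {x. \<psi> x \<noteq> 0}) \<subseteq> \<Omega>"
    using assms by (auto simp: test_fun_def closure_Un)
  ultimately have "compact (closure {x. \<phi> x + \<psi> x \<noteq> 0}) \<and> closure {x. \<phi> x + \<psi> x \<noteq> 0} \<subseteq> \<Omega>"
    by (intro closure_support_subset[where S="{x. \<phi> x \<noteq> 0} \<union> {x. \<psi> x \<noteq> 0}"]) auto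
  moreover have "pderiv (\<lambda>x. \<phi> x + \<psi> x) j = (\<lambda>x. pderiv \<phi> j x + pderiv \<psi> j x)" for j
    using assms by (auto simp: fun_eq_iff pderiv_add test_fun_def)
  ultimately show ?thesis
    using assms unfolding test_fun_def by (auto intro!: continuous_intros)
qed

lemma test_fun_mult:
  fixes \<phi> \<psi> :: "real^'n \<Rightarrow> real"
  assumes "test_fun \<Omega> \<phi>" "test_fun \<Omega> \<psi>"
  shows "test_fun \<Omega> (\<lambda>x. \<phi> x * \<psi> x)"
proof -
  have "compact (closure {x. \<phi> x * \<psi> x \<noteq> 0}) \<and> closure {x. \<phi> x * \<psi> x \<noteq> 0} \<subseteq> \<Omega>"
    by (rule closure_support_subset[where S="{x. \<phi> x \<noteq> 0}"]) (use assms in \<open>auto simp: test_fun_def\<close>)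
  moreover have "pderiv (\<lambda>x. \<phi> x * \<psi> x) j = (\<lambda>x. pderiv \<phi> j x * \<psi> x + \<phi> x * pderiv \<psi> j x)" for j
    using assms by (auto simp: fun_eq_iff pderiv_mult test_fun_def)
  ultimately show ?thesis
    using assms test_fun_continuous[OF assms(1)] test_fun_continuous[OF assms(2)]
    unfolding test_fun_def by (auto intro!: continuous_intros)
qed

lemma test_fun_cmult:
  fixes \<phi> :: "real^'n \<Rightarrow> real"
  assumes "test_fun \<Omega> \<phi>"
  shows "test_fun \<Omega> (\<lambda>x. c * \<phi> x)"
proof -
  have "compact (closure {x. c * \<phi> x \<noteq> 0}) \<and> closure {x. c * \<phi> x \<noteq> 0} \<subseteq> \<Omega>"
    by (rule closure_support_subset[where S="{x. \<phi> x \<noteq> 0}"]) (use assms in \<open>auto simp: test_fun_def\<close>)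
  moreover have "pderiv (\<lambda>x. c * \<phi> x) j = (\<lambda>x. c * pderiv \<phi> j x)" for j
    using assms by (auto simp: fun_eq_iff pderiv_cmult test_fun_def)
  ultimately show ?thesis
    using assms unfolding test_fun_def by (auto intro!: continuous_intros)
qed

lemma test_fun_zero: "test_fun \<Omega> (\<lambda>x. 0)"
  unfolding test_fun_def pderiv_def by (auto simp: frechet_derivative_const)

lemma test_fun_sum:
  assumes "\<And>i. i \<in> I \<Longrightarrow> test_fun \<Omega> (\<phi> i)"
  shows "test_fun \<Omega> (\<lambda>x. \<Sum>i\<in>I. \<phi> i x)"
  using assms by (induction I rule: infinite_finite_induct) (auto intro: test_fun_add test_fun_zero)

lemma pderiv_sum:
  assumes "finite I" "\<And>i. i \<in> I \<Longrightarrow> test_fun \<Omega> (\<phi> i)"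
  shows "pderiv (\<lambda>x. \<Sum>i\<in>I. \<phi> i x) j x = (\<Sum>i\<in>I. pderiv (\<phi> i) j x)"
  using assms
proof (induction I)
  case empty
  then show ?case by (simp add: pderiv_def frechet_derivative_const)
next
  case (insert i I)
  then show ?case
    using test_fun_sum[of I \<Omega> \<phi>] test_fun_differentiable[of \<Omega>]
    by (subst sum.insert) (auto simp: pderiv_add)
qed

lemma compact_support: "test_fun \<Omega> \<phi> \<Longrightarrow> compact (closure {x. \<phi> x \<noteq> 0})"
  by (simp add: test_fun_def)

lemma eq_0_outside_support: "x \<notin> closure {x. \<phi> x \<noteq> 0} \<Longrightarrow> \<phi> x = 0"
  using closure_subset[of "{x. \<phi> x \<noteq> 0}"] by blast

text \<open>The complement of the closed support is open, so the function coincides with 0 near x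
  and has its derivative.\<close>

lemma pderiv_eq_0_outside:
  assumes "x \<notin> closure {x. \<phi> x \<noteq> 0}"
  shows "pderiv \<phi> j x = 0"
proof -
  have z: "0 = \<phi> y" if "y \<in> - closure {x. \<phi> x \<noteq> 0}" for y
    using eq_0_outside_support[of y \<phi>] that by auto
  have "(\<phi> has_derivative (\<lambda>x. 0)) (at x)"
    by (rule has_derivative_transform_within_open[OF has_derivative_const open_Compl[OF closed_closure] _ z])
       (use assms in auto)
  from pderiv_eqI[OF this] show ?thesis by simp
qed

lemma pderiv_test_fun_eq_0: "test_fun \<Omega> \<phi> \<Longrightarrow> x \<notin> \<Omega> \<Longrightarrow> pderiv \<phi> j x = 0"
  by (rule pderiv_eq_0_outside) (auto simp: test_fun_def)

lemma bounded_of_compact_support: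
  fixes f :: "'a::topological_space \<Rightarrow> real"
  assumes "continuous_on UNIV f" "compact K" "\<And>x. x \<notin> K \<Longrightarrow> f x = 0"
  shows "\<exists>B\<ge>0. \<forall>x. \<bar>f x\<bar> \<le> B"
proof -
  have "bounded (f ` K)"
    using assms by (metis compact_continuous_image compact_imp_bounded continuous_on_subset subset_UNIV)
  then obtain B where B: "B > 0" "\<And>x. x \<in> K \<Longrightarrow> \<bar>f x\<bar> \<le> B"
    by (auto simp: bounded_pos)
  show ?thesis
    by (rule exI[of _ B]) (use B assms(3) in \<open>force\<close>)
qed

lemma test_fun_bounded:
  assumes "test_fun \<Omega> \<phi>"
  shows "\<exists>B\<ge>0. \<forall>x. \<bar>\<phi> x\<bar> \<le> B"
  by (rule bounded_of_compact_support[OF test_fun_continuous[OF assms] compact_support[OF assms] eq_0_outside_support[of _ \<phi>]])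

lemma test_fun_pderiv_bounded:
  assumes "test_fun \<Omega> \<phi>"
  shows "\<exists>B\<ge>0. \<forall>x. \<bar>pderiv \<phi> j x\<bar> \<le> B"
  by (rule bounded_of_compact_support[OF test_fun_continuous_pderiv[OF assms] compact_support[OF assms] pderiv_eq_0_outside])

lemma integrable_of_compact_support:
  fixes f :: "'a::euclidean_space \<Rightarrow> real"
  assumes "continuous_on UNIV f" "compact K" "\<And>x. x \<notin> K \<Longrightarrow> f x = 0"
  shows "integrable lborel f"
proof -
  have "integrable lborel (\<lambda>x. indicator K x *\<^sub>R f x)"
    using assms by (intro borel_integrable_compact) (auto intro: continuous_on_subset)
  moreover have "(\<lambda>x. indicator K x *\<^sub>R f x) = f"
    using assms(3) by (auto simp: indicator_def fun_eq_iff)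
  ultimately show ?thesis by simp
qed

lemma test_fun_integrable: "test_fun \<Omega> \<phi> \<Longrightarrow> integrable lborel \<phi>"
  by (rule integrable_of_compact_support[OF test_fun_continuous compact_support eq_0_outside_support[of _ \<phi>]])

text \<open>Restriction to a line parallel to axis j, where the one-dimensional difference quotient
  and the mean value theorem of \<open>integral_pderiv_zero\<close> apply.\<close>

lemma pderiv_directional:
  assumes "\<phi> differentiable (at (x + s *\<^sub>R axis j 1))"
  shows "((\<lambda>t. \<phi> (x + t *\<^sub>R axis j 1)) has_real_derivative pderiv \<phi> j (x + s *\<^sub>R axis j 1)) (at s)"
proof -
  define D where "D = frechet_derivative \<phi> (at (x + s *\<^sub>R axis j 1))"
  have 1: "(\<phi> has_derivative D) (at (x + s *\<^sub>R axis j 1))"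
    using assms unfolding D_def frechet_derivative_works .
  interpret D: bounded_linear D using 1 by (rule has_derivative_bounded_linear)
  have "((\<lambda>t. x + t *\<^sub>R axis j 1) has_derivative (\<lambda>t. t *\<^sub>R axis j 1)) (at s)"
    by (auto intro!: derivative_eq_intros)
  from diff_chain_at[OF this 1]
  have "((\<lambda>t. \<phi> (x + t *\<^sub>R axis j 1)) has_derivative (\<lambda>t. D (t *\<^sub>R axis j 1))) (at s)"
    by (simp add: o_def)
  moreover have "(\<lambda>t. D (t *\<^sub>R axis j 1)) = (*) (D (axis j 1))"
    by (auto simp: D.scaleR mult.commute)
  ultimately show ?thesis
    by (simp add: has_field_derivative_def pderiv_def D_def)
qed

text \<open>Translation invariance makes every difference quotient integrate to zero.\<close>

lemma integral_pderiv_zero: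
  fixes \<phi> :: "real^'n \<Rightarrow> real"
  assumes "test_fun \<Omega> \<phi>"
  shows "(LINT x|lborel. pderiv \<phi> j x) = 0"
proof -
  define e :: "real^'n" where "e = axis j 1"
  have ne: "norm e = 1" by (simp add: e_def)
  define s where "s n = \<phi> \<circ> (\<lambda>x. x + (1 / real (Suc n)) *\<^sub>R e)" for n
  define q where "q n x = (s n x - \<phi> x) / (1 / real (Suc n))" for n x
  obtain B where B: "B \<ge> 0" "\<And>x. \<bar>pderiv \<phi> j x\<bar> \<le> B"
    using test_fun_pderiv_bounded[OF assms] by blast
  have "bounded {x. \<phi> x \<noteq> 0}"
    using assms by (auto simp: test_fun_def)
  then obtain R where R: "\<And>x. \<phi> x \<noteq> 0 \<Longrightarrow> norm x \<le> R"
    by (auto simp: bounded_iff)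
  have sint: "integrable lborel (s n)" "(LINT x|lborel. s n x) = (LINT x|lborel. \<phi> x)" for n
  proof -
    define c where "c = (1 / real (Suc n)) *\<^sub>R e"
    have eq: "distr lborel borel ((+) c) = lborel" by (rule lborel_distr_plus)
    have m: "\<phi> \<in> borel_measurable borel"
      using test_fun_continuous[OF assms] by (rule borel_measurable_continuous_onI)
    have seq: "s n = (\<lambda>x. \<phi> (c + x))"
      by (simp add: s_def o_def add.commute c_def del: of_nat_Suc)
    show "integrable lborel (s n)"
      using test_fun_integrable[OF assms] integrable_distr_eq[of "(+) c" lborel borel \<phi>] m
      unfolding seq by (simp add: eq)
    show "(LINT x|lborel. s n x) = (LINT x|lborel. \<phi> x)"
      using integral_distr[of "(+) c" lborel borel \<phi>] m
      unfolding seq by (simp add: eq)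
  qed
  have q0: "(LINT x|lborel. q n x) = 0" for n
    unfolding q_def using sint[of n] test_fun_integrable[OF assms] by simp
  have lim: "(\<lambda>n. q n x) \<longlonglongrightarrow> pderiv \<phi> j x" for x
  proof -
    have "((\<lambda>t. \<phi> (x + t *\<^sub>R e)) has_real_derivative pderiv \<phi> j x) (at 0)"
      using pderiv_directional[of \<phi> x 0 j] test_fun_differentiable[OF assms] by (simp add: e_def)
    then have l: "(\<lambda>h. (\<phi> (x + h *\<^sub>R e) - \<phi> x) / h) \<midarrow>0\<rightarrow> pderiv \<phi> j x"
      by (simp add: DERIV_def)
    have "filterlim (\<lambda>n. 1 / real (Suc n)) (at 0) sequentially"
      unfolding filterlim_at using LIMSEQ_inverse_real_of_nat by (auto simp: inverse_eq_divide)
    from filterlim_compose[OF l this] show ?thesis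
      by (simp add: q_def s_def)
  qed
  \<comment> \<open>Dominating function for the quotients. The mean value theorem bounds them by B;
    the shift has length at most 1, so outside the ball of radius R + 1 both values of \<phi>
    vanish.\<close>
  have bnd: "\<bar>q n x\<bar> \<le> B * indicator (cball 0 (R + 1)) x" for n x
  proof (cases "x \<in> cball 0 (R + 1)")
    case True
    have d: "((\<lambda>t. \<phi> (x + t *\<^sub>R e)) has_real_derivative pderiv \<phi> j (x + t *\<^sub>R e)) (at t)" for t
      unfolding e_def by (rule pderiv_directional[OF test_fun_differentiable[OF assms]])
    obtain z where "\<phi> (x + (1 / real (Suc n)) *\<^sub>R e) - \<phi> (x + 0 *\<^sub>R e)
        = (1 / real (Suc n) - 0) * pderiv \<phi> j (x + z *\<^sub>R e)"
      using MVT2[of 0 "1 / real (Suc n)", OF _ d] by auto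
    then have "q n x = pderiv \<phi> j (x + z *\<^sub>R e)"
      by (simp add: q_def s_def)
    then show ?thesis using B True by simp
  next
    case False
    then have "norm x > R + 1" by simp
    moreover have "norm x \<le> norm (x + (1 / real (Suc n)) *\<^sub>R e) + 1"
    proof -
      define c where "c = (1 / real (Suc n)) *\<^sub>R e"
      have "norm c \<le> 1" by (simp add: ne c_def)
      then show ?thesis
        using norm_triangle_ineq4[of "x + c" c] unfolding c_def[symmetric] by simp
    qed
    ultimately have "\<phi> x = 0" "s n x = 0"
      using R[of x] R[of "x + (1 / real (Suc n)) *\<^sub>R e"] by (auto simp: s_def)
    then show ?thesis using False by (simp add: q_def)
  qed
  have "(\<lambda>n. LINT x|lborel. q n x) \<longlonglongrightarrow> (LINT x|lborel. pderiv \<phi> j x)"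
  proof (rule integral_dominated_convergence[where w="\<lambda>x. B * indicator (cball 0 (R + 1)) x"])
    show "pderiv \<phi> j \<in> borel_measurable lborel"
      using borel_measurable_continuous_onI[OF test_fun_continuous_pderiv[OF assms]] by simp
    show "q n \<in> borel_measurable lborel" for n
      unfolding q_def using sint[of n] test_fun_integrable[OF assms]
      by (intro borel_measurable_divide borel_measurable_diff borel_measurable_integrable) auto
    show "integrable lborel (\<lambda>x. B * indicator (cball 0 (R + 1)) x :: real)"
      by (intro integrable_mult_right integrable_real_indicator) (use emeasure_lborel_cball_finite in \<open>auto simp: less_top[symmetric]\<close>)
    show "AE x in lborel. (\<lambda>n. q n x) \<longlonglongrightarrow> pderiv \<phi> j x" using lim by simp
    show "AE x in lborel. norm (q n x) \<le> B * indicator (cball 0 (R + 1)) x" for n using bnd by simp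
  qed
  then show ?thesis using q0 by (simp add: LIMSEQ_const_iff)
qed


section \<open>The fundamental lemma of the calculus of variations\<close>

text \<open>\<open>test_fun\<close> without the support condition: the factors of a product bump
  depend on a single coordinate each, so compact support can be expected of their product
  only.\<close>

definition C1_fun :: "(real^'n \<Rightarrow> real) \<Rightarrow> bool" where
  "C1_fun \<phi> \<longleftrightarrow> (\<forall>x. \<phi> differentiable (at x)) \<and> (\<forall>j. continuous_on UNIV (pderiv \<phi> j))"

lemma C1_fun_const: "C1_fun (\<lambda>x. c)"
  by (simp add: C1_fun_def pderiv_def frechet_derivative_const)

lemma C1_fun_mult:
  assumes "C1_fun \<phi>" "C1_fun \<psi>"
  shows "C1_fun (\<lambda>x. \<phi> x * \<psi> x)"
proof -
  have "pderiv (\<lambda>x. \<phi> x * \<psi> x) j = (\<lambda>x. pderiv \<phi> j x * \<psi> x + \<phi> x * pderiv \<psi> j x)" for j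
    using assms by (auto simp: fun_eq_iff pderiv_mult C1_fun_def)
  moreover have "continuous_on UNIV \<phi>" "continuous_on UNIV \<psi>"
    using assms by (auto simp: C1_fun_def intro!: continuous_at_imp_continuous_on differentiable_imp_continuous_within)
  ultimately show ?thesis
    using assms unfolding C1_fun_def by (auto intro!: continuous_intros)
qed

lemma C1_fun_prod:
  assumes "\<And>i. i \<in> I \<Longrightarrow> C1_fun (\<phi> i)"
  shows "C1_fun (\<lambda>x. \<Prod>i\<in>I. \<phi> i x)"
  using assms by (induction I rule: infinite_finite_induct) (auto intro: C1_fun_const C1_fun_mult)

lemma C1_fun_coordinate:
  fixes i :: "'n::finite"
  assumes d: "\<And>t. (g has_real_derivative g' t) (at t)" and c: "continuous_on UNIV g'"
  shows "C1_fun (\<lambda>x::real^'n. g (x $ i))"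
proof -
  have hd: "((\<lambda>x::real^'n. g (x $ i)) has_derivative (\<lambda>h. g' (x $ i) * h $ i)) (at x)" for x
  proof -
    have "((\<lambda>x::real^'n. x $ i) has_derivative (\<lambda>h. h $ i)) (at x)"
      by (rule bounded_linear_imp_has_derivative[OF bounded_linear_vec_nth])
    from diff_chain_at[OF this d[unfolded has_field_derivative_def]]
    show ?thesis by (simp add: o_def)
  qed
  have "pderiv (\<lambda>x::real^'n. g (x $ i)) j = (\<lambda>x. g' (x $ i) * axis j 1 $ i)" for j
    using pderiv_eqI[OF hd] by auto
  moreover have "continuous_on UNIV (\<lambda>x::real^'n. g' (x $ i))"
    by (rule continuous_on_compose2[OF c]) (auto intro!: continuous_intros)
  ultimately show ?thesis
    using hd unfolding C1_fun_def differentiable_def by (auto intro!: continuous_intros)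
qed

text \<open>Squaring smooths the kink of the positive part: at 0 the difference quotient is bounded
  by |h|.\<close>

lemma max_0_power2_derivative:
  "((\<lambda>s::real. (max 0 s)\<^sup>2) has_real_derivative 2 * max 0 s) (at s)"
proof -
  consider "s < 0" | "s = 0" | "s > 0" by linarith
  then show ?thesis
  proof cases
    case 1
    have "((\<lambda>s::real. 0) has_real_derivative 0) (at s)" by simp
    then have "((\<lambda>s::real. (max 0 s)\<^sup>2) has_real_derivative 0) (at s)"
      by (rule has_field_derivative_transform_within_open[where S="{..<0}"]) (use 1 in auto)
    then show ?thesis using 1 by simp
  next
    case 3
    have "((\<lambda>s::real. s\<^sup>2) has_real_derivative 2 * s) (at s)"
      by (auto intro!: derivative_eq_intros)
    then have "((\<lambda>s::real. (max 0 s)\<^sup>2) has_real_derivative 2 * s) (at s)"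
      by (rule has_field_derivative_transform_within_open[where S="{0<..}"]) (use 3 in auto)
    then show ?thesis using 3 by simp
  next
    case 2
    have "((\<lambda>h::real. (max 0 h)\<^sup>2 / h) \<longlongrightarrow> 0) (at 0)"
    proof (rule Lim_null_comparison)
      show "\<forall>\<^sub>F h in at 0. norm ((max 0 h)\<^sup>2 / h) \<le> \<bar>h\<bar>"
      proof (rule always_eventually, rule allI)
        fix h :: real
        show "norm ((max 0 h)\<^sup>2 / h) \<le> \<bar>h\<bar>"
          by (cases "h > 0") (auto simp: power2_eq_square)
      qed
      show "((\<lambda>h::real. \<bar>h\<bar>) \<longlongrightarrow> 0) (at 0)"
        by (rule tendsto_rabs_zero) simp
    qed
    then show ?thesis using 2 by (simp add: DERIV_def)
  qed
qed

text \<open>X / (1 + X), where X is n times the squared positive part of a parabola that is positive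
  on the open interval from a to b. The values stay between 0 and 1, and large n drives them to the
  indicator of the interval. Since \<open>test_fun\<close> asks for one continuous derivative, a
  squared positive part is smooth enough.\<close>

definition bump1 :: "real \<Rightarrow> real \<Rightarrow> nat \<Rightarrow> real \<Rightarrow> real" where
  "bump1 a b n t = real n * (max 0 ((t - a) * (b - t)))\<^sup>2 / (1 + real n * (max 0 ((t - a) * (b - t)))\<^sup>2)"

lemma bump1_bounds: "0 \<le> bump1 a b n t" "bump1 a b n t \<le> 1"
proof -
  define X where "X = real n * (max 0 ((t - a) * (b - t)))\<^sup>2"
  have "X \<ge> 0" by (simp add: X_def)
  then show "0 \<le> bump1 a b n t" "bump1 a b n t \<le> 1"
    unfolding bump1_def X_def[symmetric] by auto
qed

lemma bump1_C1:
  "\<exists>g'. (\<forall>t. (bump1 a b n has_real_derivative g' t) (at t)) \<and> continuous_on UNIV g'"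
proof -
  define s where "s t = (t - a) * (b - t)" for t
  define s' where "s' t = a + b - 2 * t" for t
  define G where "G t = (max 0 (s t))\<^sup>2" for t
  define G' where "G' t = 2 * max 0 (s t) * s' t" for t
  define g' where "g' t = (real n * G' t * (1 + real n * G t) - real n * G t * (real n * G' t)) / (1 + real n * G t)\<^sup>2" for t
  have pos: "1 + real n * G t > 0" for t
  proof -
    have "real n * G t \<ge> 0" by (simp add: G_def)
    then show ?thesis by linarith
  qed
  have ds: "(s has_real_derivative s' t) (at t)" for t
    unfolding s_def s'_def by (auto intro!: derivative_eq_intros simp: algebra_simps)
  have dG: "(G has_real_derivative G' t) (at t)" for t
    using DERIV_chain2[OF max_0_power2_derivative ds, of t] unfolding G_def G'_def .
  have "(bump1 a b n has_real_derivative g' t) (at t)" for t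
  proof -
    have "((\<lambda>t. real n * G t / (1 + real n * G t)) has_real_derivative g' t) (at t)"
      unfolding g'_def using pos[of t]
      by (auto intro!: derivative_eq_intros dG simp: power2_eq_square)
    then show ?thesis by (simp add: bump1_def[abs_def] G_def s_def)
  qed
  moreover have "continuous_on UNIV s" "continuous_on UNIV s'"
    unfolding s_def s'_def by (auto intro!: continuous_intros)
  then have "continuous_on UNIV G" "continuous_on UNIV G'"
    unfolding G_def G'_def by (auto intro!: continuous_intros)
  then have "continuous_on UNIV g'"
    unfolding g'_def using pos by (auto intro!: continuous_intros simp: less_imp_neq[THEN not_sym])
  ultimately show ?thesis by blast
qed

definition bump :: "real^'n \<Rightarrow> real^'n \<Rightarrow> nat \<Rightarrow> real^'n \<Rightarrow> real" where
  "bump a b n x = (\<Prod>i\<in>UNIV. bump1 (a $ i) (b $ i) n (x $ i))"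

text \<open>The order a < b matters: for b < a the product (t - a) (b - t) is positive between b and
  a.\<close>

lemma bump1_eq_0: "a < b \<Longrightarrow> \<not> (a < t \<and> t < b) \<Longrightarrow> bump1 a b n t = 0"
proof -
  assume "a < b" "\<not> (a < t \<and> t < b)"
  then have "(t - a) * (b - t) \<le> 0"
    by (cases "t \<le> a") (auto simp: mult_le_0_iff)
  then show ?thesis by (simp add: bump1_def max_def)
qed

lemma bump1_tendsto: 
  assumes "a < t" "t < b"
  shows "(\<lambda>n. bump1 a b n t) \<longlonglongrightarrow> 1"
proof -
  define c where "c = (max 0 ((t - a) * (b - t)))\<^sup>2"
  have c: "c > 0" using assms by (simp add: c_def)
  have pos: "1 + real n * c > 0" for n using c by (simp add: add_pos_nonneg)
  have eq: "bump1 a b n t = 1 - 1 / (1 + real n * c)" for n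
    unfolding bump1_def c_def[symmetric] using pos[of n] by (simp add: field_simps)
  have "filterlim (\<lambda>n. 1 + real n * c) at_top sequentially"
    by (rule filterlim_tendsto_add_at_top[OF tendsto_const])
       (rule filterlim_at_top_mult_tendsto_pos[OF tendsto_const c filterlim_real_sequentially])
  then have "(\<lambda>n. 1 / (1 + real n * c)) \<longlonglongrightarrow> 0"
    using tendsto_inverse_0_at_top by (auto simp: inverse_eq_divide)
  from tendsto_diff[OF tendsto_const this, of 1] show ?thesis by (simp add: eq)
qed

lemma bump_eq_0:
  assumes "box a b \<noteq> {}" "x \<notin> box a b"
  shows "bump a b n x = 0"
proof -
  have "a $ i < b $ i" for i
    using assms(1) by (auto simp: interval_ne_empty_cart)
  moreover obtain i where "\<not> (a $ i < x $ i \<and> x $ i < b $ i)"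
    using assms(2) by (auto simp: mem_box_cart)
  ultimately have "bump1 (a $ i) (b $ i) n (x $ i) = 0" by (intro bump1_eq_0)
  then show ?thesis unfolding bump_def by (intro prod_zero) auto
qed

lemma bump_bounds: "0 \<le> bump a b n x" "bump a b n x \<le> 1"
  unfolding bump_def by (auto intro!: prod_nonneg prod_le_1 bump1_bounds)

lemma bump_tendsto: 
  assumes "box a b \<noteq> {}"
  shows "(\<lambda>n. bump a b n x) \<longlonglongrightarrow> indicator (box a b) x"
proof (cases "x \<in> box a b")
  case True
  then have "(\<lambda>n. bump a b n x) \<longlonglongrightarrow> (\<Prod>i\<in>(UNIV::'a set). 1)"
    unfolding bump_def by (intro tendsto_prod bump1_tendsto) (auto simp: mem_box_cart)
  then show ?thesis using True by simp
next
  case False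
  then show ?thesis using bump_eq_0[OF assms] by simp
qed

text \<open>The support is contained in the closure of the open box, so it is the closed box that
  has to lie in \<Omega>.\<close>

lemma test_fun_bump:
  assumes "box a b \<noteq> {}" "cbox a b \<subseteq> \<Omega>"
  shows "test_fun \<Omega> (bump a b n)"
proof -
  have "C1_fun (\<lambda>x::real^'a. bump1 (a $ i) (b $ i) n (x $ i))" for i
  proof -
    obtain g' where "\<forall>t. (bump1 (a $ i) (b $ i) n has_real_derivative g' t) (at t)" "continuous_on UNIV g'"
      using bump1_C1 by blast
    then show ?thesis by (intro C1_fun_coordinate) auto
  qed
  then have "C1_fun (bump a b n)" 
    unfolding bump_def[abs_def] by (intro C1_fun_prod)
  moreover have "compact (closure {x. bump a b n x \<noteq> 0}) \<and> closure {x. bump a b n x \<noteq> 0} \<subseteq> \<Omega>"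
    by (rule closure_support_subset[where S="box a b"]) (use assms bump_eq_0[OF assms(1)] in \<open>auto simp: closure_box\<close>)
  ultimately show ?thesis by (simp add: C1_fun_def test_fun_def)
qed

text \<open>Dynkin's argument: open boxes are an intersection-stable generator of the Borel sets,
  and the sets over which k integrates to 0 are closed under complements and countable disjoint
  unions. The hypothesis \<open>total\<close> starts the complement step, because the whole space is
  not a box.\<close>

lemma AE_zero_if_box_integrals_zero:
  fixes k :: "'a::euclidean_space \<Rightarrow> real"
  assumes k: "integrable lborel k"
    and box: "\<And>a b. (LINT x:box a b|lborel. k x) = 0" and total: "(LINT x|lborel. k x) = 0"
  shows "AE x in lborel. k x = 0"
proof -
  have int: "set_integrable lborel A k" if "A \<in> sets borel" for A
    using integrable_mult_indicator[OF _ k, of A] that by (simp add: set_integrable_def)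
  have "(LINT x:A|lborel. k x) = 0" if A: "A \<in> sets lborel" for A
  proof -
    have *: "A \<in> sigma_sets UNIV (range (\<lambda>(a, b). box a b :: 'a set))"
      using A by (simp add: borel_eq_box)
    have st: "Int_stable (range (\<lambda>(a, b). box a b :: 'a set))"
    proof (rule Int_stableI)
      fix X Y :: "'a set"
      assume "X \<in> range (\<lambda>(a, b). box a b)" "Y \<in> range (\<lambda>(a, b). box a b)"
      then obtain a b c d where "X = box a b" "Y = box c d" by auto
      moreover have "box p q \<in> range (\<lambda>(a, b). box a b)" for p q :: 'a
        by (rule image_eqI[of _ _ "(p, q)"]) auto
      ultimately show "X \<inter> Y \<in> range (\<lambda>(a, b). box a b)"
        by (simp only: box_Int_box)
    qed
    show ?thesis
      using st subset_UNIV[of "range (\<lambda>(a, b). box a b :: 'a set)", unfolded Pow_UNIV[symmetric]] *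
    proof (induction rule: sigma_sets_induct_disjoint)
      case (basic A)
      then show ?case using box by auto
    next
      case empty
      then show ?case by (simp add: set_lebesgue_integral_def)
    next
      case (compl A)
      then have A: "A \<in> sets borel" by (simp add: borel_eq_box)
      have "(LINT x:UNIV|lborel. k x) = (LINT x:A|lborel. k x) + (LINT x:(UNIV - A)|lborel. k x)"
        using A by (subst set_integral_Un[symmetric]) (auto intro!: int simp: Un_absorb1)
      then show ?case using compl total by (simp add: set_lebesgue_integral_def)
    next
      case (union A)
      then have A: "\<And>i. A i \<in> sets borel" by (auto simp: borel_eq_box)
      have "(LINT x:(\<Union>i. A i)|lborel. k x) = (\<Sum>i. (LINT x:(A i)|lborel. k x))"
        using A union by (intro lebesgue_integral_countable_add int) (auto simp: disjoint_family_on_def)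
      then show ?case using union by simp
    qed
  qed
  then have "AE x in lborel. k x = (\<lambda>x. 0) x"
    using k by (intro density_unique_real) auto
  then show ?thesis by simp
qed

text \<open>Bumps lie between 0 and 1 and converge to the indicator of a box, so dominated
  convergence turns orthogonality to test functions into vanishing integrals over boxes inside
  \<Omega>. Countably many closed boxes exhaust \<Omega>, which makes the exceptional sets
  harmless.\<close>

theorem fundamental_lemma:
  fixes g :: "real^'n \<Rightarrow> real"
  assumes "open \<Omega>" and int: "set_integrable lborel \<Omega> g"
    and zero: "\<And>\<phi>. test_fun \<Omega> \<phi> \<Longrightarrow> (LINT x:\<Omega>|lborel. g x * \<phi> x) = 0"
  shows "AE x in lborel. x \<in> \<Omega> \<longrightarrow> g x = 0"
proof -
  define h where "h x = indicator \<Omega> x * g x" for x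
  have h: "integrable lborel h" using int by (simp add: set_integrable_def h_def[abs_def])
  have step1: "(LINT x:box a b|lborel. h x) = 0" if ab: "cbox a b \<subseteq> \<Omega>" for a b
  proof (cases "box a b = {}")
    case True
    then show ?thesis by (simp add: set_lebesgue_integral_def)
  next
    case False
    have "(\<lambda>n. LINT x|lborel. bump a b n x * h x) \<longlonglongrightarrow> (LINT x|lborel. indicator (box a b) x * h x)"
    proof (rule integral_dominated_convergence[where w="\<lambda>x. \<bar>h x\<bar>"])
      show "(\<lambda>x. indicator (box a b) x * h x) \<in> borel_measurable lborel"
        using h by auto
      show "(\<lambda>x. bump a b n x * h x) \<in> borel_measurable lborel" for n
      proof -
        have "bump a b n \<in> borel_measurable borel"
          by (rule borel_measurable_continuous_onI[OF test_fun_continuous[OF test_fun_bump[OF False ab]]])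
        then show ?thesis using h by auto
      qed
      show "integrable lborel (\<lambda>x. \<bar>h x\<bar>)" using h by auto
      show "AE x in lborel. (\<lambda>n. bump a b n x * h x) \<longlonglongrightarrow> indicator (box a b) x * h x"
        by (intro AE_I2 tendsto_intros bump_tendsto False)
      show "AE x in lborel. norm (bump a b n x * h x) \<le> \<bar>h x\<bar>" for n
        using bump_bounds[of a b n] by (auto simp: abs_mult intro!: mult_left_le_one_le)
    qed
    moreover have "(LINT x|lborel. bump a b n x * h x) = 0" for n
      using zero[OF test_fun_bump[OF False ab, of n]]
      by (simp add: set_lebesgue_integral_def h_def mult_ac)
    ultimately show ?thesis
      by (simp add: set_lebesgue_integral_def LIMSEQ_const_iff)
  qed
  have step2: "AE x in lborel. x \<in> cbox c d \<longrightarrow> h x = 0" if cd: "cbox c d \<subseteq> \<Omega>" for c d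
  proof -
    \<comment> \<open>\<open>AE_zero_if_box_integrals_zero\<close> asks for all boxes of the space.
      After truncation to one box inside \<Omega>, only intersections with it count, and these are
      again boxes inside \<Omega>.\<close>
    define k where "k x = indicator (box c d) x * h x" for x
    have "AE x in lborel. k x = 0"
    proof (rule AE_zero_if_box_integrals_zero)
      show "integrable lborel k"
        using integrable_mult_indicator[OF _ h, of "box c d"] by (simp add: k_def[abs_def])
      show "(LINT x|lborel. k x) = 0"
        using step1[OF cd] by (simp add: k_def set_lebesgue_integral_def)
      fix a b :: "real^'n"
      have eq: "(LINT x:box a b|lborel. k x) = (LINT x:(box a b \<inter> box c d)|lborel. h x)"
        by (simp add: k_def set_lebesgue_integral_def indicator_inter_arith mult.assoc)
      show "(LINT x:box a b|lborel. k x) = 0"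
      proof (cases "box a b \<inter> box c d = {}")
        case True
        then show ?thesis unfolding eq by (simp add: set_lebesgue_integral_def)
      next
        case False
        obtain p q where pq: "box a b \<inter> box c d = box p q" by (rule that[OF box_Int_box])
        \<comment> \<open>The corners p and q come from an existence statement, so the inclusion of
          the closed box in \<Omega> has to be recovered from the open one; this works because the
          intersection is nonempty.\<close>
        have "cbox p q = closure (box p q)" using False pq by simp
        also have "\<dots> \<subseteq> closure (box c d)" using pq by (intro closure_mono) auto
        also have "\<dots> \<subseteq> cbox c d" by (meson box_subset_cbox closed_cbox closure_minimal)
        finally show ?thesis unfolding eq pq using cd by (intro step1) auto
      qed
    qed
    \<comment> \<open>The cover of \<Omega> consists of closed boxes, hence the null boundary has to
      be discarded.\<close>
    moreover have "AE x in lborel. x \<notin> cbox c d - box c d"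
    proof (rule AE_not_in)
      have "cbox c d - box c d \<in> null_sets lebesgue"
        using negligible_frontier_interval negligible_iff_null_sets by blast
      then show "cbox c d - box c d \<in> null_sets lborel"
        by (subst (asm) null_sets_completion_iff) auto
    qed
    ultimately show ?thesis
      by eventually_elim (auto simp: k_def split: split_indicator_asm)
  qed
  obtain D where D: "countable D" "D \<subseteq> Pow \<Omega>" "\<And>X. X \<in> D \<Longrightarrow> \<exists>a b. X = cbox a b" "\<Union>D = \<Omega>"
    using open_countable_Union_open_cbox[OF \<open>open \<Omega>\<close>] by metis
  have "AE x in lborel. \<forall>X\<in>D. x \<in> X \<longrightarrow> h x = 0"
  proof (subst AE_ball_countable[OF D(1)], rule ballI)
    fix X assume "X \<in> D"
    then obtain a b where "X = cbox a b" "cbox a b \<subseteq> \<Omega>" using D by blast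
    then show "AE x in lborel. x \<in> X \<longrightarrow> h x = 0" using step2 by simp
  qed
  moreover have "x \<in> \<Omega> \<Longrightarrow> h x = 0 \<Longrightarrow> g x = 0" for x by (simp add: h_def)
  moreover have "\<exists>X\<in>D. x \<in> X" if "x \<in> \<Omega>" for x using that unfolding D(4)[symmetric] by (rule UnionE) (rule bexI)
  ultimately show ?thesis
    by (auto elim!: eventually_mono)
qed


section \<open>Square integrable functions on a bounded open set\<close>

text \<open>Young's inequality twice: the exponents 3 and 3/2 split off x, then 4/3 and 4 split
  y^(3/2) z^(3/2). The factor 2/3 from the first step turns 3/4 and 1/4 into 1/2 and 1/6.\<close>

lemma Young_three:
  fixes x y z :: real
  assumes "x \<ge> 0" "y \<ge> 0" "z \<ge> 0"
  shows "x * y * z \<le> x ^ 3 / 3 + y\<^sup>2 / 2 + z ^ 6 / 6"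
proof -
  have a: "x * (y * z) \<le> x powr 3 / 3 + (y * z) powr (3/2) / (3/2)"
    using assms by (intro Youngs_inequality) auto
  have b: "y powr (3/2) * z powr (3/2) \<le> (y powr (3/2)) powr (4/3) / (4/3) + (z powr (3/2)) powr 4 / 4"
    using assms by (intro Youngs_inequality) auto
  have "x powr 3 = x ^ 3" "(y powr (3/2)) powr (4/3) = y\<^sup>2" "(z powr (3/2)) powr 4 = z ^ 6"
    using assms by (simp_all add: powr_powr powr_numeral)
  with a b show ?thesis
    using assms by (simp add: powr_mult mult.assoc)
qed

text \<open>Hoelder's inequality by normalization: \<open>Young_three\<close> for f / F, g / G and h
  / H integrates to 1/3 + 1/2 + 1/6 = 1.\<close>

lemma holder_three:
  fixes f g h :: "'a \<Rightarrow> real"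
  assumes [measurable]: "f \<in> borel_measurable M" "g \<in> borel_measurable M" "h \<in> borel_measurable M"
    and nn: "\<And>x. f x \<ge> 0" "\<And>x. g x \<ge> 0" "\<And>x. h x \<ge> 0"
    and int: "integrable M (\<lambda>x. f x ^ 3)" "integrable M (\<lambda>x. (g x)\<^sup>2)" "integrable M (\<lambda>x. h x ^ 6)"
  shows "integrable M (\<lambda>x. f x * g x * h x)"
    and "(LINT x|M. f x * g x * h x)
      \<le> (LINT x|M. f x ^ 3) powr (1/3) * sqrt (LINT x|M. (g x)\<^sup>2) * (LINT x|M. h x ^ 6) powr (1/6)"
proof -
  show i: "integrable M (\<lambda>x. f x * g x * h x)"
  proof (rule Bochner_Integration.integrable_bound)
    show "integrable M (\<lambda>x. f x ^ 3 / 3 + (g x)\<^sup>2 / 2 + h x ^ 6 / 6)" using int by auto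
    show "AE x in M. norm (f x * g x * h x) \<le> norm (f x ^ 3 / 3 + (g x)\<^sup>2 / 2 + h x ^ 6 / 6)"
      using Young_three nn by (auto simp: abs_mult intro!: order_trans[OF _ abs_ge_self])
  qed auto
  define F G H where "F = (LINT x|M. f x ^ 3) powr (1/3)" and "G = sqrt (LINT x|M. (g x)\<^sup>2)"
    and "H = (LINT x|M. h x ^ 6) powr (1/6)"
  have pw: "F ^ 3 = (LINT x|M. f x ^ 3)" "G\<^sup>2 = (LINT x|M. (g x)\<^sup>2)" "H ^ 6 = (LINT x|M. h x ^ 6)"
  proof -
    have "F ^ 3 = F powr 3" "H ^ 6 = H powr 6" by (auto simp: F_def H_def powr_numeral)
    then show "F ^ 3 = (LINT x|M. f x ^ 3)" "H ^ 6 = (LINT x|M. h x ^ 6)"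
      using nn by (auto simp: F_def H_def powr_powr)
    show "G\<^sup>2 = (LINT x|M. (g x)\<^sup>2)" by (simp add: G_def)
  qed
  have ge: "F \<ge> 0" "G \<ge> 0" "H \<ge> 0" by (auto simp: F_def G_def H_def)
  show "(LINT x|M. f x * g x * h x) \<le> F * G * H"
  proof (cases "F = 0 \<or> G = 0 \<or> H = 0")
    \<comment> \<open>Normalization is impossible here, but a factor of norm 0 vanishes almost
      everywhere and with it the product.\<close>
    case True
    then have "(LINT x|M. f x ^ 3) = 0 \<or> (LINT x|M. (g x)\<^sup>2) = 0 \<or> (LINT x|M. h x ^ 6) = 0"
      using pw by (elim disjE) (metis power_zero_numeral)+
    then have "(AE x in M. f x ^ 3 = 0) \<or> (AE x in M. (g x)\<^sup>2 = 0) \<or> (AE x in M. h x ^ 6 = 0)"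
      using int nn by (auto simp: integral_nonneg_eq_0_iff_AE)
    then have "AE x in M. f x * g x * h x = 0"
      by (auto elim: eventually_mono)
    then have "(LINT x|M. f x * g x * h x) = 0"
      by (rule integral_eq_zero_AE)
    then show ?thesis using ge by simp
  next
    case False
    then have pos: "F > 0" "G > 0" "H > 0" using ge by auto
    have "(LINT x|M. (f x * g x * h x) / (F * G * H))
        \<le> (LINT x|M. (f x ^ 3 / F ^ 3) / 3 + ((g x)\<^sup>2 / G\<^sup>2) / 2 + (h x ^ 6 / H ^ 6) / 6)"
    proof (rule integral_mono)
      show "integrable M (\<lambda>x. (f x * g x * h x) / (F * G * H))" using i by simp
      show "integrable M (\<lambda>x. (f x ^ 3 / F ^ 3) / 3 + ((g x)\<^sup>2 / G\<^sup>2) / 2 + (h x ^ 6 / H ^ 6) / 6)"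
        using int by simp
      show "(f x * g x * h x) / (F * G * H) \<le> (f x ^ 3 / F ^ 3) / 3 + ((g x)\<^sup>2 / G\<^sup>2) / 2 + (h x ^ 6 / H ^ 6) / 6" for x
        using Young_three[of "f x / F" "g x / G" "h x / H"] nn pos by (simp add: power_divide)
    qed
    also have "\<dots> = (F ^ 3 / F ^ 3) / 3 + (G\<^sup>2 / G\<^sup>2) / 2 + (H ^ 6 / H ^ 6) / 6"
      using int by (simp add: pw)
    also have "\<dots> = 1" using pos by simp
    finally show ?thesis using i pos by (simp add: field_simps)
  qed
qed

lemma integrable_inner_of_square:
  fixes u v :: "'a \<Rightarrow> 'b::euclidean_space"
  assumes [measurable]: "u \<in> borel_measurable M" "v \<in> borel_measurable M"
    and "integrable M (\<lambda>x. (norm (u x))\<^sup>2)" "integrable M (\<lambda>x. (norm (v x))\<^sup>2)"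
  shows "integrable M (\<lambda>x. u x \<bullet> v x)" "integrable M (\<lambda>x. norm (u x) * norm (v x))"
proof -
  have *: "norm (u x) * norm (v x) \<le> (norm (u x))\<^sup>2 + (norm (v x))\<^sup>2" for x
  proof -
    have "2 * norm (u x) * norm (v x) \<le> (norm (u x))\<^sup>2 + (norm (v x))\<^sup>2" by (rule sum_squares_bound)
    moreover have "0 \<le> norm (u x) * norm (v x)" by simp
    ultimately show ?thesis by linarith
  qed
  show 2: "integrable M (\<lambda>x. norm (u x) * norm (v x))"
    by (rule Bochner_Integration.integrable_bound[where f="\<lambda>x. (norm (u x))\<^sup>2 + (norm (v x))\<^sup>2"])
       (use assms * in \<open>auto\<close>)
  show "integrable M (\<lambda>x. u x \<bullet> v x)"
    by (rule Bochner_Integration.integrable_bound[OF 2]) (auto simp: Cauchy_Schwarz_ineq2)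
qed

locale bounded_open =
  fixes \<Omega> :: "(real^'n) set"
  assumes open_domain: "open \<Omega>" and bounded_domain: "bounded \<Omega>"
begin

text \<open>Integrals over the set \<Omega> become plain integrals with respect to this finite
  measure, to which the general integration theorems apply directly.\<close>

abbreviation D :: "(real^'n) measure" where "D \<equiv> restrict_space lborel \<Omega>"

lemma domain_sets: "\<Omega> \<inter> space lborel \<in> sets lborel"
  using open_domain by simp

lemma finite_measure_domain: "finite_measure D"
proof (rule finite_measureI)
  have "emeasure lborel \<Omega> < \<infinity>" using emeasure_bounded_finite[OF bounded_domain] .
  then show "emeasure D (space D) \<noteq> \<infinity>"
    using domain_sets by (subst emeasure_restrict_space) auto
qed

lemma integral_domain:
  fixes f :: "real^'n \<Rightarrow> 'b::{banach, second_countable_topology}"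
  shows "(LINT x:\<Omega>|lborel. f x) = (LINT x|D. f x)"
  by (simp add: set_lebesgue_integral_def integral_restrict_space[OF domain_sets])

lemma integrable_domain:
  fixes f :: "real^'n \<Rightarrow> 'b::{banach, second_countable_topology}"
  shows "set_integrable lborel \<Omega> f \<longleftrightarrow> integrable D f"
  by (simp add: set_integrable_def integrable_restrict_space[OF domain_sets])

lemma AE_domain: "(AE x in D. P x) \<longleftrightarrow> (AE x in lborel. x \<in> \<Omega> \<longrightarrow> P x)"
  by (rule AE_restrict_space_iff[OF domain_sets])

lemma L2_iff:
  fixes u :: "real^'n \<Rightarrow> 'b::euclidean_space"
  shows "L2 \<Omega> u \<longleftrightarrow> u \<in> borel_measurable D \<and> integrable D (\<lambda>x. (norm (u x))\<^sup>2)"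
  by (simp add: L2_def integrable_domain set_borel_measurable_def
      borel_measurable_restrict_space_iff[OF domain_sets])

lemma L2_measurable: "L2 \<Omega> u \<Longrightarrow> u \<in> borel_measurable D" for u :: "real^'n \<Rightarrow> 'b::euclidean_space"
  by (simp add: L2_iff)

lemma measurable_continuous:
  fixes f :: "real^'n \<Rightarrow> 'b::euclidean_space"
  shows "continuous_on UNIV f \<Longrightarrow> f \<in> borel_measurable D"
  by (rule measurable_restrict_space1) (simp add: borel_measurable_continuous_onI)

lemma L2_bounded:
  fixes u :: "real^'n \<Rightarrow> 'b::euclidean_space"
  assumes "u \<in> borel_measurable D" "\<And>x. norm (u x) \<le> B"
  shows "L2 \<Omega> u"
proof -
  interpret finite_measure D by (rule finite_measure_domain)
  have "integrable D (\<lambda>x. (norm (u x))\<^sup>2)"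
    using assms by (intro integrable_const_bound[where B="B\<^sup>2"]) (auto intro!: power_mono)
  then show ?thesis using assms by (simp add: L2_iff)
qed

lemma L2_inner_integrable:
  fixes u v :: "real^'n \<Rightarrow> 'b::euclidean_space"
  shows "L2 \<Omega> u \<Longrightarrow> L2 \<Omega> v \<Longrightarrow> integrable D (\<lambda>x. u x \<bullet> v x)"
  by (auto simp: L2_iff intro: integrable_inner_of_square)

lemma L2_add:
  fixes u v :: "real^'n \<Rightarrow> 'b::euclidean_space"
  assumes "L2 \<Omega> u" "L2 \<Omega> v"
  shows "L2 \<Omega> (\<lambda>x. u x + v x)"
proof -
  have "integrable D (\<lambda>x. (norm (u x))\<^sup>2 + (norm (v x))\<^sup>2 + 2 * (u x \<bullet> v x))"
    using assms L2_inner_integrable[OF assms] by (auto simp: L2_iff)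
  then have "integrable D (\<lambda>x. (norm (u x + v x))\<^sup>2)"
    by (rule back_subst[of "integrable D"]) (auto simp: power2_norm_eq_inner algebra_simps inner_commute)
  then show ?thesis using assms by (auto simp: L2_iff)
qed

lemma L2_scaleR:
  fixes u :: "real^'n \<Rightarrow> 'b::euclidean_space"
  assumes "L2 \<Omega> u" shows "L2 \<Omega> (\<lambda>x. c *\<^sub>R u x)"
  using assms by (auto simp: L2_iff power_mult_distrib)

lemma L2_diff:
  fixes u v :: "real^'n \<Rightarrow> 'b::euclidean_space"
  assumes "L2 \<Omega> u" "L2 \<Omega> v"
  shows "L2 \<Omega> (\<lambda>x. u x - v x)"
  using L2_add[OF assms(1) L2_scaleR[OF assms(2), of "-1"]] by simp

lemma L2_nth: "L2 \<Omega> u \<Longrightarrow> L2 \<Omega> (\<lambda>x. u x $ i)" for u :: "real^'n \<Rightarrow> ('b::euclidean_space)^'m"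
proof -
  assume u: "L2 \<Omega> u"
  then have [measurable]: "u \<in> borel_measurable D" by (rule L2_measurable)
  have m: "(\<lambda>x. u x $ i) \<in> borel_measurable D"
    by (rule measurable_compose[OF \<open>u \<in> borel_measurable D\<close>])
       (auto intro!: borel_measurable_continuous_onI continuous_intros)
  have "integrable D (\<lambda>x. (norm (u x $ i))\<^sup>2)"
    using u m by (intro Bochner_Integration.integrable_bound[where g="\<lambda>x. (norm (u x $ i))\<^sup>2" and f="\<lambda>x. (norm (u x))\<^sup>2"])
      (auto simp: L2_iff intro!: power_mono Finite_Cartesian_Product.norm_nth_le)
  then show ?thesis using m by (simp add: L2_iff)
qed

lemma L2_integrable:
  fixes u :: "real^'n \<Rightarrow> real"
  assumes "L2 \<Omega> u" shows "integrable D u"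
proof -
  interpret finite_measure D by (rule finite_measure_domain)
  have "L2 \<Omega> (\<lambda>x. 1::real)" by (rule L2_bounded[of _ 1]) auto
  from L2_inner_integrable[OF assms this] show ?thesis by simp
qed

lemma l2ip_eq: "l2ip \<Omega> u v = (LINT x|D. u x \<bullet> v x)" for u v :: "real^'n \<Rightarrow> 'b::euclidean_space"
  by (simp add: l2ip_def integral_domain)

lemma l2ip_commute: "l2ip \<Omega> u v = l2ip \<Omega> v u"
  by (simp add: l2ip_def inner_commute)

lemma l2ip_add_left:
  fixes u v w :: "real^'n \<Rightarrow> 'b::euclidean_space"
  assumes "L2 \<Omega> u" "L2 \<Omega> v" "L2 \<Omega> w"
  shows "l2ip \<Omega> (\<lambda>x. u x + v x) w = l2ip \<Omega> u w + l2ip \<Omega> v w"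
  using assms by (simp add: l2ip_eq inner_add_left L2_inner_integrable)

lemma l2ip_scaleR_left:
  fixes u w :: "real^'n \<Rightarrow> 'b::euclidean_space"
  shows "l2ip \<Omega> (\<lambda>x. c *\<^sub>R u x) w = c * l2ip \<Omega> u w"
  by (simp add: l2ip_eq)

lemma l2ip_cong_AE:
  fixes u v u' v' :: "real^'n \<Rightarrow> 'b::euclidean_space"
  assumes "L2 \<Omega> u" "L2 \<Omega> v" "L2 \<Omega> u'" "L2 \<Omega> v'" "AE x in D. u x = u' x" "AE x in D. v x = v' x"
  shows "l2ip \<Omega> u v = l2ip \<Omega> u' v'"
  unfolding l2ip_eq
proof (rule integral_cong_AE)
  show "AE x in D. u x \<bullet> v x = u' x \<bullet> v' x"
    using assms(5,6) by eventually_elim simp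
qed (use assms in \<open>auto simp: L2_iff\<close>)

lemma l2ip_self: "l2ip \<Omega> u u = (LINT x|D. (norm (u x))\<^sup>2)" for u :: "real^'n \<Rightarrow> 'b::euclidean_space"
  by (simp add: l2ip_eq power2_norm_eq_inner)

lemma l2ip_self_nonneg: "0 \<le> l2ip \<Omega> u u" for u :: "real^'n \<Rightarrow> 'b::euclidean_space"
  by (simp add: l2ip_self)

lemma l2norm_nonneg: "0 \<le> l2norm \<Omega> u" for u :: "real^'n \<Rightarrow> 'b::euclidean_space"
  by (simp add: l2norm_def l2ip_self_nonneg)

lemma l2norm_power2: "(l2norm \<Omega> u)\<^sup>2 = l2ip \<Omega> u u" for u :: "real^'n \<Rightarrow> 'b::euclidean_space"
  by (simp add: l2norm_def l2ip_self_nonneg)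

lemma l2norm_cong_AE:
  fixes u u' :: "real^'n \<Rightarrow> 'b::euclidean_space"
  assumes "L2 \<Omega> u" "L2 \<Omega> u'" "AE x in D. u x = u' x"
  shows "l2norm \<Omega> u = l2norm \<Omega> u'"
  unfolding l2norm_def using l2ip_cong_AE[OF assms(1,1,2,2,3,3)] by simp

lemma l2norm_scaleR: "l2norm \<Omega> (\<lambda>x. c *\<^sub>R u x) = \<bar>c\<bar> * l2norm \<Omega> u" for u :: "real^'n \<Rightarrow> 'b::euclidean_space"
  by (simp add: l2norm_def l2ip_eq real_sqrt_mult flip: power2_eq_square mult.assoc)

lemma l2norm_eq_0: 
  fixes u :: "real^'n \<Rightarrow> 'b::euclidean_space"
  assumes "L2 \<Omega> u" "l2norm \<Omega> u = 0"
  shows "AE x in D. u x = 0"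
proof -
  have "(LINT x|D. (norm (u x))\<^sup>2) = 0"
    using assms(2) by (simp add: l2norm_def l2ip_self)
  then have "AE x in D. (norm (u x))\<^sup>2 = 0"
    using assms(1) by (subst (asm) integral_nonneg_eq_0_iff_AE) (auto simp: L2_iff)
  then show ?thesis by eventually_elim simp
qed

text \<open>Functions are not identified almost everywhere, so \<open>l2ip\<close> is only positive
  semidefinite and the discriminant argument has to include a v of norm 0.\<close>

lemma l2_Cauchy_Schwarz:
  fixes u v :: "real^'n \<Rightarrow> 'b::euclidean_space"
  assumes "L2 \<Omega> u" "L2 \<Omega> v"
  shows "\<bar>l2ip \<Omega> u v\<bar> \<le> l2norm \<Omega> u * l2norm \<Omega> v"
proof -
  have q: "0 \<le> l2ip \<Omega> u u + 2 * t * l2ip \<Omega> u v + t\<^sup>2 * l2ip \<Omega> v v" for t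
  proof -
    have tv: "L2 \<Omega> (\<lambda>x. t *\<^sub>R v x)" using assms L2_scaleR by blast
    have "0 \<le> l2ip \<Omega> (\<lambda>x. u x + t *\<^sub>R v x) (\<lambda>x. u x + t *\<^sub>R v x)" by (rule l2ip_self_nonneg)
    also have "\<dots> = l2ip \<Omega> u u + 2 * t * l2ip \<Omega> u v + t\<^sup>2 * l2ip \<Omega> v v"
      using assms tv L2_add[OF assms(1) tv]
      by (simp add: l2ip_add_left l2ip_scaleR_left l2ip_commute[of u "\<lambda>x. u x + t *\<^sub>R v x"]
          l2ip_commute[of v "\<lambda>x. u x + t *\<^sub>R v x"] l2ip_commute[of v u] power2_eq_square algebra_simps)
    finally show ?thesis .
  qed
  have "(l2ip \<Omega> u v)\<^sup>2 \<le> l2ip \<Omega> u u * l2ip \<Omega> v v"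
  proof (cases "l2ip \<Omega> v v = 0")
    case True
    have "l2ip \<Omega> u v = 0"
    proof (rule ccontr)
      assume n: "l2ip \<Omega> u v \<noteq> 0"
      \<comment> \<open>With |v| = 0 the quadratic in t is affine; this t is where it takes the
        value -1.\<close>
      have "0 \<le> l2ip \<Omega> u u + 2 * (- (l2ip \<Omega> u u + 1) / (2 * l2ip \<Omega> u v)) * l2ip \<Omega> u v"
        using q[of "- (l2ip \<Omega> u u + 1) / (2 * l2ip \<Omega> u v)"] True by simp
      also have "\<dots> = -1" using n by (simp add: field_simps)
      finally show False by simp
    qed
    then show ?thesis using True by simp
  next
    case False
    then have pos: "l2ip \<Omega> v v > 0" using l2ip_self_nonneg[of v] by simp
    \<comment> \<open>The quadratic at its minimizer t = - (u, v) / (v, v).\<close>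
    have "0 \<le> l2ip \<Omega> u u - (l2ip \<Omega> u v)\<^sup>2 / l2ip \<Omega> v v"
      using q[of "- l2ip \<Omega> u v / l2ip \<Omega> v v"] pos by (simp add: power2_eq_square field_simps)
    then show ?thesis using pos by (simp add: field_simps)
  qed
  then have "sqrt ((l2ip \<Omega> u v)\<^sup>2) \<le> sqrt (l2ip \<Omega> u u * l2ip \<Omega> v v)" by (rule real_sqrt_le_mono)
  then show ?thesis by (simp add: l2norm_def real_sqrt_mult)
qed

lemma l2norm_triangle:
  fixes u v :: "real^'n \<Rightarrow> 'b::euclidean_space"
  assumes "L2 \<Omega> u" "L2 \<Omega> v"
  shows "l2norm \<Omega> (\<lambda>x. u x + v x) \<le> l2norm \<Omega> u + l2norm \<Omega> v"
proof (rule power2_le_imp_le)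
  have "(l2norm \<Omega> (\<lambda>x. u x + v x))\<^sup>2 = l2ip \<Omega> u u + 2 * l2ip \<Omega> u v + l2ip \<Omega> v v"
    unfolding l2norm_power2 using assms L2_add[OF assms]
    by (simp add: l2ip_add_left l2ip_commute[of u "\<lambda>x. u x + v x"]
          l2ip_commute[of v "\<lambda>x. u x + v x"] l2ip_commute[of v u])
  also have "\<dots> \<le> (l2norm \<Omega> u + l2norm \<Omega> v)\<^sup>2"
    using l2_Cauchy_Schwarz[OF assms] by (simp add: power2_sum l2norm_power2)
  finally show "(l2norm \<Omega> (\<lambda>x. u x + v x))\<^sup>2 \<le> (l2norm \<Omega> u + l2norm \<Omega> v)\<^sup>2" .
qed (simp add: l2norm_nonneg)

end


section \<open>Weak gradients and the space H10\<close>

context bounded_open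
begin

abbreviation test_field :: "(real^'n \<Rightarrow> real^'n) \<Rightarrow> bool" where
  "test_field \<psi> \<equiv> \<forall>i. test_fun \<Omega> (\<lambda>x. \<psi> x $ i)"

lemma L2_vecI:
  fixes u :: "real^'n \<Rightarrow> ('b::euclidean_space)^'m"
  assumes "\<And>i. L2 \<Omega> (\<lambda>x. u x $ i)"
  shows "L2 \<Omega> u"
proof -
  have "u \<in> borel_measurable D"
  proof (subst borel_measurable_euclidean_space, rule ballI)
    fix b :: "'b^'m" assume "b \<in> Basis"
    then obtain i c where b: "b = axis i c" by (auto simp: Basis_vec_def)
    have "(\<lambda>x. u x $ i) \<in> borel_measurable D" using assms L2_measurable by blast
    then show "(\<lambda>x. u x \<bullet> b) \<in> borel_measurable D" by (auto simp: b inner_axis)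
  qed
  moreover have "(norm (u x))\<^sup>2 = (\<Sum>i\<in>UNIV. (norm (u x $ i))\<^sup>2)" for x
    by (simp add: norm_vec_def L2_set_def sum_nonneg)
  then have "integrable D (\<lambda>x. (norm (u x))\<^sup>2)"
    using assms by (auto simp: L2_iff)
  ultimately show ?thesis by (simp add: L2_iff)
qed

lemma L2_test_fun:
  assumes "test_fun \<Omega> \<phi>"
  shows "L2 \<Omega> \<phi>"
proof -
  obtain B where "\<And>x. \<bar>\<phi> x\<bar> \<le> B" using test_fun_bounded[OF assms] by blast
  then show ?thesis
    by (intro L2_bounded[where B=B] measurable_continuous[OF test_fun_continuous[OF assms]]) auto
qed

lemma L2_pderiv:
  assumes "test_fun \<Omega> \<phi>"
  shows "L2 \<Omega> (pderiv \<phi> j)"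
proof -
  obtain B where "\<And>x. \<bar>pderiv \<phi> j x\<bar> \<le> B" using test_fun_pderiv_bounded[OF assms] by blast
  then show ?thesis
    by (intro L2_bounded[where B=B] measurable_continuous[OF test_fun_continuous_pderiv[OF assms]]) auto
qed

lemma L2_test_field: "test_field \<psi> \<Longrightarrow> L2 \<Omega> \<psi>"
  by (intro L2_vecI L2_test_fun) auto

lemma L2_jac: "test_field \<psi> \<Longrightarrow> L2 \<Omega> (jac \<psi>)"
  by (intro L2_vecI) (simp add: jac_def L2_pderiv)

lemma L2_mult_integrable:
  fixes f g :: "real^'n \<Rightarrow> real"
  shows "L2 \<Omega> f \<Longrightarrow> L2 \<Omega> g \<Longrightarrow> integrable D (\<lambda>x. f x * g x)"
  using L2_inner_integrable[of f g] by simp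

text \<open>The product of two test functions is a test function; its derivative vanishes off
  \<Omega> and has integral 0 over the whole space.\<close>

lemma integration_by_parts:
  assumes "test_fun \<Omega> \<phi>" "test_fun \<Omega> \<psi>"
  shows "(LINT x|D. \<phi> x * pderiv \<psi> j x) = - (LINT x|D. pderiv \<phi> j x * \<psi> x)"
proof -
  let ?f = "\<lambda>x. \<phi> x * \<psi> x"
  have t: "test_fun \<Omega> ?f" using assms by (rule test_fun_mult)
  have "indicator \<Omega> x *\<^sub>R pderiv ?f j x = pderiv ?f j x" for x
    using pderiv_test_fun_eq_0[OF t, of x j] by (auto simp: indicator_def)
  then have "(LINT x|D. pderiv ?f j x) = (LINT x|lborel. pderiv ?f j x)"
    by (simp add: integral_restrict_space[OF domain_sets] del: real_scaleR_def)
  also have "\<dots> = 0" by (rule integral_pderiv_zero[OF t])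
  finally have "0 = (LINT x|D. pderiv \<phi> j x * \<psi> x + \<phi> x * pderiv \<psi> j x)"
    using assms by (simp add: pderiv_mult test_fun_differentiable[where A=\<Omega>])
  also have "\<dots> = (LINT x|D. pderiv \<phi> j x * \<psi> x) + (LINT x|D. \<phi> x * pderiv \<psi> j x)"
    using assms by (intro Bochner_Integration.integral_add L2_mult_integrable L2_test_fun L2_pderiv)
  finally show ?thesis by simp
qed

lemma weak_gradD:
  assumes "weak_grad \<Omega> u G" "test_fun \<Omega> \<phi>"
  shows "(LINT x|D. u x $ i * pderiv \<phi> j x) = - (LINT x|D. G x $ i $ j * \<phi> x)"
  using assms by (simp add: weak_grad_def integral_domain)

lemma weak_grad_jac: "test_field \<psi> \<Longrightarrow> weak_grad \<Omega> \<psi> (jac \<psi>)"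
  by (simp add: weak_grad_def integral_domain integration_by_parts jac_def)

lemma weak_grad_add:
  assumes "weak_grad \<Omega> u G" "weak_grad \<Omega> v H" "L2 \<Omega> u" "L2 \<Omega> v" "L2 \<Omega> G" "L2 \<Omega> H"
  shows "weak_grad \<Omega> (\<lambda>x. u x + v x) (\<lambda>x. G x + H x)"
  unfolding weak_grad_def
proof (intro allI impI)
  fix \<phi> i j assume t: "test_fun \<Omega> \<phi>"
  show "(LINT x:\<Omega>|lborel. (u x + v x) $ i * pderiv \<phi> j x) = - (LINT x:\<Omega>|lborel. (G x + H x) $ i $ j * \<phi> x)"
    using assms(3-6) weak_gradD[OF assms(1) t, of i j] weak_gradD[OF assms(2) t, of i j] t
    by (simp add: integral_domain distrib_right L2_mult_integrable L2_test_fun L2_pderiv L2_nth)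
qed

lemma weak_grad_scaleR:
  assumes "weak_grad \<Omega> u G"
  shows "weak_grad \<Omega> (\<lambda>x. c *\<^sub>R u x) (\<lambda>x. c *\<^sub>R G x)"
  using weak_gradD[OF assms] by (simp add: weak_grad_def integral_domain mult.assoc)

text \<open>The fundamental lemma, applied to each entry of G - G'. The fields u and u' are allowed
  to differ on a null set, so that a field of norm 0 can be compared with the constant 0.\<close>

lemma weak_grad_unique:
  assumes "weak_grad \<Omega> u G" "weak_grad \<Omega> u' G'" "L2 \<Omega> G" "L2 \<Omega> G'" 
    and "L2 \<Omega> u" "L2 \<Omega> u'" "AE x in D. u x = u' x"
  shows "AE x in D. G x = G' x"
proof -
  have "AE x in D. G x $ i $ j - G' x $ i $ j = 0" for i j
    unfolding AE_domain
  proof (rule fundamental_lemma[OF open_domain])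
    have l: "L2 \<Omega> (\<lambda>x. G x $ i $ j)" "L2 \<Omega> (\<lambda>x. G' x $ i $ j)"
      using assms by (auto intro: L2_nth)
    show "set_integrable lborel \<Omega> (\<lambda>x. G x $ i $ j - G' x $ i $ j)"
      unfolding integrable_domain using l by (intro L2_integrable L2_diff)
    fix \<phi> assume t: "test_fun \<Omega> \<phi>"
    have "(LINT x|D. u x $ i * pderiv \<phi> j x) = (LINT x|D. u' x $ i * pderiv \<phi> j x)"
    proof (rule integral_cong_AE)
      show "AE x in D. u x $ i * pderiv \<phi> j x = u' x $ i * pderiv \<phi> j x"
        using assms(7) by eventually_elim simp
    qed (use assms t in \<open>auto intro!: borel_measurable_times L2_measurable[OF L2_nth] L2_measurable[OF L2_pderiv]\<close>)
    then have "(LINT x|D. G x $ i $ j * \<phi> x) = (LINT x|D. G' x $ i $ j * \<phi> x)"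
      using weak_gradD[OF assms(1) t, of i j] weak_gradD[OF assms(2) t, of i j] by simp
    then show "(LINT x:\<Omega>|lborel. (G x $ i $ j - G' x $ i $ j) * \<phi> x) = 0"
      using l t by (simp add: integral_domain left_diff_distrib L2_mult_integrable L2_test_fun)
  qed
  then have "AE x in D. \<forall>i j. G x $ i $ j - G' x $ i $ j = 0"
    by (simp add: AE_all_countable)
  then show ?thesis
    by eventually_elim (simp add: vec_eq_iff)
qed

lemma H1_grad: "H1 \<Omega> u \<Longrightarrow> L2 \<Omega> u \<and> L2 \<Omega> (grad \<Omega> u) \<and> weak_grad \<Omega> u (grad \<Omega> u)"
  unfolding H1_def grad_def by (metis (mono_tags, lifting) someI_ex)

lemma H1I: "L2 \<Omega> u \<Longrightarrow> L2 \<Omega> G \<Longrightarrow> weak_grad \<Omega> u G \<Longrightarrow> H1 \<Omega> u"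
  unfolding H1_def by blast

text \<open>Every rule for \<open>grad\<close> goes through here: exhibit some weak gradient, and
  uniqueness identifies it with the chosen one up to a null set.\<close>

lemma grad_AE_eq:
  assumes "L2 \<Omega> u" "L2 \<Omega> G" "weak_grad \<Omega> u G"
  shows "AE x in D. grad \<Omega> u x = G x"
  using H1_grad[OF H1I[OF assms]] assms by (intro weak_grad_unique[where u=u and u'=u]) auto

lemma H1_add:
  assumes "H1 \<Omega> u" "H1 \<Omega> v"
  shows "H1 \<Omega> (\<lambda>x. u x + v x)" "AE x in D. grad \<Omega> (\<lambda>x. u x + v x) x = grad \<Omega> u x + grad \<Omega> v x"
  using H1_grad[OF assms(1)] H1_grad[OF assms(2)]
  by (auto intro: H1I grad_AE_eq L2_add weak_grad_add)

lemma H1_scaleR: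
  assumes "H1 \<Omega> u"
  shows "H1 \<Omega> (\<lambda>x. c *\<^sub>R u x)" "AE x in D. grad \<Omega> (\<lambda>x. c *\<^sub>R u x) x = c *\<^sub>R grad \<Omega> u x"
  using H1_grad[OF assms] by (auto intro: H1I grad_AE_eq L2_scaleR weak_grad_scaleR)

lemma H1_test_field:
  assumes "test_field \<psi>"
  shows "H1 \<Omega> \<psi>" "AE x in D. grad \<Omega> \<psi> x = jac \<psi> x"
  using assms by (auto intro: H1I grad_AE_eq L2_test_field L2_jac weak_grad_jac)

lemma jac_add:
  assumes "test_field \<psi>" "test_field \<eta>"
  shows "jac (\<lambda>x. \<psi> x + \<eta> x) x = jac \<psi> x + jac \<eta> x"
  using assms by (simp add: jac_def vec_eq_iff pderiv_add test_fun_differentiable[where A=\<Omega>])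

lemma jac_scaleR:
  assumes "test_field \<psi>"
  shows "jac (\<lambda>x. c *\<^sub>R \<psi> x) x = c *\<^sub>R jac \<psi> x"
  using assms by (simp add: jac_def vec_eq_iff pderiv_cmult test_fun_differentiable[where A=\<Omega>])

text \<open>Separates the two distances whose squares the definition of \<open>H10\<close> adds
  up.\<close>

lemma sum_squares_tendsto_0_iff:
  fixes a b :: "nat \<Rightarrow> real"
  assumes "\<And>n. a n \<ge> 0" "\<And>n. b n \<ge> 0"
  shows "(\<lambda>n. (a n)\<^sup>2 + (b n)\<^sup>2) \<longlonglongrightarrow> 0 \<longleftrightarrow> a \<longlonglongrightarrow> 0 \<and> b \<longlonglongrightarrow> 0"
proof
  assume *: "(\<lambda>n. (a n)\<^sup>2 + (b n)\<^sup>2) \<longlonglongrightarrow> 0"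
  have s: "(\<lambda>n. sqrt ((a n)\<^sup>2 + (b n)\<^sup>2)) \<longlonglongrightarrow> 0" using tendsto_real_sqrt[OF *] by simp
  have "a \<longlonglongrightarrow> 0" 
    by (rule Lim_null_comparison[OF _ s]) (use assms in \<open>auto intro!: real_le_rsqrt\<close>)
  moreover have "b \<longlonglongrightarrow> 0" 
    by (rule Lim_null_comparison[OF _ s]) (use assms in \<open>auto intro!: real_le_rsqrt\<close>)
  ultimately show "a \<longlonglongrightarrow> 0 \<and> b \<longlonglongrightarrow> 0" by blast
next
  assume "a \<longlonglongrightarrow> 0 \<and> b \<longlonglongrightarrow> 0"
  then have "(\<lambda>n. (a n)\<^sup>2 + (b n)\<^sup>2) \<longlonglongrightarrow> 0\<^sup>2 + 0\<^sup>2" by (intro tendsto_intros) auto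
  then show "(\<lambda>n. (a n)\<^sup>2 + (b n)\<^sup>2) \<longlonglongrightarrow> 0" by simp
qed

lemma H10_iff:
  "H10 \<Omega> u \<longleftrightarrow> H1 \<Omega> u \<and> (\<exists>\<psi>. (\<forall>n. test_field (\<psi> n)) \<and> (\<lambda>n. l2norm \<Omega> (\<lambda>x. u x - \<psi> n x)) \<longlonglongrightarrow> 0
     \<and> (\<lambda>n. l2norm \<Omega> (\<lambda>x. grad \<Omega> u x - jac (\<psi> n) x)) \<longlonglongrightarrow> 0)"
  unfolding H10_def by (subst sum_squares_tendsto_0_iff) (auto simp: l2norm_nonneg)

lemma H10_H1: "H10 \<Omega> u \<Longrightarrow> H1 \<Omega> u"
  by (simp add: H10_def)

lemma H10_L2: "H10 \<Omega> u \<Longrightarrow> L2 \<Omega> u" and H10_L2_grad: "H10 \<Omega> u \<Longrightarrow> L2 \<Omega> (grad \<Omega> u)"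
  using H1_grad[OF H10_H1] by auto

text \<open>The constant sequence \<psi> approximates \<psi>. Its gradient distance is 0 because
  \<open>grad\<close> and \<open>jac\<close> agree almost everywhere.\<close>

lemma H10_test_field:
  assumes "test_field \<psi>"
  shows "H10 \<Omega> \<psi>"
proof -
  have "l2norm \<Omega> (\<lambda>x. grad \<Omega> \<psi> x - jac \<psi> x) = l2norm \<Omega> (\<lambda>x. 0 :: real^'n^'n)"
  proof (rule l2norm_cong_AE)
    show "AE x in D. grad \<Omega> \<psi> x - jac \<psi> x = 0" using H1_test_field(2)[OF assms] by eventually_elim simp
    show "L2 \<Omega> (\<lambda>x. 0 :: real^'n^'n)" by (rule L2_bounded[of _ 0]) auto
  qed (use H1_grad[OF H1_test_field(1)[OF assms]] assms in \<open>auto intro!: L2_diff L2_jac\<close>)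
  then show ?thesis
    unfolding H10_iff using assms H1_test_field(1)[OF assms]
    by (intro conjI exI[of _ "\<lambda>n. \<psi>"]) (auto simp: l2norm_def l2ip_def)
qed

lemma H10_add:
  assumes "H10 \<Omega> u" "H10 \<Omega> v"
  shows "H10 \<Omega> (\<lambda>x. u x + v x)"
proof -
  note H1 = H10_H1[OF assms(1)] H10_H1[OF assms(2)]
  note L = H1_grad[OF H1(1)] H1_grad[OF H1(2)] H1_grad[OF H1_add(1)[OF H1]]
  obtain \<psi> where p: "\<And>n. test_field (\<psi> n)" "(\<lambda>n. l2norm \<Omega> (\<lambda>x. u x - \<psi> n x)) \<longlonglongrightarrow> 0"
     "(\<lambda>n. l2norm \<Omega> (\<lambda>x. grad \<Omega> u x - jac (\<psi> n) x)) \<longlonglongrightarrow> 0" using assms(1) unfolding H10_iff by blast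
  obtain \<eta> where c: "\<And>n. test_field (\<eta> n)" "(\<lambda>n. l2norm \<Omega> (\<lambda>x. v x - \<eta> n x)) \<longlonglongrightarrow> 0"
     "(\<lambda>n. l2norm \<Omega> (\<lambda>x. grad \<Omega> v x - jac (\<eta> n) x)) \<longlonglongrightarrow> 0" using assms(2) unfolding H10_iff by blast
  have t: "test_field (\<lambda>x. \<psi> n x + \<eta> n x)" for n using p c by (simp add: test_fun_add)
  have b1: "l2norm \<Omega> (\<lambda>x. (u x + v x) - (\<psi> n x + \<eta> n x)) \<le> l2norm \<Omega> (\<lambda>x. u x - \<psi> n x) + l2norm \<Omega> (\<lambda>x. v x - \<eta> n x)" for n
    using l2norm_triangle[of "\<lambda>x. u x - \<psi> n x" "\<lambda>x. v x - \<eta> n x"] L p c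
    by (simp add: L2_diff L2_test_field algebra_simps)
  have b2: "l2norm \<Omega> (\<lambda>x. grad \<Omega> (\<lambda>x. u x + v x) x - jac (\<lambda>x. \<psi> n x + \<eta> n x) x)
     \<le> l2norm \<Omega> (\<lambda>x. grad \<Omega> u x - jac (\<psi> n) x) + l2norm \<Omega> (\<lambda>x. grad \<Omega> v x - jac (\<eta> n) x)" for n
  proof -
    have "l2norm \<Omega> (\<lambda>x. grad \<Omega> (\<lambda>x. u x + v x) x - jac (\<lambda>x. \<psi> n x + \<eta> n x) x)
      = l2norm \<Omega> (\<lambda>x. (grad \<Omega> u x - jac (\<psi> n) x) + (grad \<Omega> v x - jac (\<eta> n) x))"
    proof (rule l2norm_cong_AE)
      show "AE x in D. grad \<Omega> (\<lambda>x. u x + v x) x - jac (\<lambda>x. \<psi> n x + \<eta> n x) x =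
         (grad \<Omega> u x - jac (\<psi> n) x) + (grad \<Omega> v x - jac (\<eta> n) x)"
        using H1_add(2)[OF H1] by eventually_elim (use p c in \<open>simp add: jac_add\<close>)
    qed (use L p c t in \<open>auto intro!: L2_diff L2_add L2_jac\<close>)
    also have "\<dots> \<le> l2norm \<Omega> (\<lambda>x. grad \<Omega> u x - jac (\<psi> n) x) + l2norm \<Omega> (\<lambda>x. grad \<Omega> v x - jac (\<eta> n) x)"
      by (rule l2norm_triangle) (use L p c in \<open>auto intro!: L2_diff L2_jac\<close>)
    finally show ?thesis .
  qed
  have z: "f \<longlonglongrightarrow> 0" if "\<And>n. 0 \<le> f n" "\<And>n. f n \<le> g n + h n" "g \<longlonglongrightarrow> 0" "h \<longlonglongrightarrow> 0" for f g h :: "nat \<Rightarrow> real"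
    by (rule Lim_null_comparison[of _ "\<lambda>n. g n + h n"]) (use that tendsto_add[OF that(3,4)] in auto)
  show ?thesis
    unfolding H10_iff
    by (intro conjI exI[of _ "\<lambda>n x. \<psi> n x + \<eta> n x"] allI H1_add(1)[OF H1] z[OF l2norm_nonneg b1 p(2) c(2)]
        z[OF l2norm_nonneg b2 p(3) c(3)]) (use t in auto)
qed

lemma H10_scaleR:
  assumes "H10 \<Omega> u"
  shows "H10 \<Omega> (\<lambda>x. c *\<^sub>R u x)"
proof -
  note H1 = H10_H1[OF assms]
  note L = H1_grad[OF H1] H1_grad[OF H1_scaleR(1)[OF H1, of c]]
  obtain \<psi> where p: "\<And>n. test_field (\<psi> n)" "(\<lambda>n. l2norm \<Omega> (\<lambda>x. u x - \<psi> n x)) \<longlonglongrightarrow> 0"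
     "(\<lambda>n. l2norm \<Omega> (\<lambda>x. grad \<Omega> u x - jac (\<psi> n) x)) \<longlonglongrightarrow> 0" using assms(1) unfolding H10_iff by blast
  have t: "test_field (\<lambda>x. c *\<^sub>R \<psi> n x)" for n using p by (simp add: test_fun_cmult)
  have b1: "l2norm \<Omega> (\<lambda>x. c *\<^sub>R u x - c *\<^sub>R \<psi> n x) = \<bar>c\<bar> * l2norm \<Omega> (\<lambda>x. u x - \<psi> n x)" for n
    using l2norm_scaleR[of c "\<lambda>x. u x - \<psi> n x"] by (simp add: algebra_simps)
  have b2: "l2norm \<Omega> (\<lambda>x. grad \<Omega> (\<lambda>x. c *\<^sub>R u x) x - jac (\<lambda>x. c *\<^sub>R \<psi> n x) x)
     = \<bar>c\<bar> * l2norm \<Omega> (\<lambda>x. grad \<Omega> u x - jac (\<psi> n) x)" for n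
  proof -
    have "l2norm \<Omega> (\<lambda>x. grad \<Omega> (\<lambda>x. c *\<^sub>R u x) x - jac (\<lambda>x. c *\<^sub>R \<psi> n x) x)
      = l2norm \<Omega> (\<lambda>x. c *\<^sub>R (grad \<Omega> u x - jac (\<psi> n) x))"
    proof (rule l2norm_cong_AE)
      show "AE x in D. grad \<Omega> (\<lambda>x. c *\<^sub>R u x) x - jac (\<lambda>x. c *\<^sub>R \<psi> n x) x = c *\<^sub>R (grad \<Omega> u x - jac (\<psi> n) x)"
        using H1_scaleR(2)[OF H1] by eventually_elim (use p in \<open>simp add: jac_scaleR algebra_simps\<close>)
    qed (use L p t in \<open>auto intro!: L2_diff L2_scaleR L2_jac\<close>)
    then show ?thesis by (simp add: l2norm_scaleR)
  qed
  have z: "(\<lambda>n. \<bar>c\<bar> * f n) \<longlonglongrightarrow> 0" if "f \<longlonglongrightarrow> 0" for f :: "nat \<Rightarrow> real"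
    using tendsto_mult_right[OF that, of "\<bar>c\<bar>"] tendsto_mult_left[OF that, of "\<bar>c\<bar>"] by simp
  show ?thesis
    unfolding H10_iff
    by (intro conjI exI[of _ "\<lambda>n x. c *\<^sub>R \<psi> n x"] allI H1_scaleR(1)[OF H1]) (use t p(2,3) in \<open>auto simp: b1 b2 z\<close>)
qed

lemma H10_diff: "H10 \<Omega> u \<Longrightarrow> H10 \<Omega> v \<Longrightarrow> H10 \<Omega> (\<lambda>x. u x - v x)"
  using H10_add[of u "\<lambda>x. (-1) *\<^sub>R v x"] H10_scaleR[of v "-1"] by simp

lemma grad_add: 
  "H10 \<Omega> u \<Longrightarrow> H10 \<Omega> v \<Longrightarrow> AE x in D. grad \<Omega> (\<lambda>x. u x + v x) x = grad \<Omega> u x + grad \<Omega> v x"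
  by (intro H1_add(2) H10_H1)

lemma grad_scaleR: "H10 \<Omega> u \<Longrightarrow> AE x in D. grad \<Omega> (\<lambda>x. c *\<^sub>R u x) x = c *\<^sub>R grad \<Omega> u x"
  by (intro H1_scaleR(2) H10_H1)

lemma grad_diff: 
  assumes "H10 \<Omega> u" "H10 \<Omega> v"
  shows "AE x in D. grad \<Omega> (\<lambda>x. u x - v x) x = grad \<Omega> u x - grad \<Omega> v x"
proof -
  have "AE x in D. grad \<Omega> (\<lambda>x. u x + (-1) *\<^sub>R v x) x = grad \<Omega> u x + grad \<Omega> (\<lambda>x. (-1) *\<^sub>R v x) x"
    by (rule grad_add[OF assms(1) H10_scaleR[OF assms(2), of "-1"]])
  moreover have "AE x in D. grad \<Omega> (\<lambda>x. (-1) *\<^sub>R v x) x = (-1) *\<^sub>R grad \<Omega> v x"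
    by (rule grad_scaleR[OF assms(2)])
  ultimately show ?thesis by eventually_elim simp
qed

lemma h1snorm_nonneg: "0 \<le> h1snorm \<Omega> u"
  by (simp add: h1snorm_def l2norm_nonneg)

lemma h1snorm_scaleR:
  assumes "H10 \<Omega> u"
  shows "h1snorm \<Omega> (\<lambda>x. c *\<^sub>R u x) = \<bar>c\<bar> * h1snorm \<Omega> u"
  unfolding h1snorm_def l2norm_scaleR[symmetric]
  by (rule l2norm_cong_AE)
     (use assms grad_scaleR[OF assms] in \<open>auto intro: H10_L2_grad L2_scaleR H10_scaleR\<close>)

lemma h1snorm_triangle:
  assumes "H10 \<Omega> u" "H10 \<Omega> v"
  shows "h1snorm \<Omega> (\<lambda>x. u x + v x) \<le> h1snorm \<Omega> u + h1snorm \<Omega> v"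
proof -
  have "h1snorm \<Omega> (\<lambda>x. u x + v x) = l2norm \<Omega> (\<lambda>x. grad \<Omega> u x + grad \<Omega> v x)"
    unfolding h1snorm_def
    by (rule l2norm_cong_AE)
       (use assms grad_add[OF assms] in \<open>auto intro: H10_L2_grad L2_add H10_add\<close>)
  also have "\<dots> \<le> h1snorm \<Omega> u + h1snorm \<Omega> v"
    unfolding h1snorm_def by (rule l2norm_triangle) (use assms in \<open>auto intro: H10_L2_grad\<close>)
  finally show ?thesis .
qed

lemma h1ip_self: "h1ip \<Omega> u u = (h1snorm \<Omega> u)\<^sup>2"
  by (simp add: h1ip_def h1snorm_def l2norm_power2)

lemma h1ip_add_left:
  assumes "H10 \<Omega> u" "H10 \<Omega> v" "H10 \<Omega> w"
  shows "h1ip \<Omega> (\<lambda>x. u x + v x) w = h1ip \<Omega> u w + h1ip \<Omega> v w"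
proof -
  have "h1ip \<Omega> (\<lambda>x. u x + v x) w = l2ip \<Omega> (\<lambda>x. grad \<Omega> u x + grad \<Omega> v x) (grad \<Omega> w)"
    unfolding h1ip_def
    by (rule l2ip_cong_AE) (use assms grad_add[OF assms(1,2)] in \<open>auto intro: H10_L2_grad L2_add H10_add\<close>)
  then show ?thesis using assms by (simp add: h1ip_def l2ip_add_left H10_L2_grad)
qed

lemma h1ip_scaleR_left:
  assumes "H10 \<Omega> u" "H10 \<Omega> w"
  shows "h1ip \<Omega> (\<lambda>x. c *\<^sub>R u x) w = c * h1ip \<Omega> u w"
proof -
  have "h1ip \<Omega> (\<lambda>x. c *\<^sub>R u x) w = l2ip \<Omega> (\<lambda>x. c *\<^sub>R grad \<Omega> u x) (grad \<Omega> w)"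
    unfolding h1ip_def
    by (rule l2ip_cong_AE) (use assms grad_scaleR[OF assms(1)] in \<open>auto intro: H10_L2_grad L2_scaleR H10_scaleR\<close>)
  then show ?thesis by (simp add: h1ip_def l2ip_scaleR_left)
qed

text \<open>Here the gradient distance is the seminorm of the difference field, which is the form in
  which linearity and boundedness of \<open>bstar\<close> can be used.\<close>

lemma H10_dense:
  assumes "H10 \<Omega> u"
  obtains \<psi> where "\<And>n. test_field (\<psi> n)" "(\<lambda>n. l2norm \<Omega> (\<lambda>x. u x - \<psi> n x)) \<longlonglongrightarrow> 0"
    "(\<lambda>n. h1snorm \<Omega> (\<lambda>x. u x - \<psi> n x)) \<longlonglongrightarrow> 0"
proof -
  obtain \<psi> where p: "\<And>n. test_field (\<psi> n)" "(\<lambda>n. l2norm \<Omega> (\<lambda>x. u x - \<psi> n x)) \<longlonglongrightarrow> 0"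
     "(\<lambda>n. l2norm \<Omega> (\<lambda>x. grad \<Omega> u x - jac (\<psi> n) x)) \<longlonglongrightarrow> 0" using assms(1) unfolding H10_iff by blast
  have "h1snorm \<Omega> (\<lambda>x. u x - \<psi> n x) = l2norm \<Omega> (\<lambda>x. grad \<Omega> u x - jac (\<psi> n) x)" for n
    unfolding h1snorm_def
  proof (rule l2norm_cong_AE)
    show "AE x in D. grad \<Omega> (\<lambda>x. u x - \<psi> n x) x = grad \<Omega> u x - jac (\<psi> n) x"
      using grad_diff[OF assms H10_test_field[OF p(1)], of n] H1_test_field(2)[OF p(1), of n]
      by eventually_elim simp
  qed (use assms p(1) in \<open>auto intro!: H10_L2_grad[OF H10_diff[OF assms H10_test_field]] H10_L2_grad[OF assms] L2_diff L2_jac\<close>)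
  then have "(\<lambda>n. h1snorm \<Omega> (\<lambda>x. u x - \<psi> n x)) \<longlonglongrightarrow> 0" using p(3) by simp
  from that[OF p(1,2) this] show thesis .
qed

lemma L2_divg:
  assumes "H10 \<Omega> v"
  shows "L2 \<Omega> (divg \<Omega> v)"
proof -
  have "L2 \<Omega> (\<lambda>x. \<Sum>i\<in>I. grad \<Omega> v x $ i $ i)" if "finite I" for I
    using that
  proof (induction I)
    case empty
    then show ?case by (intro L2_bounded[of _ 0]) auto
  next
    case (insert i I)
    then show ?case using L2_add[OF L2_nth[OF L2_nth[OF H10_L2_grad[OF assms]]] insert.IH, of i i] by simp
  qed
  then show ?thesis unfolding divg_def[abs_def] by simp
qed

end


section \<open>The convective trilinear form\<close>

text \<open>The signs of \<open>C3\<close> and \<open>C6\<close> are assumed here; the final theorem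
  reads them off from the inequalities at one field with nonzero gradient.\<close>

locale sobolev_domain = bounded_open \<Omega> for \<Omega> :: "(real^'n) set" +
  fixes CP C3 C6 :: real
  assumes CP_pos: "CP > 0" and C3_nonneg: "C3 \<ge> 0" and C6_nonneg: "C6 \<ge> 0"
    and poincare: "H10 \<Omega> \<phi> \<Longrightarrow> l2norm \<Omega> \<phi> \<le> CP * h1snorm \<Omega> \<phi>"
    and sobolev6: "H10 \<Omega> \<phi> \<Longrightarrow> Lpnorm \<Omega> 6 \<phi> \<le> C6 * h1snorm \<Omega> \<phi>"
    and ladyzh3: "H10 \<Omega> \<phi> \<Longrightarrow> Lpnorm \<Omega> 3 \<phi> \<le> C3 * sqrt (l2norm \<Omega> \<phi>) * sqrt (h1snorm \<Omega> \<phi>)"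
begin

lemma Lpnorm_numeral_eq:
  fixes u :: "real^'n \<Rightarrow> real^'n"
  shows "Lpnorm \<Omega> (numeral k) u = (LINT x|D. norm (u x) ^ numeral k) powr (1 / numeral k)"
  by (simp add: Lpnorm_def integral_domain)

lemma Lpnorm_nonneg: "0 \<le> Lpnorm \<Omega> p u"
  by (simp add: Lpnorm_def)

lemma h1snorm_test_field_bounded:
  assumes "H10 \<Omega> u" "\<And>n. test_field (\<psi> n)" "(\<lambda>n. h1snorm \<Omega> (\<lambda>x. u x - \<psi> n x)) \<longlonglongrightarrow> 0"
  shows "\<exists>B\<ge>0. \<forall>n. h1snorm \<Omega> (\<psi> n) \<le> B"
proof -
  obtain B where B: "\<And>n. \<bar>h1snorm \<Omega> (\<lambda>x. u x - \<psi> n x)\<bar> \<le> B"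
    using convergent_imp_Bseq[OF convergentI[OF assms(3)]] by (auto simp: Bseq_def)
  have "h1snorm \<Omega> (\<psi> n) \<le> h1snorm \<Omega> u + B" for n
  proof -
    have d: "H10 \<Omega> (\<lambda>x. u x - \<psi> n x)" by (intro H10_diff assms(1) H10_test_field[OF assms(2)])
    show ?thesis
      using h1snorm_triangle[OF assms(1) H10_scaleR[OF d, of "-1"]] h1snorm_scaleR[OF d, of "-1"] B[of n]
      by simp
  qed
  moreover have "h1snorm \<Omega> u + B \<ge> 0"
    using h1snorm_nonneg[of u] B[of 0] by linarith
  ultimately show ?thesis by blast
qed

lemma test_field_norm_power_integrable:
  assumes "test_field \<psi>"
  shows "integrable D (\<lambda>x. norm (\<psi> x) ^ k)"
proof -
  interpret finite_measure D by (rule finite_measure_domain)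
  have "\<forall>i. \<exists>B. \<forall>x. \<bar>\<psi> x $ i\<bar> \<le> B" using assms test_fun_bounded by blast
  then obtain B where B: "\<And>i x. \<bar>\<psi> x $ i\<bar> \<le> B i" by metis
  have b: "norm (\<psi> x) \<le> (\<Sum>i\<in>UNIV. B i)" for x
    by (rule order_trans[OF norm_le_l1_cart]) (intro sum_mono B)
  show ?thesis
    by (rule integrable_const_bound[where B="(\<Sum>i\<in>UNIV. B i) ^ k"])
       (use b L2_measurable[OF L2_test_field[OF assms]] in \<open>auto intro!: power_mono\<close>)
qed

text \<open>Fatou's lemma along an almost everywhere convergent subsequence of test fields. The integrability does not
  follow from the bound on \<open>Lpnorm\<close> alone, because the integral of a non-integrable function is \<open>0\<close>.\<close>

lemma H10_L6_integrable:
  assumes "H10 \<Omega> u"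
  shows "integrable D (\<lambda>x. norm (u x) ^ 6)"
proof -
  obtain \<psi> where p: "\<And>n. test_field (\<psi> n)" "(\<lambda>n. l2norm \<Omega> (\<lambda>x. u x - \<psi> n x)) \<longlonglongrightarrow> 0"
     "(\<lambda>n. h1snorm \<Omega> (\<lambda>x. u x - \<psi> n x)) \<longlonglongrightarrow> 0" by (rule H10_dense[OF assms]) blast
  have L: "L2 \<Omega> (\<lambda>x. u x - \<psi> n x)" for n
    by (intro L2_diff H10_L2 assms L2_test_field p)
  have um: "u \<in> borel_measurable D" using L2_measurable[OF H10_L2[OF assms]] .
  have pm: "\<psi> n \<in> borel_measurable D" for n using L2_measurable[OF L2_test_field[OF p(1)]] .
  have "(\<lambda>n. (l2norm \<Omega> (\<lambda>x. u x - \<psi> n x))\<^sup>2) \<longlonglongrightarrow> 0"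
    using tendsto_power[OF p(2), of 2] by simp
  \<comment> \<open>Squared L2 distances read as L1 norms, so that L1 convergence supplies the
    almost everywhere convergent subsequence.\<close>
  then have "(\<lambda>n. LINT x|D. norm ((norm (u x - \<psi> n x))\<^sup>2)) \<longlonglongrightarrow> 0"
    by (simp add: l2norm_power2 l2ip_self)
  with L obtain r :: "nat \<Rightarrow> nat" where r: "strict_mono r" "AE x in D. (\<lambda>n. (norm (u x - \<psi> (r n) x))\<^sup>2) \<longlonglongrightarrow> 0"
    using tendsto_L1_AE_subseq[of D "\<lambda>n x. (norm (u x - \<psi> n x))\<^sup>2"] by (auto simp: L2_iff)
  obtain B where B: "B \<ge> 0" "\<And>n. h1snorm \<Omega> (\<psi> n) \<le> B" using h1snorm_test_field_bounded[OF assms p(1,3)] by blast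
  have bnd: "(LINT x|D. norm (\<psi> n x) ^ 6) \<le> (C6 * B) ^ 6" for n
  proof -
    have "Lpnorm \<Omega> 6 (\<psi> n) \<le> C6 * B"
      using sobolev6[OF H10_test_field[OF p(1)]] B(2)[of n] C6_nonneg
      by (meson mult_left_mono order_trans)
    then have "Lpnorm \<Omega> 6 (\<psi> n) ^ 6 \<le> (C6 * B) ^ 6" by (intro power_mono Lpnorm_nonneg)
    moreover have "Lpnorm \<Omega> 6 (\<psi> n) ^ 6 = Lpnorm \<Omega> 6 (\<psi> n) powr 6" by (simp add: Lpnorm_nonneg)
    then have "Lpnorm \<Omega> 6 (\<psi> n) ^ 6 = (LINT x|D. norm (\<psi> n x) ^ 6)"
      by (simp add: Lpnorm_numeral_eq powr_powr)
    ultimately show ?thesis by simp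
  qed
  have AE: "AE x in D. ennreal (norm (u x) ^ 6) = liminf (\<lambda>n. ennreal (norm (\<psi> (r n) x) ^ 6))"
    using r(2)
  proof eventually_elim
    fix x assume "(\<lambda>n. (norm (u x - \<psi> (r n) x))\<^sup>2) \<longlonglongrightarrow> 0"
    from tendsto_real_sqrt[OF this] have "(\<lambda>n. u x - \<psi> (r n) x) \<longlonglongrightarrow> 0"
      by (simp add: tendsto_norm_zero_iff)
    from tendsto_diff[OF tendsto_const this, of "u x"] have "(\<lambda>n. \<psi> (r n) x) \<longlonglongrightarrow> u x" by simp
    then have "(\<lambda>n. ennreal (norm (\<psi> (r n) x) ^ 6)) \<longlonglongrightarrow> ennreal (norm (u x) ^ 6)"
      by (intro tendsto_ennrealI tendsto_power tendsto_norm)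
    then show "ennreal (norm (u x) ^ 6) = liminf (\<lambda>n. ennreal (norm (\<psi> (r n) x) ^ 6))"
      by (rule lim_imp_Liminf[OF sequentially_bot, symmetric])
  qed
  have "(\<integral>\<^sup>+x. ennreal (norm (u x) ^ 6) \<partial>D) = (\<integral>\<^sup>+x. liminf (\<lambda>n. ennreal (norm (\<psi> (r n) x) ^ 6)) \<partial>D)"
    by (rule nn_integral_cong_AE[OF AE])
  also have "\<dots> \<le> liminf (\<lambda>n. \<integral>\<^sup>+x. ennreal (norm (\<psi> (r n) x) ^ 6) \<partial>D)"
    by (rule nn_integral_liminf) (use pm in auto)
  also have "\<dots> \<le> liminf (\<lambda>n. ennreal ((C6 * B) ^ 6))"
  proof (rule Liminf_mono, rule always_eventually, rule allI)
    fix n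
    \<comment> \<open>Powers of test fields are integrable, so for them the real integral is the
      true one and the Sobolev bound transfers to the nonnegative integral.\<close>
    have "(\<integral>\<^sup>+x. ennreal (norm (\<psi> (r n) x) ^ 6) \<partial>D) = ennreal (LINT x|D. norm (\<psi> (r n) x) ^ 6)"
      by (rule nn_integral_eq_integral) (auto intro: test_field_norm_power_integrable[OF p(1)])
    then show "(\<integral>\<^sup>+x. ennreal (norm (\<psi> (r n) x) ^ 6) \<partial>D) \<le> ennreal ((C6 * B) ^ 6)"
      using bnd by (simp add: ennreal_leI)
  qed
  also have "\<dots> < \<infinity>" by (simp add: Liminf_const)
  finally show ?thesis using um by (intro integrableI_bounded) auto
qed

text \<open>Pointwise domination: t^3 is at most t^2 for t \<le> 1 and at most t^6 beyond.\<close>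

lemma H10_L3_integrable:
  assumes "H10 \<Omega> u"
  shows "integrable D (\<lambda>x. norm (u x) ^ 3)"
proof (rule Bochner_Integration.integrable_bound)
  show "integrable D (\<lambda>x. (norm (u x))\<^sup>2 + norm (u x) ^ 6)"
    using H10_L6_integrable[OF assms] H10_L2[OF assms] by (auto simp: L2_iff)
  show "(\<lambda>x. norm (u x) ^ 3) \<in> borel_measurable D"
    using H10_L2[OF assms] by (auto simp: L2_iff)
  have "t ^ 3 \<le> t\<^sup>2 + t ^ 6" if "t \<ge> 0" for t :: real
  proof (cases "t \<le> 1")
    case True
    then have "t ^ 3 \<le> t ^ 2" using that by (intro power_decreasing) auto
    then show ?thesis using that by (simp add: add_increasing2)
  next
    case False
    then have "t ^ 3 \<le> t ^ 6" by (intro power_increasing) auto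
    then show ?thesis by (simp add: add_increasing)
  qed
  then show "AE x in D. norm (norm (u x) ^ 3) \<le> norm ((norm (u x))\<^sup>2 + norm (u x) ^ 6)"
    by simp
qed

text \<open>The codomain of G is left general, since G is a matrix field in the convective term and
  a scalar field in the divergence term.\<close>

lemma trilinear_holder:
  fixes G :: "real^'n \<Rightarrow> 'b::euclidean_space"
  assumes "H10 \<Omega> u" "L2 \<Omega> G" "H10 \<Omega> w"
  shows "integrable D (\<lambda>x. norm (u x) * norm (G x) * norm (w x))"
    and "(LINT x|D. norm (u x) * norm (G x) * norm (w x)) \<le> Lpnorm \<Omega> 3 u * l2norm \<Omega> G * Lpnorm \<Omega> 6 w"
proof -
  note H = holder_three[of "\<lambda>x. norm (u x)" D "\<lambda>x. norm (G x)" "\<lambda>x. norm (w x)"]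
  have m: "u \<in> borel_measurable D" "G \<in> borel_measurable D" "w \<in> borel_measurable D"
    using assms by (auto intro: L2_measurable H10_L2)
  show "integrable D (\<lambda>x. norm (u x) * norm (G x) * norm (w x))"
    using m assms H10_L3_integrable H10_L6_integrable by (intro H(1)) (auto simp: L2_iff)
  show "(LINT x|D. norm (u x) * norm (G x) * norm (w x)) \<le> Lpnorm \<Omega> 3 u * l2norm \<Omega> G * Lpnorm \<Omega> 6 w"
    unfolding Lpnorm_numeral_eq l2norm_def l2ip_self
    using m assms H10_L3_integrable H10_L6_integrable by (intro H(2)) (auto simp: L2_iff)
qed

definition conv :: "(real^'n \<Rightarrow> real^'n) \<Rightarrow> (real^'n \<Rightarrow> real^'n) \<Rightarrow> (real^'n \<Rightarrow> real^'n) \<Rightarrow> real^'n \<Rightarrow> real" where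
  "conv v w z x = (grad \<Omega> w x *v v x) \<bullet> z x"

definition divt :: "(real^'n \<Rightarrow> real^'n) \<Rightarrow> (real^'n \<Rightarrow> real^'n) \<Rightarrow> (real^'n \<Rightarrow> real^'n) \<Rightarrow> real^'n \<Rightarrow> real" where
  "divt v w z x = divg \<Omega> v x * (w x \<bullet> z x)"

text \<open>\<open>norm\<close> on matrices is the Frobenius norm, so Cauchy-Schwarz in each row
  suffices.\<close>

lemma norm_matrix_vector_le: "norm (A *v v) \<le> norm A * norm v" for A :: "real^'n^'n"
proof -
  have "norm (A *v v) = L2_set (\<lambda>i. row i A \<bullet> v) UNIV"
    by (simp add: norm_vec_def L2_set_def matrix_vector_mult_def row_def inner_vec_def)
  also have "\<dots> \<le> L2_set (\<lambda>i. norm (A $ i) * norm v) UNIV"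
    unfolding L2_set_def
  proof (intro real_sqrt_le_mono sum_mono)
    fix i
    have "row i A = A $ i" by (simp add: row_def vec_eq_iff)
    then have "\<bar>row i A \<bullet> v\<bar> \<le> norm (A $ i) * norm v" by (simp add: Cauchy_Schwarz_ineq2)
    then show "(row i A \<bullet> v)\<^sup>2 \<le> (norm (A $ i) * norm v)\<^sup>2" by (metis abs_ge_zero power2_abs power_mono)
  qed
  also have "\<dots> = norm A * norm v"
    by (simp add: norm_vec_def[of A] L2_set_left_distrib)
  finally show ?thesis .
qed

lemma conv_measurable:
  assumes "H10 \<Omega> v" "H10 \<Omega> w" "H10 \<Omega> z"
  shows "conv v w z \<in> borel_measurable D"
proof -
  have "conv v w z = (\<lambda>x. \<Sum>i\<in>UNIV. (\<Sum>j\<in>UNIV. grad \<Omega> w x $ i $ j * v x $ j) * z x $ i)"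
    by (simp add: fun_eq_iff conv_def inner_vec_def matrix_vector_mult_def)
  moreover have "\<dots> \<in> borel_measurable D"
    using assms by (intro borel_measurable_sum borel_measurable_times L2_measurable L2_nth H10_L2 H10_L2_grad)
  ultimately show ?thesis by simp
qed

lemma divt_measurable:
  assumes "H10 \<Omega> v" "H10 \<Omega> w" "H10 \<Omega> z"
  shows "divt v w z \<in> borel_measurable D"
  unfolding divt_def[abs_def] using assms
  by (intro borel_measurable_times borel_measurable_inner L2_measurable L2_divg H10_L2)

lemma conv_bound:
  assumes "H10 \<Omega> v" "H10 \<Omega> w" "H10 \<Omega> z"
  shows "integrable D (conv v w z)"
    and "\<bar>LINT x|D. conv v w z x\<bar> \<le> Lpnorm \<Omega> 3 v * h1snorm \<Omega> w * Lpnorm \<Omega> 6 z"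
proof -
  note T = trilinear_holder[OF assms(1) H10_L2_grad[OF assms(2)] assms(3)]
  have le: "\<bar>conv v w z x\<bar> \<le> norm (v x) * norm (grad \<Omega> w x) * norm (z x)" for x
  proof -
    have "\<bar>conv v w z x\<bar> \<le> norm (grad \<Omega> w x *v v x) * norm (z x)"
      unfolding conv_def by (rule Cauchy_Schwarz_ineq2)
    also have "\<dots> \<le> (norm (grad \<Omega> w x) * norm (v x)) * norm (z x)"
      by (intro mult_right_mono norm_matrix_vector_le) auto
    finally show ?thesis by (simp add: mult_ac)
  qed
  show i: "integrable D (conv v w z)"
    by (rule Bochner_Integration.integrable_bound[OF T(1)]) (use le conv_measurable[OF assms] in auto)
  have "\<bar>LINT x|D. conv v w z x\<bar> \<le> (LINT x|D. \<bar>conv v w z x\<bar>)" by (rule integral_abs_bound)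
  also have "\<dots> \<le> (LINT x|D. norm (v x) * norm (grad \<Omega> w x) * norm (z x))"
    by (rule integral_mono) (use i T(1) le in auto)
  also note T(2)
  finally show "\<bar>LINT x|D. conv v w z x\<bar> \<le> Lpnorm \<Omega> 3 v * h1snorm \<Omega> w * Lpnorm \<Omega> 6 z"
    by (simp add: h1snorm_def)
qed

lemma divt_bound:
  assumes "H10 \<Omega> v" "H10 \<Omega> w" "H10 \<Omega> z"
  shows "integrable D (divt v w z)"
    and "\<bar>LINT x|D. divt v w z x\<bar> \<le> Lpnorm \<Omega> 3 w * l2norm \<Omega> (divg \<Omega> v) * Lpnorm \<Omega> 6 z"
proof -
  note T = trilinear_holder[OF assms(2) L2_divg[OF assms(1)] assms(3)]
  have le: "\<bar>divt v w z x\<bar> \<le> norm (w x) * norm (divg \<Omega> v x) * norm (z x)" for x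
  proof -
    have "\<bar>divt v w z x\<bar> \<le> \<bar>divg \<Omega> v x\<bar> * (norm (w x) * norm (z x))"
      unfolding divt_def abs_mult by (intro mult_left_mono Cauchy_Schwarz_ineq2) auto
    then show ?thesis by (simp add: mult_ac)
  qed
  show i: "integrable D (divt v w z)"
    by (rule Bochner_Integration.integrable_bound[OF T(1)]) (use le divt_measurable[OF assms] in auto)
  have "\<bar>LINT x|D. divt v w z x\<bar> \<le> (LINT x|D. \<bar>divt v w z x\<bar>)" by (rule integral_abs_bound)
  also have "\<dots> \<le> (LINT x|D. norm (w x) * norm (divg \<Omega> v x) * norm (z x))"
    by (rule integral_mono) (use i T(1) le in auto)
  also note T(2)
  finally show "\<bar>LINT x|D. divt v w z x\<bar> \<le> Lpnorm \<Omega> 3 w * l2norm \<Omega> (divg \<Omega> v) * Lpnorm \<Omega> 6 z" .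
qed

lemma bstar_eq: "bstar \<Omega> v w z = (LINT x|D. conv v w z x) + 1/2 * (LINT x|D. divt v w z x)"
  by (simp add: bstar_def integral_domain conv_def divt_def)

lemma bstar_eq_integral:
  assumes "H10 \<Omega> v" "H10 \<Omega> w" "H10 \<Omega> z"
  shows "bstar \<Omega> v w z = (LINT x|D. conv v w z x + 1/2 * divt v w z x)"
    and "integrable D (\<lambda>x. conv v w z x + 1/2 * divt v w z x)"
  using conv_bound(1)[OF assms] divt_bound(1)[OF assms] by (auto simp: bstar_eq)

lemma integral_AE_sum:
  fixes f g h :: "'a \<Rightarrow> real"
  assumes "integrable M f" "integrable M g" "integrable M h" "AE x in M. f x = g x + h x"
  shows "integral\<^sup>L M f = integral\<^sup>L M g + integral\<^sup>L M h"
  by (subst Bochner_Integration.integral_add[symmetric, OF assms(2,3)]) (rule integral_cong_AE, use assms in auto)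

lemma integral_AE_scaled:
  fixes f g :: "'a \<Rightarrow> real"
  assumes "integrable M f" "integrable M g" "AE x in M. f x = c * g x"
  shows "integral\<^sup>L M f = c * integral\<^sup>L M g"
  by (subst integral_mult_right_zero[symmetric]) (rule integral_cong_AE, use assms in auto)

lemma bstar_add_1:
  assumes "H10 \<Omega> v" "H10 \<Omega> v'" "H10 \<Omega> w" "H10 \<Omega> z"
  shows "bstar \<Omega> (\<lambda>x. v x + v' x) w z = bstar \<Omega> v w z + bstar \<Omega> v' w z"
  unfolding bstar_eq_integral(1)[OF H10_add[OF assms(1,2)] assms(3,4)] bstar_eq_integral(1)[OF assms(1,3,4)]
    bstar_eq_integral(1)[OF assms(2,3,4)]
proof (rule integral_AE_sum)
  show "AE x in D. conv (\<lambda>x. v x + v' x) w z x + 1/2 * divt (\<lambda>x. v x + v' x) w z x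
     = (conv v w z x + 1/2 * divt v w z x) + (conv v' w z x + 1/2 * divt v' w z x)"
    using grad_add[OF assms(1,2)]
    by eventually_elim (simp add: conv_def divt_def divg_def matrix_vector_right_distrib inner_add_left
        sum.distrib algebra_simps)
qed (intro bstar_eq_integral(2) H10_add assms)+

lemma bstar_add_2:
  assumes "H10 \<Omega> v" "H10 \<Omega> w" "H10 \<Omega> w'" "H10 \<Omega> z"
  shows "bstar \<Omega> v (\<lambda>x. w x + w' x) z = bstar \<Omega> v w z + bstar \<Omega> v w' z"
  unfolding bstar_eq_integral(1)[OF assms(1) H10_add[OF assms(2,3)] assms(4)] bstar_eq_integral(1)[OF assms(1,2,4)]
    bstar_eq_integral(1)[OF assms(1,3,4)]
proof (rule integral_AE_sum)
  show "AE x in D. conv v (\<lambda>x. w x + w' x) z x + 1/2 * divt v (\<lambda>x. w x + w' x) z x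
     = (conv v w z x + 1/2 * divt v w z x) + (conv v w' z x + 1/2 * divt v w' z x)"
    using grad_add[OF assms(2,3)]
    by eventually_elim (simp add: conv_def divt_def matrix_vector_mult_add_rdistrib inner_add_left
        algebra_simps)
qed (intro bstar_eq_integral(2) H10_add assms)+

lemma bstar_add_3:
  assumes "H10 \<Omega> v" "H10 \<Omega> w" "H10 \<Omega> z" "H10 \<Omega> z'"
  shows "bstar \<Omega> v w (\<lambda>x. z x + z' x) = bstar \<Omega> v w z + bstar \<Omega> v w z'"
  unfolding bstar_eq_integral(1)[OF assms(1,2) H10_add[OF assms(3,4)]] bstar_eq_integral(1)[OF assms(1,2,3)]
    bstar_eq_integral(1)[OF assms(1,2,4)]
proof (rule integral_AE_sum)
  show "AE x in D. conv v w (\<lambda>x. z x + z' x) x + 1/2 * divt v w (\<lambda>x. z x + z' x) x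
     = (conv v w z x + 1/2 * divt v w z x) + (conv v w z' x + 1/2 * divt v w z' x)"
    by (simp add: conv_def divt_def inner_add_right algebra_simps)
qed (intro bstar_eq_integral(2) H10_add assms)+

lemma bstar_scaleR_1:
  assumes "H10 \<Omega> v" "H10 \<Omega> w" "H10 \<Omega> z"
  shows "bstar \<Omega> (\<lambda>x. c *\<^sub>R v x) w z = c * bstar \<Omega> v w z"
  unfolding bstar_eq_integral(1)[OF H10_scaleR[OF assms(1)] assms(2,3)] bstar_eq_integral(1)[OF assms]
proof (rule integral_AE_scaled)
  show "AE x in D. conv (\<lambda>x. c *\<^sub>R v x) w z x + 1/2 * divt (\<lambda>x. c *\<^sub>R v x) w z x
     = c * (conv v w z x + 1/2 * divt v w z x)"
    using grad_scaleR[OF assms(1), of c]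
    by eventually_elim (simp add: conv_def divt_def divg_def matrix_vector_mult_scaleR
        sum_distrib_left[symmetric] algebra_simps)
qed (intro bstar_eq_integral(2) H10_scaleR assms)+

lemma bstar_scaleR_2:
  assumes "H10 \<Omega> v" "H10 \<Omega> w" "H10 \<Omega> z"
  shows "bstar \<Omega> v (\<lambda>x. c *\<^sub>R w x) z = c * bstar \<Omega> v w z"
  unfolding bstar_eq_integral(1)[OF assms(1) H10_scaleR[OF assms(2)] assms(3)] bstar_eq_integral(1)[OF assms]
proof (rule integral_AE_scaled)
  show "AE x in D. conv v (\<lambda>x. c *\<^sub>R w x) z x + 1/2 * divt v (\<lambda>x. c *\<^sub>R w x) z x
     = c * (conv v w z x + 1/2 * divt v w z x)"
    using grad_scaleR[OF assms(2), of c]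
    by eventually_elim (simp add: conv_def divt_def scaleR_matrix_vector_assoc[symmetric] algebra_simps)
qed (intro bstar_eq_integral(2) H10_scaleR assms)+

lemma bstar_scaleR_3:
  assumes "H10 \<Omega> v" "H10 \<Omega> w" "H10 \<Omega> z"
  shows "bstar \<Omega> v w (\<lambda>x. c *\<^sub>R z x) = c * bstar \<Omega> v w z"
  by (simp add: bstar_eq conv_def divt_def algebra_simps)

end


section \<open>Skew-symmetry and the bounds of the trilinear form\<close>

context sobolev_domain
begin

lemma Lpnorm3_le:
  assumes "H10 \<Omega> w"
  shows "Lpnorm \<Omega> 3 w \<le> C3 * sqrt CP * h1snorm \<Omega> w"
proof -
  have "sqrt (l2norm \<Omega> w) \<le> sqrt (CP * h1snorm \<Omega> w)"
    using poincare[OF assms] by (rule real_sqrt_le_mono)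
  then have "C3 * sqrt (l2norm \<Omega> w) * sqrt (h1snorm \<Omega> w) \<le> C3 * sqrt (CP * h1snorm \<Omega> w) * sqrt (h1snorm \<Omega> w)"
    using C3_nonneg h1snorm_nonneg by (intro mult_right_mono mult_left_mono) auto
  also have "\<dots> = C3 * sqrt CP * h1snorm \<Omega> w"
    using h1snorm_nonneg[of w] by (simp add: real_sqrt_mult)
  finally show ?thesis using ladyzh3[OF assms] by linarith
qed

text \<open>A crude bound for fixed v that keeps the divergence term, with the norm of div v inside
  K. It provides the continuity in the last two arguments that the density argument for
  skew-symmetry rests on.\<close>

lemma bstar_bounded:
  assumes "H10 \<Omega> v"
  obtains K where "\<And>w z. H10 \<Omega> w \<Longrightarrow> H10 \<Omega> z \<Longrightarrow> \<bar>bstar \<Omega> v w z\<bar> \<le> K * h1snorm \<Omega> w * h1snorm \<Omega> z"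
proof
  define K1 where "K1 = Lpnorm \<Omega> 3 v"
  define K2 where "K2 = l2norm \<Omega> (divg \<Omega> v)"
  fix w z assume w: "H10 \<Omega> w" and z: "H10 \<Omega> z"
  have "K1 * h1snorm \<Omega> w * Lpnorm \<Omega> 6 z \<le> K1 * h1snorm \<Omega> w * (C6 * h1snorm \<Omega> z)"
    using sobolev6[OF z] by (intro mult_left_mono) (auto simp: K1_def Lpnorm_nonneg h1snorm_nonneg)
  with conv_bound(2)[OF assms w z]
  have a: "\<bar>LINT x|D. conv v w z x\<bar> \<le> K1 * h1snorm \<Omega> w * (C6 * h1snorm \<Omega> z)" by (simp add: K1_def)
  have "Lpnorm \<Omega> 3 w * K2 * Lpnorm \<Omega> 6 z \<le> (C3 * sqrt CP * h1snorm \<Omega> w) * K2 * (C6 * h1snorm \<Omega> z)"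
    using sobolev6[OF z] Lpnorm3_le[OF w] C3_nonneg CP_pos
    by (intro mult_mono) (auto simp: K2_def Lpnorm_nonneg h1snorm_nonneg l2norm_nonneg)
  with divt_bound(2)[OF assms w z]
  have b: "\<bar>LINT x|D. divt v w z x\<bar> \<le> (C3 * sqrt CP * h1snorm \<Omega> w) * K2 * (C6 * h1snorm \<Omega> z)" by (simp add: K2_def)
  have "\<bar>bstar \<Omega> v w z\<bar> \<le> \<bar>LINT x|D. conv v w z x\<bar> + 1/2 * \<bar>LINT x|D. divt v w z x\<bar>"
    unfolding bstar_eq by linarith
  also have "\<dots> \<le> K1 * h1snorm \<Omega> w * (C6 * h1snorm \<Omega> z) + 1/2 * ((C3 * sqrt CP * h1snorm \<Omega> w) * K2 * (C6 * h1snorm \<Omega> z))"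
    using a b by linarith
  finally show "\<bar>bstar \<Omega> v w z\<bar> \<le> (K1 * C6 + C3 * sqrt CP * K2 * C6 / 2) * h1snorm \<Omega> w * h1snorm \<Omega> z"
    by (simp add: algebra_simps)
qed

text \<open>With \<phi> the pointwise inner product of \<psi> and \<eta>, the product rule turns the
  sum into the integral of v . grad \<phi> + (div v) \<phi>. Since \<phi> is a test function, its
  j-th summand vanishes by the weak gradient of the component v_j.\<close>

lemma bstar_skew_test_field:
  assumes v: "H10 \<Omega> v" and p: "test_field \<psi>" and e: "test_field \<eta>"
  shows "bstar \<Omega> v \<psi> \<eta> + bstar \<Omega> v \<eta> \<psi> = 0"
proof -
  define \<phi> where "\<phi> x = (\<Sum>i\<in>UNIV. \<psi> x $ i * \<eta> x $ i)" for x
  have ti: "test_fun \<Omega> (\<lambda>x. \<psi> x $ i * \<eta> x $ i)" for i using p e by (intro test_fun_mult) auto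
  then have t: "test_fun \<Omega> \<phi>" unfolding \<phi>_def[abs_def] by (intro test_fun_sum)
  have pd: "pderiv \<phi> j x = (\<Sum>i\<in>UNIV. jac \<psi> x $ i $ j * \<eta> x $ i + \<psi> x $ i * jac \<eta> x $ i $ j)" for j x
    unfolding \<phi>_def[abs_def] using p e
    by (subst pderiv_sum[OF _ ti]) (auto simp: pderiv_mult test_fun_differentiable[where A=\<Omega>] jac_def)
  have Hp: "H10 \<Omega> \<psi>" "H10 \<Omega> \<eta>" using p e by (auto intro: H10_test_field)
  have i1: "integrable D (\<lambda>x. v x $ j * pderiv \<phi> j x)" for j
    by (intro L2_mult_integrable L2_nth H10_L2 v L2_pderiv t)
  have i2: "integrable D (\<lambda>x. grad \<Omega> v x $ j $ j * \<phi> x)" for j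
    by (intro L2_mult_integrable L2_nth H10_L2_grad v L2_test_fun t)
  have "bstar \<Omega> v \<psi> \<eta> + bstar \<Omega> v \<eta> \<psi>
    = (LINT x|D. (conv v \<psi> \<eta> x + 1/2 * divt v \<psi> \<eta> x) + (conv v \<eta> \<psi> x + 1/2 * divt v \<eta> \<psi> x))"
    using bstar_eq_integral[OF v Hp] bstar_eq_integral[OF v Hp(2,1)]
    by (simp only: Bochner_Integration.integral_add)
  also have "\<dots> = (LINT x|D. (\<Sum>j\<in>UNIV. v x $ j * pderiv \<phi> j x + grad \<Omega> v x $ j $ j * \<phi> x))"
  proof (rule integral_cong_AE)
    show "AE x in D. (conv v \<psi> \<eta> x + 1/2 * divt v \<psi> \<eta> x) + (conv v \<eta> \<psi> x + 1/2 * divt v \<eta> \<psi> x)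
       = (\<Sum>j\<in>UNIV. v x $ j * pderiv \<phi> j x + grad \<Omega> v x $ j $ j * \<phi> x)"
      using H1_test_field(2)[OF p] H1_test_field(2)[OF e]
    proof eventually_elim
      fix x assume g: "grad \<Omega> \<psi> x = jac \<psi> x" "grad \<Omega> \<eta> x = jac \<eta> x"
      have ip: "\<psi> x \<bullet> \<eta> x = \<phi> x" "\<eta> x \<bullet> \<psi> x = \<phi> x" by (auto simp: \<phi>_def inner_vec_def mult.commute)
      \<comment> \<open>The factor 1/2 of \<open>bstar\<close> is what makes both forms together
        contain exactly one divergence term.\<close>
      have d: "1/2 * divt v \<psi> \<eta> x + 1/2 * divt v \<eta> \<psi> x = (\<Sum>j\<in>UNIV. grad \<Omega> v x $ j $ j * \<phi> x)"
        by (simp add: divt_def ip divg_def sum_distrib_right)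
      have "conv v \<psi> \<eta> x + conv v \<eta> \<psi> x
        = (\<Sum>i\<in>UNIV. \<Sum>j\<in>UNIV. v x $ j * (jac \<psi> x $ i $ j * \<eta> x $ i + \<psi> x $ i * jac \<eta> x $ i $ j))"
        unfolding conv_def g inner_vec_def matrix_vector_mult_def
        by (simp add: sum.distrib sum_distrib_right sum_distrib_left distrib_left mult_ac)
      also have "\<dots> = (\<Sum>j\<in>UNIV. v x $ j * pderiv \<phi> j x)"
        by (subst sum.swap) (simp add: pd sum_distrib_left)
      finally show "(conv v \<psi> \<eta> x + 1/2 * divt v \<psi> \<eta> x) + (conv v \<eta> \<psi> x + 1/2 * divt v \<eta> \<psi> x)
       = (\<Sum>j\<in>UNIV. v x $ j * pderiv \<phi> j x + grad \<Omega> v x $ j $ j * \<phi> x)"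
        using d by (simp only: sum.distrib)
    qed
    show "(\<lambda>x. (conv v \<psi> \<eta> x + 1/2 * divt v \<psi> \<eta> x) + (conv v \<eta> \<psi> x + 1/2 * divt v \<eta> \<psi> x)) \<in> borel_measurable D"
      by (intro borel_measurable_integrable Bochner_Integration.integrable_add[OF bstar_eq_integral(2)[OF v Hp] bstar_eq_integral(2)[OF v Hp(2,1)]])
    show "(\<lambda>x. \<Sum>j\<in>UNIV. v x $ j * pderiv \<phi> j x + grad \<Omega> v x $ j $ j * \<phi> x) \<in> borel_measurable D"
      by (intro borel_measurable_integrable Bochner_Integration.integrable_sum Bochner_Integration.integrable_add i1 i2)
  qed
  also have "\<dots> = (\<Sum>j\<in>UNIV. (LINT x|D. v x $ j * pderiv \<phi> j x) + (LINT x|D. grad \<Omega> v x $ j $ j * \<phi> x))"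
    using i1 i2 by simp
  also have "\<dots> = 0"
    using weak_gradD[OF _ t, of v "grad \<Omega> v"] H1_grad[OF H10_H1[OF v]] by simp
  finally show ?thesis .
qed

lemma bstar_diff_2:
  assumes "H10 \<Omega> v" "H10 \<Omega> w" "H10 \<Omega> w'" "H10 \<Omega> z"
  shows "bstar \<Omega> v (\<lambda>x. w x - w' x) z = bstar \<Omega> v w z - bstar \<Omega> v w' z"
  using bstar_add_2[OF assms(1,2) H10_scaleR[OF assms(3), of "-1"] assms(4)] bstar_scaleR_2[OF assms(1,3,4), of "-1"]
  by simp

lemma bstar_diff_3:
  assumes "H10 \<Omega> v" "H10 \<Omega> w" "H10 \<Omega> z" "H10 \<Omega> z'"
  shows "bstar \<Omega> v w (\<lambda>x. z x - z' x) = bstar \<Omega> v w z - bstar \<Omega> v w z'"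
  using bstar_add_3[OF assms(1,2,3) H10_scaleR[OF assms(4), of "-1"]] bstar_scaleR_3[OF assms(1,2,4), of "-1"]
  by simp

lemma bstar_diff_1:
  assumes "H10 \<Omega> v" "H10 \<Omega> v'" "H10 \<Omega> w" "H10 \<Omega> z"
  shows "bstar \<Omega> (\<lambda>x. v x - v' x) w z = bstar \<Omega> v w z - bstar \<Omega> v' w z"
  using bstar_add_1[OF assms(1) H10_scaleR[OF assms(2), of "-1"] assms(3,4)] bstar_scaleR_1[OF assms(2,3,4), of "-1"]
  by simp

lemma bstar_skew:
  assumes v: "H10 \<Omega> v" and w: "H10 \<Omega> w" and z: "H10 \<Omega> z"
  shows "bstar \<Omega> v w z = - bstar \<Omega> v z w"
proof -
  obtain K where K: "\<And>w z. H10 \<Omega> w \<Longrightarrow> H10 \<Omega> z \<Longrightarrow> \<bar>bstar \<Omega> v w z\<bar> \<le> K * h1snorm \<Omega> w * h1snorm \<Omega> z"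
    using bstar_bounded[OF v] by blast
  \<comment> \<open>The density argument for one slot, applied twice: first to w with a test field
    in the other slot, then to z with w in the other slot.\<close>
  have step: "bstar \<Omega> v w z + bstar \<Omega> v z w = 0"
    if w: "H10 \<Omega> w" and z: "H10 \<Omega> z" and tst: "\<And>\<psi>. test_field \<psi> \<Longrightarrow> bstar \<Omega> v \<psi> z + bstar \<Omega> v z \<psi> = 0" for w z
  proof -
    obtain \<psi> where p: "\<And>n. test_field (\<psi> n)" "(\<lambda>n. h1snorm \<Omega> (\<lambda>x. w x - \<psi> n x)) \<longlonglongrightarrow> 0"
      by (rule H10_dense[OF w]) blast
    have bd: "\<bar>bstar \<Omega> v w z + bstar \<Omega> v z w\<bar> \<le> 2 * K * h1snorm \<Omega> z * h1snorm \<Omega> (\<lambda>x. w x - \<psi> n x)" for n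
    proof -
      have pn: "H10 \<Omega> (\<psi> n)" using p by (intro H10_test_field) auto
      have d: "H10 \<Omega> (\<lambda>x. w x - \<psi> n x)" by (intro H10_diff w pn)
      have "bstar \<Omega> v w z + bstar \<Omega> v z w = bstar \<Omega> v (\<lambda>x. w x - \<psi> n x) z + bstar \<Omega> v z (\<lambda>x. w x - \<psi> n x)"
        using tst[OF p(1), of n] bstar_diff_2[OF v w pn z] bstar_diff_3[OF v z w pn] by simp
      then show ?thesis using K[OF d z] K[OF z d] by (simp add: mult_ac abs_le_iff) 
    qed
    have "(\<lambda>n. 2 * K * h1snorm \<Omega> z * h1snorm \<Omega> (\<lambda>x. w x - \<psi> n x)) \<longlonglongrightarrow> 2 * K * h1snorm \<Omega> z * 0"
      by (intro tendsto_intros p)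
    then have "\<bar>bstar \<Omega> v w z + bstar \<Omega> v z w\<bar> \<le> 2 * K * h1snorm \<Omega> z * 0"
      by (rule LIMSEQ_le_const) (use bd in auto)
    then show ?thesis by simp
  qed
  have "bstar \<Omega> v w \<eta> + bstar \<Omega> v \<eta> w = 0" if "test_field \<eta>" for \<eta>
    by (rule step[OF w H10_test_field[OF that] bstar_skew_test_field[OF v _ that]])
  then have "bstar \<Omega> v \<eta> w + bstar \<Omega> v w \<eta> = 0" if "test_field \<eta>" for \<eta>
    using that by (simp add: add.commute)
  from step[OF z w this] show ?thesis by simp
qed

lemma bstar_same: "H10 \<Omega> v \<Longrightarrow> H10 \<Omega> w \<Longrightarrow> bstar \<Omega> v w w = 0"
  using bstar_skew[of v w w] by simp

text \<open>By skew-symmetry the divergence term cancels in \<open>bstar v w z = (bstar v w z - bstar v z w) / 2\<close>, so that only the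
  \<open>L\<^sup>3\<close> norm of the convecting field enters.\<close>

lemma bstar_interpolated_bound:
  assumes v: "H10 \<Omega> v" and w: "H10 \<Omega> w" and z: "H10 \<Omega> z"
  shows "\<bar>bstar \<Omega> v w z\<bar> \<le> C3 * C6 * sqrt (l2norm \<Omega> v * h1snorm \<Omega> v) * h1snorm \<Omega> w * h1snorm \<Omega> z"
proof -
  define A where "A = (LINT x|D. conv v w z x)"
  define B where "B = (LINT x|D. conv v z w x)"
  define h where "h = Lpnorm \<Omega> 3 v * (C6 * h1snorm \<Omega> w * h1snorm \<Omega> z)"
  have "divt v w z = divt v z w" by (simp add: divt_def fun_eq_iff inner_commute)
  then have "2 * bstar \<Omega> v w z = A - B"
    using bstar_skew[OF v w z] by (simp add: bstar_eq A_def B_def)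
  moreover have "Lpnorm \<Omega> 3 v * h1snorm \<Omega> w * Lpnorm \<Omega> 6 z \<le> Lpnorm \<Omega> 3 v * h1snorm \<Omega> w * (C6 * h1snorm \<Omega> z)"
    using sobolev6[OF z] by (intro mult_left_mono) (auto simp: Lpnorm_nonneg h1snorm_nonneg)
  then have "\<bar>A\<bar> \<le> h" using conv_bound(2)[OF v w z] by (simp add: A_def h_def mult_ac)
  moreover have "Lpnorm \<Omega> 3 v * h1snorm \<Omega> z * Lpnorm \<Omega> 6 w \<le> Lpnorm \<Omega> 3 v * h1snorm \<Omega> z * (C6 * h1snorm \<Omega> w)"
    using sobolev6[OF w] by (intro mult_left_mono) (auto simp: Lpnorm_nonneg h1snorm_nonneg)
  then have "\<bar>B\<bar> \<le> h" using conv_bound(2)[OF v z w] by (simp add: B_def h_def mult_ac)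
  ultimately have "\<bar>bstar \<Omega> v w z\<bar> \<le> h" by linarith
  also have "h \<le> (C3 * sqrt (l2norm \<Omega> v) * sqrt (h1snorm \<Omega> v)) * (C6 * h1snorm \<Omega> w * h1snorm \<Omega> z)"
    unfolding h_def using ladyzh3[OF v] C6_nonneg by (intro mult_right_mono) (auto simp: h1snorm_nonneg)
  finally show ?thesis by (simp add: real_sqrt_mult mult_ac)
qed

text \<open>Poincare's inequality trades the L2 half of the interpolated bound for a gradient, which
  is the origin of M.\<close>

lemma bstar_bound:
  assumes v: "H10 \<Omega> v" and w: "H10 \<Omega> w" and z: "H10 \<Omega> z"
  shows "\<bar>bstar \<Omega> v w z\<bar> \<le> sqrt CP * C3 * C6 * h1snorm \<Omega> v * h1snorm \<Omega> w * h1snorm \<Omega> z"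
proof -
  have "sqrt (l2norm \<Omega> v * h1snorm \<Omega> v) \<le> sqrt ((CP * h1snorm \<Omega> v) * h1snorm \<Omega> v)"
    using poincare[OF v] h1snorm_nonneg by (intro real_sqrt_le_mono mult_right_mono) auto
  also have "\<dots> = sqrt CP * h1snorm \<Omega> v"
    using h1snorm_nonneg[of v] by (simp add: real_sqrt_mult)
  finally have "C3 * C6 * sqrt (l2norm \<Omega> v * h1snorm \<Omega> v) * h1snorm \<Omega> w * h1snorm \<Omega> z
     \<le> C3 * C6 * (sqrt CP * h1snorm \<Omega> v) * h1snorm \<Omega> w * h1snorm \<Omega> z"
    using C3_nonneg C6_nonneg h1snorm_nonneg by (intro mult_right_mono mult_left_mono) auto
  with bstar_interpolated_bound[OF assms] show ?thesis by (simp add: mult_ac)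
qed

end


section \<open>The Picard operator and the Anderson residual\<close>

context bounded_open
begin

lemma H10_zero: "H10 \<Omega> (\<lambda>x. 0)"
  by (rule H10_test_field) (simp add: test_fun_zero)

lemma lin_comb_empty: "lin_comb c {} w = (\<lambda>x. 0)"
  by (simp add: lin_comb_def)

lemma lin_comb_insert: "finite A \<Longrightarrow> i \<notin> A \<Longrightarrow> lin_comb c (insert i A) w = (\<lambda>x. c i *\<^sub>R w i x + lin_comb c A w x)"
  by (simp add: lin_comb_def)

lemma H10_lin_comb:
  assumes "finite A" "\<And>j. j \<in> A \<Longrightarrow> H10 \<Omega> (w j)"
  shows "H10 \<Omega> (lin_comb c A w)"
  using assms
proof (induction A)
  case empty
  then show ?case by (simp add: lin_comb_empty H10_zero)
next
  case (insert i A)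
  then show ?case by (simp add: lin_comb_insert H10_add H10_scaleR)
qed

lemma L2_lin_comb:
  fixes w :: "nat \<Rightarrow> real^'n \<Rightarrow> 'b::euclidean_space"
  assumes "finite A" "\<And>j. j \<in> A \<Longrightarrow> L2 \<Omega> (w j)"
  shows "L2 \<Omega> (lin_comb c A w)"
  using assms
proof (induction A)
  case empty
  then show ?case by (intro L2_bounded[of _ 0]) (auto simp: lin_comb_empty)
next
  case (insert i A)
  then show ?case by (simp add: lin_comb_insert L2_add L2_scaleR)
qed

lemma grad_lin_comb:
  assumes "finite A" "\<And>j. j \<in> A \<Longrightarrow> H10 \<Omega> (w j)"
  shows "AE x in D. grad \<Omega> (lin_comb c A w) x = lin_comb c A (\<lambda>j. grad \<Omega> (w j)) x"
  using assms
proof (induction A)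
  case empty
  have "AE x in D. grad \<Omega> (\<lambda>x. 0 *\<^sub>R 0) x = 0 *\<^sub>R grad \<Omega> (\<lambda>x. 0) x"
    by (rule grad_scaleR[OF H10_zero])
  then show ?case by (simp add: lin_comb_empty)
next
  case (insert i A)
  have wi: "H10 \<Omega> (w i)" and wA: "\<And>j. j \<in> A \<Longrightarrow> H10 \<Omega> (w j)" using insert.prems by auto
  have "AE x in D. grad \<Omega> (\<lambda>x. c i *\<^sub>R w i x + lin_comb c A w x) x = grad \<Omega> (\<lambda>x. c i *\<^sub>R w i x) x + grad \<Omega> (lin_comb c A w) x"
    by (rule grad_add[OF H10_scaleR[OF wi] H10_lin_comb[OF insert.hyps(1) wA]])
  moreover have "AE x in D. grad \<Omega> (lin_comb c A w) x = lin_comb c A (\<lambda>j. grad \<Omega> (w j)) x"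
    by (rule insert.IH[OF wA])
  ultimately show ?case using grad_scaleR[OF wi, of "c i"]
    unfolding lin_comb_insert[OF insert.hyps] by eventually_elim simp
qed

text \<open>Connects the combinations of gradients in the claim with the gradients of combinations
  in the estimates.\<close>

lemma h1snorm_lin_comb:
  assumes "finite A" "\<And>j. j \<in> A \<Longrightarrow> H10 \<Omega> (w j)"
  shows "l2norm \<Omega> (lin_comb c A (\<lambda>j. grad \<Omega> (w j))) = h1snorm \<Omega> (lin_comb c A w)"
  unfolding h1snorm_def
proof (rule l2norm_cong_AE)
  have "AE x in D. grad \<Omega> (lin_comb c A w) x = lin_comb c A (\<lambda>j. grad \<Omega> (w j)) x"
    by (rule grad_lin_comb[OF assms])
  then show "AE x in D. lin_comb c A (\<lambda>j. grad \<Omega> (w j)) x = grad \<Omega> (lin_comb c A w) x"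
    by (simp add: eq_commute)
qed (use assms in \<open>auto intro: L2_lin_comb H10_L2_grad H10_lin_comb\<close>)

lemma h1ip_lin_comb:
  assumes "finite A" "\<And>j. j \<in> A \<Longrightarrow> H10 \<Omega> (w j)" "H10 \<Omega> z"
  shows "h1ip \<Omega> (lin_comb c A w) z = (\<Sum>j\<in>A. c j * h1ip \<Omega> (w j) z)"
  using assms
proof (induction A)
  case empty
  then show ?case using h1ip_scaleR_left[OF H10_zero, of z 0] by (simp add: lin_comb_empty)
next
  case (insert i A)
  then show ?case
    by (simp add: lin_comb_insert h1ip_add_left h1ip_scaleR_left H10_scaleR H10_lin_comb)
qed

lemma h1snorm_minus_commute:
  assumes "H10 \<Omega> u" "H10 \<Omega> v"
  shows "h1snorm \<Omega> (\<lambda>x. u x - v x) = h1snorm \<Omega> (\<lambda>x. v x - u x)"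
  using h1snorm_scaleR[OF H10_diff[OF assms], of "-1"] by simp

lemma h1snorm_telescope:
  assumes "\<And>p. H10 \<Omega> (a p)" "i \<le> j"
  shows "h1snorm \<Omega> (\<lambda>x. a j x - a i x) \<le> (\<Sum>p\<in>{Suc i..j}. h1snorm \<Omega> (incr a p))"
  using assms(2)
proof (induction j rule: dec_induct)
  case base
  show ?case using h1snorm_scaleR[OF H10_zero, of 0] by simp
next
  case (step j)
  have "h1snorm \<Omega> (\<lambda>x. a (Suc j) x - a i x) \<le> h1snorm \<Omega> (incr a (Suc j)) + h1snorm \<Omega> (\<lambda>x. a j x - a i x)"
    using h1snorm_triangle[of "incr a (Suc j)" "\<lambda>x. a j x - a i x"] assms(1)
    by (simp add: incr_def H10_diff)
  with step show ?case by simp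
qed

lemma h1ip_diff_left:
  assumes "H10 \<Omega> u" "H10 \<Omega> v" "H10 \<Omega> w"
  shows "h1ip \<Omega> (\<lambda>x. u x - v x) w = h1ip \<Omega> u w - h1ip \<Omega> v w"
  using h1ip_add_left[OF assms(1) H10_scaleR[OF assms(2), of "-1"] assms(3)] h1ip_scaleR_left[OF assms(2,3), of "-1"]
  by simp

end

context sobolev_domain
begin

lemma bstar_lin_comb_1:
  assumes "finite A" "\<And>j. j \<in> A \<Longrightarrow> H10 \<Omega> (v j)" "H10 \<Omega> w" "H10 \<Omega> z"
  shows "bstar \<Omega> (lin_comb c A v) w z = (\<Sum>j\<in>A. c j * bstar \<Omega> (v j) w z)"
  using assms
proof (induction A)
  case empty
  then show ?case using bstar_scaleR_1[OF H10_zero, of w z 0] by (simp add: lin_comb_empty)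
next
  case (insert i A)
  then show ?case
    by (simp add: lin_comb_insert bstar_add_1 bstar_scaleR_1 H10_scaleR H10_lin_comb)
qed

lemma bstar_lin_comb_2:
  assumes "finite A" "\<And>j. j \<in> A \<Longrightarrow> H10 \<Omega> (w j)" "H10 \<Omega> v" "H10 \<Omega> z"
  shows "bstar \<Omega> v (lin_comb c A w) z = (\<Sum>j\<in>A. c j * bstar \<Omega> v (w j) z)"
  using assms
proof (induction A)
  case empty
  then show ?case using bstar_scaleR_2[OF _ H10_zero, of v z 0] by (simp add: lin_comb_empty)
next
  case (insert i A)
  then show ?case
    by (simp add: lin_comb_insert bstar_add_2 bstar_scaleR_2 H10_scaleR H10_lin_comb)
qed

end

text \<open>V is kept abstract as a set of H10 fields closed under sums and multiples, and F as a
  bound of f on V; the final theorem takes the discretely divergence-free fields and the dual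
  norm.\<close>

locale picard_problem = sobolev_domain \<Omega> CP C3 C6 for \<Omega> :: "(real^'n) set" and CP C3 C6 +
  fixes V :: "(real^'n \<Rightarrow> real^'n) set" and f :: "(real^'n \<Rightarrow> real^'n) \<Rightarrow> real" and \<nu> F :: real
  assumes nu_pos: "\<nu> > 0" and F_nonneg: "F \<ge> 0"
    and V_H10: "v \<in> V \<Longrightarrow> H10 \<Omega> v"
    and V_add: "v \<in> V \<Longrightarrow> w \<in> V \<Longrightarrow> (\<lambda>x. v x + w x) \<in> V"
    and V_scaleR: "v \<in> V \<Longrightarrow> (\<lambda>x. c *\<^sub>R v x) \<in> V"
    and f_bound: "v \<in> V \<Longrightarrow> \<bar>f v\<bar> \<le> F * h1snorm \<Omega> v"
begin

definition "M = sqrt CP * C3 * C6"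
definition "\<kappa> = M * F / \<nu>\<^sup>2"

lemma M_nonneg: "M \<ge> 0"
  using CP_pos C3_nonneg C6_nonneg by (simp add: M_def)

lemma kappa_nonneg: "\<kappa> \<ge> 0"
  using M_nonneg F_nonneg by (simp add: \<kappa>_def)

lemma V_diff: "v \<in> V \<Longrightarrow> w \<in> V \<Longrightarrow> (\<lambda>x. v x - w x) \<in> V"
  using V_add[of v "\<lambda>x. (-1) *\<^sub>R w x"] V_scaleR[of w "-1"] by simp

text \<open>Cancels one power of the norm of the test field. When that norm is 0, the sign of b
  gives the claim.\<close>

lemma divide_out:
  assumes "\<nu> * a\<^sup>2 \<le> b * a" "a \<ge> 0" "b \<ge> 0"
  shows "a \<le> b / \<nu>"
proof (cases "a = 0")
  case False
  then have "\<nu> * a \<le> b" using assms by (simp add: power2_eq_square mult.assoc[symmetric])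
  then show ?thesis using nu_pos by (simp add: pos_le_divide_eq mult.commute)
qed (use assms nu_pos in simp)

text \<open>Testing with the solution itself removes the convective term.\<close>

lemma picard_sol_bound:
  assumes "u \<in> V" "picard_sol \<Omega> \<nu> f V u v"
  shows "h1snorm \<Omega> v \<le> F / \<nu>"
proof (rule divide_out)
  have v: "v \<in> V" using assms by (simp add: picard_sol_def)
  then have "\<nu> * (h1snorm \<Omega> v)\<^sup>2 = f v"
    using assms bstar_same[OF V_H10 V_H10, of u v] by (auto simp: picard_sol_def h1ip_self[symmetric])
  also have "\<dots> \<le> F * h1snorm \<Omega> v" using f_bound[OF v] by linarith
  finally show "\<nu> * (h1snorm \<Omega> v)\<^sup>2 \<le> F * h1snorm \<Omega> v" .
qed (auto simp: h1snorm_nonneg F_nonneg)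

text \<open>Subtracting the equations and testing with d = v - v' leaves b(u, d, d) + b(u - u', v',
  d). The first term vanishes, and the a priori bound F / \<nu> for v' completes the
  constant.\<close>

lemma picard_sol_Lipschitz:
  assumes u: "u \<in> V" "u' \<in> V" and sol: "picard_sol \<Omega> \<nu> f V u v" "picard_sol \<Omega> \<nu> f V u' v'"
  shows "h1snorm \<Omega> (\<lambda>x. v x - v' x) \<le> \<kappa> * h1snorm \<Omega> (\<lambda>x. u x - u' x)"
proof -
  define d where "d = (\<lambda>x. v x - v' x)"
  have vV: "v \<in> V" "v' \<in> V" using sol by (auto simp: picard_sol_def)
  have dV: "d \<in> V" unfolding d_def using vV by (rule V_diff)
  note H = V_H10[OF u(1)] V_H10[OF u(2)] V_H10[OF vV(1)] V_H10[OF vV(2)] V_H10[OF dV]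
  have e1: "\<nu> * h1ip \<Omega> v d + bstar \<Omega> u v d = f d" and e2: "\<nu> * h1ip \<Omega> v' d + bstar \<Omega> u' v' d = f d"
    using sol dV by (auto simp: picard_sol_def)
  have "h1ip \<Omega> d d = h1ip \<Omega> v d - h1ip \<Omega> v' d"
    unfolding d_def using H by (intro h1ip_diff_left) (auto simp: d_def)
  then have "\<nu> * h1ip \<Omega> d d = \<nu> * h1ip \<Omega> v d - \<nu> * h1ip \<Omega> v' d" by (simp add: right_diff_distrib)
  moreover have "bstar \<Omega> u d d = bstar \<Omega> u v d - bstar \<Omega> u v' d"
    using bstar_diff_2[OF H(1,3,4,5)] by (simp add: d_def)
  moreover have "bstar \<Omega> u d d = 0" by (rule bstar_same[OF H(1,5)])
  moreover have "bstar \<Omega> (\<lambda>x. u x - u' x) v' d = bstar \<Omega> u v' d - bstar \<Omega> u' v' d"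
    by (rule bstar_diff_1[OF H(1,2,4,5)])
  ultimately have "\<nu> * h1ip \<Omega> d d = - bstar \<Omega> (\<lambda>x. u x - u' x) v' d"
    using e1 e2 by linarith
  then have "\<nu> * (h1snorm \<Omega> d)\<^sup>2 \<le> \<bar>bstar \<Omega> (\<lambda>x. u x - u' x) v' d\<bar>" by (simp add: h1ip_self)
  also have "\<dots> \<le> M * h1snorm \<Omega> (\<lambda>x. u x - u' x) * h1snorm \<Omega> v' * h1snorm \<Omega> d"
    using bstar_bound[OF H10_diff[OF H(1,2)] H(4,5)] by (simp add: M_def)
  also have "\<dots> \<le> M * h1snorm \<Omega> (\<lambda>x. u x - u' x) * (F / \<nu>) * h1snorm \<Omega> d"
    using picard_sol_bound[OF u(2) sol(2)] M_nonneg
    by (intro mult_right_mono mult_left_mono) (auto simp: h1snorm_nonneg)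
  finally have "h1snorm \<Omega> d \<le> (M * h1snorm \<Omega> (\<lambda>x. u x - u' x) * (F / \<nu>)) / \<nu>"
    by (rule divide_out) (use M_nonneg F_nonneg nu_pos in \<open>auto simp: h1snorm_nonneg\<close>)
  then show ?thesis by (simp add: d_def \<kappa>_def power2_eq_square mult_ac)
qed

text \<open>Testing the Picard equation of \<open>ut (k + 1)\<close> minus the averaged equations of the \<open>ut j\<close> with the new residual.\<close>

lemma residual_identity:
  fixes u ut :: "nat \<Rightarrow> real^'n \<Rightarrow> real^'n"
  assumes u: "\<And>j. u j \<in> V" and sol: "\<And>j. j \<ge> 1 \<Longrightarrow> picard_sol \<Omega> \<nu> f V (u (j - 1)) (ut j)"
    and A: "finite A" "\<And>j. j \<in> A \<Longrightarrow> j \<ge> 1" and c: "(\<Sum>j\<in>A. c j) = 1" and uk: "u k = lin_comb c A ut"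
  defines "z \<equiv> resid ut u (k + 1)"
  shows "\<nu> * (h1snorm \<Omega> z)\<^sup>2 = (\<Sum>j\<in>A. c j * bstar \<Omega> (\<lambda>x. u (j - 1) x - u k x) (ut j) z)"
proof -
  have utV: "ut j \<in> V" if "j \<ge> 1" for j using sol[OF that] by (simp add: picard_sol_def)
  have zeq: "z = (\<lambda>x. ut (k + 1) x - u k x)" by (simp add: z_def resid_def)
  have zV: "z \<in> V" unfolding zeq using utV u by (intro V_diff) auto
  have Hz: "H10 \<Omega> z" and Hu: "\<And>j. H10 \<Omega> (u j)" and Hut: "\<And>j. j \<ge> 1 \<Longrightarrow> H10 \<Omega> (ut j)"
    using zV u utV V_H10 by auto
  have eq: "\<nu> * h1ip \<Omega> (ut j) z + bstar \<Omega> (u (j - 1)) (ut j) z = f z" if "j \<ge> 1" for j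
    using sol[OF that] zV by (simp add: picard_sol_def)
  \<comment> \<open>The weights sum to 1, so averaging the equations keeps the right-hand
    side.\<close>
  have "(\<Sum>j\<in>A. c j * (\<nu> * h1ip \<Omega> (ut j) z + bstar \<Omega> (u (j - 1)) (ut j) z)) = f z"
    using eq A(2) c by (simp add: sum_distrib_right[symmetric])
  moreover have "h1ip \<Omega> (u k) z = (\<Sum>j\<in>A. c j * h1ip \<Omega> (ut j) z)"
    unfolding uk using A Hut Hz by (intro h1ip_lin_comb) auto
  ultimately have avg: "\<nu> * h1ip \<Omega> (u k) z + (\<Sum>j\<in>A. c j * bstar \<Omega> (u (j - 1)) (ut j) z) = f z"
    by (simp add: distrib_left sum.distrib sum_distrib_left mult_ac)
  \<comment> \<open>Since z is the difference of \<open>ut (k + 1)\<close> and \<open>u k\<close>,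
    and b(u k, z, z) = 0, the middle argument may be replaced by \<open>u k\<close>, which is again
    the average of the \<open>ut j\<close>.\<close>
  have "bstar \<Omega> (u k) (ut (k + 1)) z - bstar \<Omega> (u k) (u k) z = bstar \<Omega> (u k) z z"
    unfolding zeq by (rule bstar_diff_2[symmetric]) (use Hu Hut Hz zeq in auto)
  also have "\<dots> = 0" by (rule bstar_same[OF Hu Hz])
  finally have b: "bstar \<Omega> (u k) (ut (k + 1)) z = bstar \<Omega> (u k) (u k) z" by simp
  have "bstar \<Omega> (u k) (lin_comb c A ut) z = (\<Sum>j\<in>A. c j * bstar \<Omega> (u k) (ut j) z)"
    by (rule bstar_lin_comb_2) (use A Hut Hu Hz in auto)
  then have bk: "bstar \<Omega> (u k) (u k) z = (\<Sum>j\<in>A. c j * bstar \<Omega> (u k) (ut j) z)"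
    unfolding uk[symmetric] .
  have "h1ip \<Omega> z z = h1ip \<Omega> (ut (k + 1)) z - h1ip \<Omega> (u k) z"
    using h1ip_diff_left[OF Hut[of "k + 1"] Hu[of k] Hz] by (simp add: zeq)
  then have "\<nu> * h1ip \<Omega> z z = \<nu> * h1ip \<Omega> (ut (k + 1)) z - \<nu> * h1ip \<Omega> (u k) z"
    by (simp add: right_diff_distrib)
  then have "\<nu> * h1ip \<Omega> z z = (\<Sum>j\<in>A. c j * bstar \<Omega> (u (j - 1)) (ut j) z) - bstar \<Omega> (u k) (u k) z"
    using eq[of "k + 1"] avg b by simp
  also have "\<dots> = (\<Sum>j\<in>A. c j * (bstar \<Omega> (u (j - 1)) (ut j) z - bstar \<Omega> (u k) (ut j) z))"
    by (simp add: bk right_diff_distrib sum_subtractf)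
  also have "\<dots> = (\<Sum>j\<in>A. c j * bstar \<Omega> (\<lambda>x. u (j - 1) x - u k x) (ut j) z)"
    using A Hut Hz Hu by (intro sum.cong refl) (simp add: bstar_diff_1)
  finally show ?thesis by (simp add: h1ip_self)
qed

end


text \<open>E and W stand for the gradient norms of increments and residuals. For fixed j > l the
  rectangle of pairs with q < j \<le> p lies inside the triangle q < p of the claim, so each of
  these k - l indices costs at most the whole triangular sum.\<close>

lemma triangular_sum_le:
  fixes a :: "nat \<Rightarrow> real" and W E :: "nat \<Rightarrow> real"
  assumes l: "l \<ge> 1" and a: "\<And>j. j \<in> {l..k} \<Longrightarrow> \<bar>a j\<bar> \<le> abar" and abar: "abar \<ge> 0"
    and E: "\<And>j. j \<ge> 1 \<Longrightarrow> E j \<le> Kt * W j" "\<And>j. E j \<ge> 0" and W: "\<And>j. W j \<ge> 0"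
  shows "(\<Sum>j\<in>{l..k}. \<bar>a j\<bar> * ((\<Sum>p\<in>{j..k}. E p) * (\<Sum>q\<in>{l..j - 1}. E q)))
    \<le> real (k - l) * abar * Kt\<^sup>2 * (\<Sum>j\<in>{l + 1..k}. \<Sum>i\<in>{l..j - 1}. W i * W j)"
proof -
  define S where "S = (\<Sum>j\<in>{l + 1..k}. \<Sum>i\<in>{l..j - 1}. W i * W j)"
  have pair: "E p * E q \<le> Kt\<^sup>2 * (W q * W p)" if "p \<ge> 1" "q \<ge> 1" for p q
  proof -
    have "E p * E q \<le> (Kt * W p) * (Kt * W q)"
      using E that by (intro mult_mono) (auto intro: order_trans)
    then show ?thesis by (simp add: power2_eq_square mult_ac)
  qed
  have inner: "(\<Sum>p\<in>{j..k}. E p) * (\<Sum>q\<in>{l..j - 1}. E q) \<le> Kt\<^sup>2 * S" if j: "j \<in> {l + 1..k}" for j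
  proof -
    have "(\<Sum>p\<in>{j..k}. E p) * (\<Sum>q\<in>{l..j - 1}. E q) = (\<Sum>p\<in>{j..k}. \<Sum>q\<in>{l..j - 1}. E p * E q)"
      by (rule sum_product)
    also have "\<dots> \<le> (\<Sum>p\<in>{j..k}. \<Sum>q\<in>{l..j - 1}. Kt\<^sup>2 * (W q * W p))"
      using j l by (intro sum_mono pair) auto
    also have "\<dots> \<le> (\<Sum>p\<in>{j..k}. \<Sum>q\<in>{l..p - 1}. Kt\<^sup>2 * (W q * W p))"
      using W by (intro sum_mono sum_mono2) auto
    also have "\<dots> \<le> (\<Sum>p\<in>{l + 1..k}. \<Sum>q\<in>{l..p - 1}. Kt\<^sup>2 * (W q * W p))"
      using j W by (intro sum_mono2) (auto intro!: sum_nonneg)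
    finally show ?thesis by (simp add: S_def sum_distrib_left)
  qed
  have "(\<Sum>j\<in>{l..k}. \<bar>a j\<bar> * ((\<Sum>p\<in>{j..k}. E p) * (\<Sum>q\<in>{l..j - 1}. E q)))
      = (\<Sum>j\<in>{l + 1..k}. \<bar>a j\<bar> * ((\<Sum>p\<in>{j..k}. E p) * (\<Sum>q\<in>{l..j - 1}. E q)))"
  proof (rule sum.mono_neutral_right)
    show "\<forall>j\<in>{l..k} - {l + 1..k}. \<bar>a j\<bar> * ((\<Sum>p\<in>{j..k}. E p) * (\<Sum>q\<in>{l..j - 1}. E q)) = 0"
    proof
      fix j assume "j \<in> {l..k} - {l + 1..k}"
      then have "j = l" by auto
      \<comment> \<open>Truncated subtraction: for l = 0 the range would be {0..0} instead of
        empty.\<close>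
      then have "{l..j - 1} = {}" using l by auto
      then show "\<bar>a j\<bar> * ((\<Sum>p\<in>{j..k}. E p) * (\<Sum>q\<in>{l..j - 1}. E q)) = 0" by simp
    qed
  qed auto
  also have "\<dots> \<le> (\<Sum>j\<in>{l + 1..k}. abar * (Kt\<^sup>2 * S))"
    using abar E(2) by (intro sum_mono mult_mono[OF a inner]) (auto intro!: mult_nonneg_nonneg sum_nonneg)
  finally show ?thesis by (simp add: S_def mult.assoc)
qed

context picard_problem
begin

text \<open>The leading term is kept in the norms of the averaged residual itself. The gain factors,
  whose denominators may vanish, enter only when this bound is compared with the claim.\<close>

theorem anderson_residual_bound:
  fixes u ut :: "nat \<Rightarrow> real^'n \<Rightarrow> real^'n" and c :: "nat \<Rightarrow> real"
  assumes u: "\<And>j. u j \<in> V" and sol: "\<And>j. j \<ge> 1 \<Longrightarrow> picard_sol \<Omega> \<nu> f V (u (j - 1)) (ut j)"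
    and l: "1 \<le> l" "l \<le> k" and c: "(\<Sum>j\<in>{l..k}. c j) = 1" and uk: "u k = lin_comb c {l..k} ut"
    and abar: "\<And>j. j \<in> {l..k} \<Longrightarrow> \<bar>c j\<bar> \<le> abar"
    and Kt: "\<And>j. j \<ge> 1 \<Longrightarrow> h1snorm \<Omega> (incr u j) \<le> Kt * h1snorm \<Omega> (resid ut u j)"
  defines "w \<equiv> resid ut u"
  shows "h1snorm \<Omega> (w (k + 1)) \<le> C3 * C6 * F / \<nu>\<^sup>2 *
      sqrt (l2norm \<Omega> (lin_comb c {l..k} w) * h1snorm \<Omega> (lin_comb c {l..k} w))
    + Kt\<^sup>2 * M / \<nu> * \<kappa> * (real (k - l) * abar)
        * (\<Sum>j\<in>{l + 1..k}. \<Sum>i\<in>{l..j - 1}. h1snorm \<Omega> (w i) * h1snorm \<Omega> (w j))"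
proof -
  define z where "z = w (k + 1)"
  define W where "W = lin_comb c {l..k} w"
  define b where "b j = (\<lambda>x. u (j - 1) x - u k x)" for j
  define E where "E j = h1snorm \<Omega> (incr u j)" for j
  define S where "S = (\<Sum>j\<in>{l + 1..k}. \<Sum>i\<in>{l..j - 1}. h1snorm \<Omega> (w i) * h1snorm \<Omega> (w j))"
  have utV: "ut j \<in> V" if "j \<ge> 1" for j using sol[OF that] by (simp add: picard_sol_def)
  have Hu: "H10 \<Omega> (u j)" for j using u V_H10 by blast
  have Hut: "H10 \<Omega> (ut j)" if "j \<ge> 1" for j using utV[OF that] V_H10 by blast
  have Hw: "H10 \<Omega> (w j)" if "j \<ge> 1" for j
    unfolding w_def resid_def using that by (intro H10_diff Hut Hu)
  have Hz: "H10 \<Omega> z" unfolding z_def by (rule Hw) simp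
  have HW: "H10 \<Omega> W" unfolding W_def using l by (intro H10_lin_comb Hw) auto
  have Hb: "H10 \<Omega> (b j)" for j unfolding b_def by (intro H10_diff Hu)
  have abar0: "abar \<ge> 0" using abar[of k] l by force
  have id: "\<nu> * (h1snorm \<Omega> z)\<^sup>2 = (\<Sum>j\<in>{l..k}. c j * bstar \<Omega> (b j) (ut j) z)"
    unfolding z_def w_def b_def using l by (intro residual_identity u sol c uk) auto
  have lead: "(\<Sum>j\<in>{l..k}. c j * bstar \<Omega> (b j) (ut l) z) = - bstar \<Omega> W (ut l) z"
  proof -
    have "lin_comb c {l..k} b = (\<lambda>x. (-1) *\<^sub>R W x)"
    proof
      fix x
      have "lin_comb c {l..k} b x = (\<Sum>j\<in>{l..k}. c j *\<^sub>R u (j - 1) x) - (\<Sum>j\<in>{l..k}. c j) *\<^sub>R u k x"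
        by (simp add: lin_comb_def b_def scaleR_diff_right sum_subtractf scaleR_sum_left)
      also have "u k x = (\<Sum>j\<in>{l..k}. c j *\<^sub>R ut j x)" by (simp add: uk lin_comb_def)
      finally show "lin_comb c {l..k} b x = (-1) *\<^sub>R W x"
        by (simp add: c W_def w_def resid_def lin_comb_def scaleR_diff_right sum_subtractf)
    qed
    then have "bstar \<Omega> (lin_comb c {l..k} b) (ut l) z = - bstar \<Omega> W (ut l) z"
      using bstar_scaleR_1[OF HW Hut[OF l(1)] Hz, of "-1"] by simp
    moreover have "bstar \<Omega> (lin_comb c {l..k} b) (ut l) z = (\<Sum>j\<in>{l..k}. c j * bstar \<Omega> (b j) (ut l) z)"
      by (rule bstar_lin_comb_1) (use Hb Hut l Hz in auto)
    ultimately show ?thesis by simp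
  qed
  have split: "bstar \<Omega> (b j) (ut j) z = bstar \<Omega> (b j) (ut l) z + bstar \<Omega> (b j) (\<lambda>x. ut j x - ut l x) z"
    if "j \<in> {l..k}" for j
    using bstar_diff_2[OF Hb Hut Hut Hz, of j l j] that l by simp
  have leadb: "\<bar>bstar \<Omega> W (ut l) z\<bar> \<le> (C3 * C6 * sqrt (l2norm \<Omega> W * h1snorm \<Omega> W) * (F / \<nu>)) * h1snorm \<Omega> z"
  proof -
    have "\<bar>bstar \<Omega> W (ut l) z\<bar> \<le> C3 * C6 * sqrt (l2norm \<Omega> W * h1snorm \<Omega> W) * h1snorm \<Omega> (ut l) * h1snorm \<Omega> z"
      by (rule bstar_interpolated_bound[OF HW Hut[OF l(1)] Hz])
    also have "\<dots> \<le> C3 * C6 * sqrt (l2norm \<Omega> W * h1snorm \<Omega> W) * (F / \<nu>) * h1snorm \<Omega> z"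
      using picard_sol_bound[OF u sol[OF l(1)]] C3_nonneg C6_nonneg
      by (intro mult_right_mono mult_left_mono) (auto simp: h1snorm_nonneg l2norm_nonneg)
    finally show ?thesis .
  qed
  have bb: "h1snorm \<Omega> (b j) \<le> (\<Sum>p\<in>{j..k}. E p)" if "j \<in> {l..k}" for j
  proof -
    have "h1snorm \<Omega> (b j) = h1snorm \<Omega> (\<lambda>x. u k x - u (j - 1) x)"
      unfolding b_def by (rule h1snorm_minus_commute[OF Hu Hu])
    \<comment> \<open>The path from \<open>u (j - 1)\<close> to \<open>u k\<close> includes the
      increment of index j; \<open>Suc (j - 1)\<close> is j because the window starts at 1 or
      later.\<close>
    also have "\<dots> \<le> (\<Sum>p\<in>{Suc (j - 1)..k}. E p)"
      unfolding E_def using that by (intro h1snorm_telescope Hu) auto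
    finally show ?thesis using that l by simp
  qed
  have tb: "h1snorm \<Omega> (\<lambda>x. ut j x - ut l x) \<le> \<kappa> * (\<Sum>q\<in>{l..j - 1}. E q)" if "j \<in> {l..k}" for j
  proof -
    \<comment> \<open>\<open>h1snorm_telescope\<close> wants an H10 field at every index, but
      \<open>ut 0\<close> is arbitrary. Replacing index 0 by 1 leaves the window unchanged.\<close>
    define a where "a i = ut (max 1 i)" for i
    have ajl: "a j = ut j" "a l = ut l" using that l by (auto simp: a_def max_def)
    have "h1snorm \<Omega> (\<lambda>x. a j x - a l x) \<le> (\<Sum>p\<in>{Suc l..j}. h1snorm \<Omega> (incr a p))"
      using that by (intro h1snorm_telescope) (auto simp: a_def intro: Hut)
    also have "\<dots> \<le> (\<Sum>p\<in>{Suc l..j}. \<kappa> * E (p - 1))"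
    proof (rule sum_mono)
      fix p assume p: "p \<in> {Suc l..j}"
      \<comment> \<open>\<open>ut p\<close> and \<open>ut (p - 1)\<close> are the images of
        \<open>u (p - 1)\<close> and \<open>u (p - 2)\<close>, so the Lipschitz bound lowers the
        index of the increment by one. Both Picard equations exist from p = 2 on.\<close>
      then have p2: "p \<ge> 2" using l by auto
      then have "max 1 p = p" "max 1 (p - 1) = p - 1" by auto
      then have "incr a p = (\<lambda>x. ut p x - ut (p - 1) x)" by (simp only: incr_def a_def)
      then show "h1snorm \<Omega> (incr a p) \<le> \<kappa> * E (p - 1)"
        using picard_sol_Lipschitz[OF u u sol[of p] sol[of "p - 1"]] p2 by (simp add: E_def incr_def)
    qed
    also have "\<dots> = \<kappa> * (\<Sum>q\<in>{l..j - 1}. E q)"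
    proof -
      have "(\<Sum>p\<in>{Suc l..j}. E (p - 1)) = (\<Sum>q\<in>{l..j - 1}. E q)"
        by (rule sum.reindex_bij_witness[of _ Suc "\<lambda>p. p - 1"]) (use l that in auto)
      then show ?thesis by (simp add: sum_distrib_left[symmetric])
    qed
    finally show ?thesis by (simp add: ajl)
  qed
  have rem: "\<bar>c j * bstar \<Omega> (b j) (\<lambda>x. ut j x - ut l x) z\<bar>
     \<le> M * \<kappa> * h1snorm \<Omega> z * (\<bar>c j\<bar> * ((\<Sum>p\<in>{j..k}. E p) * (\<Sum>q\<in>{l..j - 1}. E q)))" if j: "j \<in> {l..k}" for j
  proof -
    have Hd: "H10 \<Omega> (\<lambda>x. ut j x - ut l x)" using j l by (intro H10_diff Hut) auto
    have "\<bar>bstar \<Omega> (b j) (\<lambda>x. ut j x - ut l x) z\<bar> \<le> M * h1snorm \<Omega> (b j) * h1snorm \<Omega> (\<lambda>x. ut j x - ut l x) * h1snorm \<Omega> z"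
      unfolding M_def by (rule bstar_bound[OF Hb Hd Hz])
    also have "\<dots> \<le> M * (\<Sum>p\<in>{j..k}. E p) * (\<kappa> * (\<Sum>q\<in>{l..j - 1}. E q)) * h1snorm \<Omega> z"
      using bb[OF j] tb[OF j] M_nonneg kappa_nonneg
      by (intro mult_right_mono mult_mono mult_nonneg_nonneg sum_nonneg) (auto simp: h1snorm_nonneg E_def)
    finally have "\<bar>c j\<bar> * \<bar>bstar \<Omega> (b j) (\<lambda>x. ut j x - ut l x) z\<bar>
       \<le> \<bar>c j\<bar> * (M * (\<Sum>p\<in>{j..k}. E p) * (\<kappa> * (\<Sum>q\<in>{l..j - 1}. E q)) * h1snorm \<Omega> z)"
      by (rule mult_left_mono) simp
    then show ?thesis by (simp add: abs_mult mult_ac)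
  qed
  have "\<bar>\<Sum>j\<in>{l..k}. c j * bstar \<Omega> (b j) (\<lambda>x. ut j x - ut l x) z\<bar>
     \<le> (\<Sum>j\<in>{l..k}. M * \<kappa> * h1snorm \<Omega> z * (\<bar>c j\<bar> * ((\<Sum>p\<in>{j..k}. E p) * (\<Sum>q\<in>{l..j - 1}. E q))))"
    by (rule order_trans[OF sum_abs sum_mono[OF rem]])
  also have "\<dots> = M * \<kappa> * h1snorm \<Omega> z * (\<Sum>j\<in>{l..k}. \<bar>c j\<bar> * ((\<Sum>p\<in>{j..k}. E p) * (\<Sum>q\<in>{l..j - 1}. E q)))"
    by (rule sum_distrib_left[symmetric])
  also have "\<dots> \<le> M * \<kappa> * h1snorm \<Omega> z * (real (k - l) * abar * Kt\<^sup>2 * S)"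
    unfolding S_def using M_nonneg kappa_nonneg Kt
    by (intro mult_left_mono triangular_sum_le l abar abar0)
       (auto simp: E_def w_def h1snorm_nonneg intro!: mult_nonneg_nonneg)
  finally have remb: "\<bar>\<Sum>j\<in>{l..k}. c j * bstar \<Omega> (b j) (\<lambda>x. ut j x - ut l x) z\<bar>
     \<le> M * \<kappa> * h1snorm \<Omega> z * (real (k - l) * abar * Kt\<^sup>2 * S)" .
  have "\<nu> * (h1snorm \<Omega> z)\<^sup>2 = - bstar \<Omega> W (ut l) z + (\<Sum>j\<in>{l..k}. c j * bstar \<Omega> (b j) (\<lambda>x. ut j x - ut l x) z)"
    unfolding id lead[symmetric] sum.distrib[symmetric]
    by (rule sum.cong) (auto simp: split distrib_left)
  also have "\<dots> \<le> \<bar>bstar \<Omega> W (ut l) z\<bar> + \<bar>\<Sum>j\<in>{l..k}. c j * bstar \<Omega> (b j) (\<lambda>x. ut j x - ut l x) z\<bar>"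
    by linarith
  also have "\<dots> \<le> (C3 * C6 * sqrt (l2norm \<Omega> W * h1snorm \<Omega> W) * (F / \<nu>)) * h1snorm \<Omega> z
     + M * \<kappa> * h1snorm \<Omega> z * (real (k - l) * abar * Kt\<^sup>2 * S)"
    using leadb remb by linarith
  also have "\<dots> = (C3 * C6 * sqrt (l2norm \<Omega> W * h1snorm \<Omega> W) * (F / \<nu>) + M * \<kappa> * (real (k - l) * abar * Kt\<^sup>2 * S)) * h1snorm \<Omega> z"
    by (simp add: algebra_simps)
  finally have "h1snorm \<Omega> z \<le> (C3 * C6 * sqrt (l2norm \<Omega> W * h1snorm \<Omega> W) * (F / \<nu>) + M * \<kappa> * (real (k - l) * abar * Kt\<^sup>2 * S)) / \<nu>"
  proof (rule divide_out)
    have "S \<ge> 0" unfolding S_def by (auto intro!: sum_nonneg mult_nonneg_nonneg simp: h1snorm_nonneg)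
    then show "0 \<le> C3 * C6 * sqrt (l2norm \<Omega> W * h1snorm \<Omega> W) * (F / \<nu>) + M * \<kappa> * (real (k - l) * abar * Kt\<^sup>2 * S)"
      using C3_nonneg C6_nonneg F_nonneg nu_pos M_nonneg kappa_nonneg abar0
      by (intro add_nonneg_nonneg mult_nonneg_nonneg) (auto simp: h1snorm_nonneg l2norm_nonneg)
  qed (simp add: h1snorm_nonneg)
  also have "\<dots> = C3 * C6 * F / \<nu>\<^sup>2 * sqrt (l2norm \<Omega> W * h1snorm \<Omega> W) + Kt\<^sup>2 * M / \<nu> * \<kappa> * (real (k - l) * abar) * S"
    by (simp add: add_divide_distrib power2_eq_square mult_ac)
  finally show ?thesis by (simp only: z_def W_def S_def)
qed

end


section \<open>The discrete space, the dual norm and the gain factors\<close>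

lemma fin_subspace_add:
  assumes "fin_subspace S P" "u \<in> S" "v \<in> S"
  shows "(\<lambda>x. u x + v x) \<in> S"
proof -
  obtain B where B: "S = {(\<lambda>x. \<Sum>b\<in>B. c b *\<^sub>R b x) | c. True}" using assms(1) unfolding fin_subspace_def by blast
  obtain c d where "u = (\<lambda>x. \<Sum>b\<in>B. c b *\<^sub>R b x)" "v = (\<lambda>x. \<Sum>b\<in>B. d b *\<^sub>R b x)"
    using assms(2,3) unfolding B by blast
  then have "(\<lambda>x. u x + v x) = (\<lambda>x. \<Sum>b\<in>B. (c b + d b) *\<^sub>R b x)"
    by (simp add: scaleR_add_left sum.distrib)
  then show ?thesis unfolding B by (intro CollectI exI[of _ "\<lambda>b. c b + d b"]) simp
qed

lemma fin_subspace_scaleR: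
  assumes "fin_subspace S P" "u \<in> S"
  shows "(\<lambda>x. a *\<^sub>R u x) \<in> S"
proof -
  obtain B where B: "S = {(\<lambda>x. \<Sum>b\<in>B. c b *\<^sub>R b x) | c. True}" using assms(1) unfolding fin_subspace_def by blast
  obtain c where "u = (\<lambda>x. \<Sum>b\<in>B. c b *\<^sub>R b x)" using assms(2) unfolding B by blast
  then have "(\<lambda>x. a *\<^sub>R u x) = (\<lambda>x. \<Sum>b\<in>B. (a * c b) *\<^sub>R b x)"
    by (simp add: scaleR_sum_right)
  then show ?thesis unfolding B by (intro CollectI exI[of _ "\<lambda>b. a * c b"]) simp
qed

context bounded_open
begin

lemma l2ip_divg_add:
  assumes "H10 \<Omega> u" "H10 \<Omega> v" "L2 \<Omega> q"
  shows "l2ip \<Omega> (divg \<Omega> (\<lambda>x. u x + v x)) q = l2ip \<Omega> (divg \<Omega> u) q + l2ip \<Omega> (divg \<Omega> v) q"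
proof -
  have "l2ip \<Omega> (divg \<Omega> (\<lambda>x. u x + v x)) q = l2ip \<Omega> (\<lambda>x. divg \<Omega> u x + divg \<Omega> v x) q"
  proof (rule l2ip_cong_AE)
    show "AE x in D. divg \<Omega> (\<lambda>x. u x + v x) x = divg \<Omega> u x + divg \<Omega> v x"
      using grad_add[OF assms(1,2)] by eventually_elim (simp add: divg_def sum.distrib)
  qed (auto intro: L2_divg L2_add H10_add assms)
  then show ?thesis using assms by (simp add: l2ip_add_left L2_divg)
qed

lemma l2ip_divg_scaleR:
  assumes "H10 \<Omega> u" "L2 \<Omega> q"
  shows "l2ip \<Omega> (divg \<Omega> (\<lambda>x. c *\<^sub>R u x)) q = c * l2ip \<Omega> (divg \<Omega> u) q"
proof -
  have "l2ip \<Omega> (divg \<Omega> (\<lambda>x. c *\<^sub>R u x)) q = l2ip \<Omega> (\<lambda>x. c *\<^sub>R divg \<Omega> u x) q"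
  proof (rule l2ip_cong_AE)
    show "AE x in D. divg \<Omega> (\<lambda>x. c *\<^sub>R u x) x = c *\<^sub>R divg \<Omega> u x"
      using grad_scaleR[OF assms(1), of c] by eventually_elim (simp add: divg_def sum_distrib_left)
  qed (auto intro!: L2_divg L2_scaleR[of "divg \<Omega> u", simplified] H10_scaleR assms)
  then show ?thesis by (simp only: l2ip_scaleR_left)
qed

lemma Vh_subspace:
  assumes X: "fin_subspace Xh (H10 \<Omega>)" and Q: "fin_subspace Qh (Qsp \<Omega>)"
  shows "v \<in> Vh \<Omega> Xh Qh \<Longrightarrow> H10 \<Omega> v"
    and "v \<in> Vh \<Omega> Xh Qh \<Longrightarrow> w \<in> Vh \<Omega> Xh Qh \<Longrightarrow> (\<lambda>x. v x + w x) \<in> Vh \<Omega> Xh Qh"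
    and "v \<in> Vh \<Omega> Xh Qh \<Longrightarrow> (\<lambda>x. c *\<^sub>R v x) \<in> Vh \<Omega> Xh Qh"
proof -
  have H: "H10 \<Omega> v" if "v \<in> Vh \<Omega> Xh Qh" for v using that X by (auto simp: Vh_def fin_subspace_def)
  have L: "L2 \<Omega> q" if "q \<in> Qh" for q using that Q by (auto simp: Qsp_def fin_subspace_def)
  show "v \<in> Vh \<Omega> Xh Qh \<Longrightarrow> H10 \<Omega> v" by (rule H)
  show "v \<in> Vh \<Omega> Xh Qh \<Longrightarrow> w \<in> Vh \<Omega> Xh Qh \<Longrightarrow> (\<lambda>x. v x + w x) \<in> Vh \<Omega> Xh Qh"
    using H[of v] H[of w] L by (auto simp: Vh_def l2ip_divg_add intro: fin_subspace_add[OF X])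
  show "v \<in> Vh \<Omega> Xh Qh \<Longrightarrow> (\<lambda>x. c *\<^sub>R v x) \<in> Vh \<Omega> Xh Qh"
    using H[of v] L by (auto simp: Vh_def l2ip_divg_scaleR intro: fin_subspace_scaleR[OF X])
qed

text \<open>A field that is 0 almost everywhere has the weak gradient 0, and uniqueness carries this
  over to the chosen \<open>grad\<close>. Hence a field with nonzero gradient has positive L2
  norm.\<close>

lemma h1snorm_eq_0_if_l2norm_eq_0:
  assumes "H10 \<Omega> u" "l2norm \<Omega> u = 0"
  shows "h1snorm \<Omega> u = 0"
proof -
  have z: "L2 \<Omega> (\<lambda>x. 0 :: real^'n)" "L2 \<Omega> (\<lambda>x. 0 :: real^'n^'n)" by (auto intro!: L2_bounded[of _ 0])
  have "AE x in D. grad \<Omega> u x = 0"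
  proof (rule weak_grad_unique)
    show "weak_grad \<Omega> u (grad \<Omega> u)" using H1_grad[OF H10_H1[OF assms(1)]] by simp
    show "weak_grad \<Omega> (\<lambda>x. 0) (\<lambda>x. 0)" by (simp add: weak_grad_def)
    show "AE x in D. u x = 0" by (rule l2norm_eq_0[OF H10_L2[OF assms(1)] assms(2)])
  qed (use z assms in \<open>auto intro: H10_L2 H10_L2_grad\<close>)
  from l2norm_cong_AE[OF H10_L2_grad[OF assms(1)] z(2) this] show ?thesis
    by (simp add: h1snorm_def l2norm_def l2ip_def)
qed

text \<open>The field \<phi> makes the set of quotients nonempty; the supremum of the empty set of
  reals would carry no information about its sign.\<close>

lemma dual_norm_bound:
  assumes f: "Hminus1 \<Omega> f" and e: "H10 \<Omega> \<phi>" "h1snorm \<Omega> \<phi> \<noteq> 0"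
  shows "0 \<le> dual_norm \<Omega> f" and "H10 \<Omega> v \<Longrightarrow> \<bar>f v\<bar> \<le> dual_norm \<Omega> f * h1snorm \<Omega> v"
proof -
  obtain C where C: "\<And>v. H10 \<Omega> v \<Longrightarrow> \<bar>f v\<bar> \<le> C * h1snorm \<Omega> v" using f unfolding Hminus1_def by blast
  have pos: "h1snorm \<Omega> v > 0" if "h1snorm \<Omega> v \<noteq> 0" for v using that h1snorm_nonneg[of v] by simp
  have bdd: "bdd_above {\<bar>f v\<bar> / h1snorm \<Omega> v | v. H10 \<Omega> v \<and> h1snorm \<Omega> v \<noteq> 0}"
    by (rule bdd_aboveI[of _ C]) (use C pos in \<open>auto simp: pos_divide_le_eq\<close>)
  have up: "\<bar>f v\<bar> / h1snorm \<Omega> v \<le> dual_norm \<Omega> f" if "H10 \<Omega> v" "h1snorm \<Omega> v \<noteq> 0" for v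
    unfolding dual_norm_def using that by (intro cSup_upper bdd) auto
  show "0 \<le> dual_norm \<Omega> f"
    by (rule order_trans[OF _ up[OF e]]) (simp add: h1snorm_nonneg)
  show "\<bar>f v\<bar> \<le> dual_norm \<Omega> f * h1snorm \<Omega> v" if "H10 \<Omega> v"
  proof (cases "h1snorm \<Omega> v = 0")
    case True
    \<comment> \<open>Such a field contributes no quotient to the supremum, but continuity of f
      forces f v = 0.\<close>
    then show ?thesis using C[OF that] by simp
  next
    case False
    then show ?thesis using up[OF that False] pos[OF False] by (simp add: pos_divide_le_eq)
  qed
qed

end

text \<open>The last three hypotheses cover vanishing denominators, where division yields \<open>0\<close>.\<close>

lemma sqrt_gain_product:
  fixes p q r s t CP :: real
  assumes "p \<ge> 0" "q \<ge> 0" "r \<ge> 0" "s \<ge> 0" "t \<ge> 0" and CP: "CP > 0"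
    and "s = 0 \<Longrightarrow> p = 0" "t = 0 \<Longrightarrow> p = 0" "r = 0 \<Longrightarrow> p = 0"
  shows "sqrt (p * q) \<le> sqrt CP * (sqrt (p / s) * sqrt (r / t) * sqrt (q / r) * sqrt (s / (CP * t)) * t)"
proof (cases "p = 0")
  case True
  then show ?thesis by simp
next
  case False
  then have pos: "s > 0" "t > 0" "r > 0" using assms by (auto simp: less_le)
  have "sqrt CP * (sqrt (p / s) * sqrt (r / t) * sqrt (q / r) * sqrt (s / (CP * t)) * t)
    = sqrt CP * (sqrt p * sqrt q / (sqrt CP * (sqrt t * sqrt t)) * t)"
    using pos by (simp add: real_sqrt_divide real_sqrt_mult)
  also have "\<dots> = sqrt (p * q)"
    using pos CP by (simp add: real_sqrt_mult)
  finally show ?thesis by simp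
qed

text \<open>Residuals start at index 1, hence residual differences at index 2, and during start-up
  the depth at step k' is cut to k' - 1. The condition k \<ge> m + 1 says that the window at step k
  is full.\<close>

theorem theorem3p4:
  fixes \<Omega> :: "(real^'n) set" and Xh :: "(real^'n \<Rightarrow> real^'n) set" and Qh :: "(real^'n \<Rightarrow> real) set"
    and \<beta> \<nu> CP C3 C6 \<sigma> abar Kt :: real and f :: "(real^'n \<Rightarrow> real^'n) \<Rightarrow> real"
    and m k :: nat and u ut :: "nat \<Rightarrow> real^'n \<Rightarrow> real^'n" and ah a :: "nat \<Rightarrow> nat \<Rightarrow> real"
  defines "w \<equiv> resid ut u"
    and "e \<equiv> incr u"
    and "V \<equiv> Vh \<Omega> Xh Qh"
    and "M \<equiv> sqrt CP * C3 * C6"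
    and "\<kappa> \<equiv> sqrt CP * C3 * C6 * dual_norm \<Omega> f / \<nu>\<^sup>2"
  assumes dim: "CARD('n) = 2 \<or> CARD('n) = 3"
    and dom: "open \<Omega>" "bounded \<Omega>" "connected \<Omega>" "\<Omega> \<noteq> {}"
    and poincare: "CP > 0" "\<forall>\<phi>. H10 \<Omega> \<phi> \<longrightarrow> l2norm \<Omega> \<phi> \<le> CP * h1snorm \<Omega> \<phi>"
    and sobolev6: "\<forall>\<phi>. H10 \<Omega> \<phi> \<longrightarrow> Lpnorm \<Omega> 6 \<phi> \<le> C6 * h1snorm \<Omega> \<phi>"
    and ladyzh3: "\<forall>\<phi>. H10 \<Omega> \<phi> \<longrightarrow> Lpnorm \<Omega> 3 \<phi> \<le> C3 * sqrt (l2norm \<Omega> \<phi>) * sqrt (h1snorm \<Omega> \<phi>)"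
    and fe: "fin_subspace Xh (H10 \<Omega>)" "fin_subspace Qh (Qsp \<Omega>)" "\<beta> > 0" "inf_sup \<Omega> Xh Qh \<beta>"
    and data: "\<nu> > 0" "Hminus1 \<Omega> f"
    and init: "u 0 \<in> V"
    and picard: "\<forall>j\<ge>1. picard_sol \<Omega> \<nu> f V (u (j - 1)) (ut j)"
    and aaL2: "\<forall>k'\<ge>1. AA_opt (l2norm \<Omega>) w k' (min m (k' - 1)) (ah k') \<and>
                 u k' = lin_comb (ah k') {k' - min m (k' - 1)..k'} ut"
    and aaH1: "\<forall>k'\<ge>1. AA_opt (h1snorm \<Omega>) w k' (min m (k' - 1)) (a k')"
    and sigma: "\<sigma> > 0" "\<forall>j\<ge>1. \<sigma> * h1snorm \<Omega> (e j) \<le> h1snorm \<Omega> (\<lambda>x. w (j + 1) x - w j x)"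
    and sigmat: "sigma_tilde \<Omega> \<sigma> u ut k > 0"
    and alphabound: "\<forall>k'\<ge>1. \<forall>j\<in>{k' - min m (k' - 1)..k'}. 0 < \<bar>ah k' j\<bar> \<and> \<bar>ah k' j\<bar> < abar"
    and indep: "\<forall>c. l2norm \<Omega> (lin_comb c {2..k} (\<lambda>j x. w j x - w (j - 1) x)) = 0 \<longrightarrow> (\<forall>j\<in>{2..k}. c j = 0)"
    and Ktilde: "\<forall>j\<ge>1. h1snorm \<Omega> (e j) \<le> Kt * h1snorm \<Omega> (w j)"
    and kbig: "k \<ge> m + 1"
  shows "h1snorm \<Omega> (w (k + 1)) \<le>
      \<kappa> * sqrt (l2norm \<Omega> (lin_comb (ah k) {k - m..k} w) / l2norm \<Omega> (w k))
        * sqrt (h1snorm \<Omega> (lin_comb (a k) {k - m..k} w) / h1snorm \<Omega> (w k))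
        * sqrt (l2norm \<Omega> (lin_comb (ah k) {k - m..k} (\<lambda>j. grad \<Omega> (w j)))
                / l2norm \<Omega> (lin_comb (a k) {k - m..k} (\<lambda>j. grad \<Omega> (w j))))
        * sqrt (l2norm \<Omega> (w k) / (CP * h1snorm \<Omega> (w k)))
        * h1snorm \<Omega> (w k)
    + Kt\<^sup>2 * M / \<nu> * \<kappa> * (real (m * (m + 3)) * abar / 2)
        * (\<Sum>j\<in>{k - m + 1..k}. \<Sum>i\<in>{k - m..j - 1}. h1snorm \<Omega> (w i) * h1snorm \<Omega> (w j))"
proof -
  interpret B: bounded_open \<Omega>
    using dom by unfold_locales
  note Vs = B.Vh_subspace[OF fe(1,2), folded V_def]
  define A where "A = {k - m..k}"
  have A: "finite A" "k \<in> A" by (auto simp: A_def)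
  have A1: "j \<ge> 1" if "j \<in> A" for j using that kbig by (auto simp: A_def)
  have mk: "min m (k - 1) = m" and k1: "k \<ge> 1" using kbig by auto
  have utV: "ut j \<in> V" if "j \<ge> 1" for j using picard that by (simp add: picard_sol_def)
  have uV: "u j \<in> V" for j
  proof (cases "j \<ge> 1")
    case False
    then show ?thesis using init by (simp add: not_le)
  next
    case True
    have lin: "lin_comb c I ut \<in> V" if "finite I" "\<And>i. i \<in> I \<Longrightarrow> i \<ge> 1" for c I
      using that
    proof (induction I)
      case empty
      then show ?case using Vs(3)[OF init, of 0] by (simp add: lin_comb_def)
    next
      case (insert i I)
      then show ?case using Vs(2)[OF Vs(3)[OF utV[of i], of "c i"] insert.IH] by (simp add: lin_comb_def)
    qed
    \<comment> \<open>Also during start-up the window stays within the indices at which the Picard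
      equation determines \<open>ut\<close>.\<close>
    have "j - min m (j - 1) \<ge> 1" using True by auto
    then show ?thesis using aaL2 True lin[of "{j - min m (j - 1)..j}" "ah j"] by auto
  qed
  have Hw: "H10 \<Omega> (w j)" if "j \<ge> 1" for j
    unfolding w_def resid_def using that by (intro B.H10_diff Vs(1) utV uV)
  have HwA: "H10 \<Omega> (w j)" if "j \<in> A" for j using Hw A1 that by blast
  have abar: "abar > 0" using alphabound k1 by (metis abs_ge_zero atLeastAtMost_iff diff_le_self le_less_trans order_refl)
  show ?thesis
  \<comment> \<open>If every H10 field has seminorm 0, the signs of C3, C6 and the dual norm are
    undetermined, but both sides of the claim are 0.\<close>
  proof (cases "\<forall>\<phi>. H10 \<Omega> \<phi> \<longrightarrow> h1snorm \<Omega> \<phi> = 0")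
    case True
    have "(\<Sum>j\<in>{k - m + 1..k}. \<Sum>i\<in>{k - m..j - 1}. h1snorm \<Omega> (w i) * h1snorm \<Omega> (w j)) = 0"
      using True Hw by (intro sum.neutral ballI) auto
    moreover have "h1snorm \<Omega> (w (k + 1)) = 0" "h1snorm \<Omega> (w k) = 0" using True Hw k1 by auto
    ultimately show ?thesis by simp
  next
    case False
    then obtain \<phi> where e: "H10 \<Omega> \<phi>" "h1snorm \<Omega> \<phi> \<noteq> 0" by blast
    have epos: "h1snorm \<Omega> \<phi> > 0" "l2norm \<Omega> \<phi> > 0"
      using e B.h1snorm_nonneg[of \<phi>] B.l2norm_nonneg[of \<phi>] B.h1snorm_eq_0_if_l2norm_eq_0[OF e(1)]
      by (auto simp: less_le)
    \<comment> \<open>Norms are nonnegative, so at a field with positive norms the Sobolev and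
      interpolation inequalities force the signs of their constants.\<close>
    have "0 \<le> Lpnorm \<Omega> 6 \<phi>" "0 \<le> Lpnorm \<Omega> 3 \<phi>" by (auto simp: Lpnorm_def)
    then have "0 \<le> C6 * h1snorm \<Omega> \<phi>" "0 \<le> C3 * (sqrt (l2norm \<Omega> \<phi>) * sqrt (h1snorm \<Omega> \<phi>))"
      using sobolev6 ladyzh3 e(1) by (auto simp: mult.assoc intro: order_trans)
    moreover have "sqrt (l2norm \<Omega> \<phi>) * sqrt (h1snorm \<Omega> \<phi>) > 0" using epos by simp
    ultimately have C: "C6 \<ge> 0" "C3 \<ge> 0" using epos by (auto simp: zero_le_mult_iff)
    define F where "F = dual_norm \<Omega> f"
    have F0: "F \<ge> 0" unfolding F_def by (rule B.dual_norm_bound(1)[OF data(2) e])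
    have Fb: "\<bar>f v\<bar> \<le> F * h1snorm \<Omega> v" if "H10 \<Omega> v" for v
      unfolding F_def using B.dual_norm_bound(2)[OF data(2) e that] .
    interpret P: picard_problem \<Omega> CP C3 C6 V f \<nu> F
      by unfold_locales (use poincare sobolev6 ladyzh3 C data(1) F0 Fb Vs in auto)
    define What where "What = lin_comb (ah k) A w"
    define Wa where "Wa = lin_comb (a k) A w"
    have HWa: "H10 \<Omega> Wa" unfolding Wa_def by (rule B.H10_lin_comb[OF A(1) HwA])
    have aa: "AA_opt (l2norm \<Omega>) w k m (ah k)" "u k = lin_comb (ah k) A ut" "AA_opt (h1snorm \<Omega>) w k m (a k)"
      using aaL2[rule_format, OF k1] aaH1[rule_format, OF k1] unfolding mk A_def by simp_all
    have sums: "(\<Sum>j\<in>A. ah k j) = 1" "(\<Sum>j\<in>A. a k j) = 1"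
      using aa(1,3) by (simp_all add: AA_opt_def A_def)
    have opt: "l2norm \<Omega> What \<le> l2norm \<Omega> (lin_comb b A w)" if "(\<Sum>j\<in>A. b j) = 1" for b
      using aa(1) that by (simp add: AA_opt_def A_def What_def)
    have p_wk: "l2norm \<Omega> What \<le> l2norm \<Omega> (w k)"
    proof -
      \<comment> \<open>Weights concentrated at the newest index are admissible in the L2
        minimization.\<close>
      have "lin_comb (\<lambda>j. if j = k then 1 else 0) A w = w k"
        using A by (auto simp: lin_comb_def fun_eq_iff if_distrib[of "\<lambda>c. c *\<^sub>R _"] cong: if_cong)
      moreover have "(\<Sum>j\<in>A. if j = k then 1 else 0 :: real) = 1" using A by simp
      ultimately show ?thesis using opt[of "\<lambda>j. if j = k then 1 else 0"] by simp
    qed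
    \<comment> \<open>The H1 weights are admissible in the L2 minimization. Together with
      \<open>p_wk\<close> and \<open>p_hk\<close> this shows that whenever a denominator of the gain
      factors is 0, the L2 norm of the averaged residual is 0 as well.\<close>
    have p_r: "l2norm \<Omega> What \<le> CP * h1snorm \<Omega> Wa"
      using opt[OF sums(2)] poincare(2) HWa unfolding Wa_def by (blast intro: order_trans)
    have nn: "l2norm \<Omega> What \<ge> 0" "h1snorm \<Omega> What \<ge> 0" "h1snorm \<Omega> Wa \<ge> 0" "l2norm \<Omega> (w k) \<ge> 0" "h1snorm \<Omega> (w k) \<ge> 0"
      by (auto simp: B.l2norm_nonneg B.h1snorm_nonneg)
    have p_hk: "l2norm \<Omega> What \<le> CP * h1snorm \<Omega> (w k)"
      using p_wk poincare(2) Hw[OF k1] by (blast intro: order_trans)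
    have gain: "sqrt (l2norm \<Omega> What * h1snorm \<Omega> What) \<le> sqrt CP *
       (sqrt (l2norm \<Omega> What / l2norm \<Omega> (w k)) * sqrt (h1snorm \<Omega> Wa / h1snorm \<Omega> (w k))
        * sqrt (h1snorm \<Omega> What / h1snorm \<Omega> Wa) * sqrt (l2norm \<Omega> (w k) / (CP * h1snorm \<Omega> (w k))) * h1snorm \<Omega> (w k))"
      by (rule sqrt_gain_product) (use nn poincare(1) p_wk p_r p_hk in auto)
    have "h1snorm \<Omega> (w (k + 1)) \<le> C3 * C6 * F / \<nu>\<^sup>2 * sqrt (l2norm \<Omega> What * h1snorm \<Omega> What)
      + Kt\<^sup>2 * P.M / \<nu> * P.\<kappa> * (real (k - (k - m)) * abar)
        * (\<Sum>j\<in>{k - m + 1..k}. \<Sum>i\<in>{k - m..j - 1}. h1snorm \<Omega> (w i) * h1snorm \<Omega> (w j))"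
      unfolding What_def A_def w_def
    proof (rule P.anderson_residual_bound)
      show "\<bar>ah k j\<bar> \<le> abar" if "j \<in> {k - m..k}" for j
        using alphabound that k1 mk by (metis less_imp_le)
      show "u k = lin_comb (ah k) {k - m..k} ut" using aa(2) by (simp only: A_def)
      show "(\<Sum>j\<in>{k - m..k}. ah k j) = 1" using sums(1) by (simp only: A_def)
      show "picard_sol \<Omega> \<nu> f V (u (j - 1)) (ut j)" if "j \<ge> 1" for j using picard that by blast
      show "h1snorm \<Omega> (incr u j) \<le> Kt * h1snorm \<Omega> (resid ut u j)" if "j \<ge> 1" for j
        using Ktilde that unfolding e_def w_def by blast
      show "1 \<le> k - m" "k - m \<le> k" using kbig by auto
    qed (rule uV)
    moreover have "C3 * C6 * F / \<nu>\<^sup>2 * sqrt (l2norm \<Omega> What * h1snorm \<Omega> What) \<le>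
        C3 * C6 * F / \<nu>\<^sup>2 * (sqrt CP *
       (sqrt (l2norm \<Omega> What / l2norm \<Omega> (w k)) * sqrt (h1snorm \<Omega> Wa / h1snorm \<Omega> (w k))
        * sqrt (h1snorm \<Omega> What / h1snorm \<Omega> Wa) * sqrt (l2norm \<Omega> (w k) / (CP * h1snorm \<Omega> (w k))) * h1snorm \<Omega> (w k)))"
      using C F0 by (intro mult_left_mono gain) auto
    moreover have "Kt\<^sup>2 * P.M / \<nu> * P.\<kappa> * (real (k - (k - m)) * abar)
        * (\<Sum>j\<in>{k - m + 1..k}. \<Sum>i\<in>{k - m..j - 1}. h1snorm \<Omega> (w i) * h1snorm \<Omega> (w j))
      \<le> Kt\<^sup>2 * P.M / \<nu> * P.\<kappa> * (real (m * (m + 3)) * abar / 2)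
        * (\<Sum>j\<in>{k - m + 1..k}. \<Sum>i\<in>{k - m..j - 1}. h1snorm \<Omega> (w i) * h1snorm \<Omega> (w j))"
    proof (intro mult_right_mono mult_left_mono)
      \<comment> \<open>The window yields the constant m \<open>abar\<close>; this inequality passes
        to the m (m + 3) / 2 of the claim.\<close>
      have "2 * m \<le> m * (m + 3)" by (simp add: algebra_simps)
      then have "2 * real m \<le> real (m * (m + 3))" by linarith
      then have "2 * real m * abar \<le> real (m * (m + 3)) * abar" using abar by (intro mult_right_mono) auto
      then show "real (k - (k - m)) * abar \<le> real (m * (m + 3)) * abar / 2" using kbig by simp
      show "0 \<le> Kt\<^sup>2 * P.M / \<nu> * P.\<kappa>" using P.M_nonneg P.kappa_nonneg data(1) by simp
    qed (auto intro!: sum_nonneg mult_nonneg_nonneg B.h1snorm_nonneg)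
    \<comment> \<open>The square root of CP produced by \<open>gain\<close> completes the constant
      to \<kappa>.\<close>
    moreover have "C3 * C6 * F / \<nu>\<^sup>2 * (sqrt CP * (x1 * x2 * x3 * x4 * x5)) = \<kappa> * x1 * x2 * x3 * x4 * x5" for x1 x2 x3 x4 x5
      by (simp add: \<kappa>_def F_def)
    moreover have "P.M = M" "P.\<kappa> = \<kappa>" unfolding P.\<kappa>_def P.M_def M_def \<kappa>_def by (simp_all add: F_def)
    moreover have "l2norm \<Omega> (lin_comb (ah k) A (\<lambda>j. grad \<Omega> (w j))) = h1snorm \<Omega> What"
        "l2norm \<Omega> (lin_comb (a k) A (\<lambda>j. grad \<Omega> (w j))) = h1snorm \<Omega> Wa"
      unfolding What_def Wa_def by (rule B.h1snorm_lin_comb[OF A(1) HwA]; assumption)+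
    ultimately show ?thesis
      unfolding A_def[symmetric] What_def[symmetric] Wa_def[symmetric] by (simp only:)
  qed
qed

end
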